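(* Let $R\subset\mathbb{N}$ be a set enumerated by a regular sequence $(r_n)_{n\in\mathbb{N}}$. Then the first-order theory $\mathrm{Th}(\mathbb{Z},+,0,R)$ is superstable of Lascar rank $\omega$.
   Context: $\mathbb{N}$ contains $0$. A strictly increasing sequence $(r_n)_{n\in\mathbb{N}}$ of natural numbers is called regular if $r_{n+1}/r_n\to\theta$ for some $\theta\in\mathbb{R}^{>1}\cup\{\infty\}$ and, if $\theta$ is (a real number) algebraic over $\mathbb{Q}$, then $(r_n)$ satisfies a linear recurrence relation whose characteristic polynomial is the minimal polynomial of $\theta$ over $\mathbb{Q}$. Here, $(r_n)$ satisfies a linear recurrence relation if there are $a_0,\dots,a_{k-1}\in\mathbb{Q}$, with $k\ge 1$ minimal, such that $r_{n+k}=\sum_{i=0}^{k-1}a_ir_{n+i}$ for all $n\in\mathbb{N}$; its characteristic polynomial is $X^k-\sum_{i=0}^{k-1}a_iX^i$. In $(\mathbb{Z},+,0,R)$, $R$ is a unary predicate interpreted by the set $\{r_n\mid n\in\mathbb{N}\}$. The Lascar rank is the $U$-rank. *)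

theory Defs
  imports Complex_Main "HOL-Computational_Algebra.Polynomial"
begin

unbundle cardinal_syntax

section \<open>Regular sequences\<close>

definition satisfies_rec :: "(nat \<Rightarrow> nat) \<Rightarrow> nat \<Rightarrow> (nat \<Rightarrow> rat) \<Rightarrow> bool" where
  "satisfies_rec r k a \<longleftrightarrow>
     k \<ge> 1 \<and> (\<forall>n. (of_nat (r (n + k)) :: rat) = (\<Sum>i<k. a i * of_nat (r (n + i))))"

definition linear_recurrence :: "(nat \<Rightarrow> nat) \<Rightarrow> nat \<Rightarrow> (nat \<Rightarrow> rat) \<Rightarrow> bool" where
  "linear_recurrence r k a \<longleftrightarrow>
     satisfies_rec r k a \<and> (\<forall>k' a'. satisfies_rec r k' a' \<longrightarrow> k \<le> k')"

definition rec_char_poly :: "nat \<Rightarrow> (nat \<Rightarrow> rat) \<Rightarrow> rat poly" where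
  "rec_char_poly k a = monom 1 k - (\<Sum>i<k. monom (a i) i)"

definition is_min_poly :: "real \<Rightarrow> rat poly \<Rightarrow> bool" where
  "is_min_poly \<theta> p \<longleftrightarrow>
     lead_coeff p = 1 \<and> poly (map_poly of_rat p) \<theta> = 0 \<and>
     (\<forall>q. q \<noteq> 0 \<longrightarrow> poly (map_poly of_rat q) \<theta> = 0 \<longrightarrow> degree p \<le> degree q)"

text \<open>The two disjuncts are the cases of an infinite and of a real limit of the quotients.
  The quotient for \<open>r n = 0\<close>, which can only occur for \<open>n = 0\<close>, does not affect the limit.\<close>

definition regular :: "(nat \<Rightarrow> nat) \<Rightarrow> bool" where
  "regular r \<longleftrightarrow> strict_mono r \<and>
     (filterlim (\<lambda>n. real (r (Suc n)) / real (r n)) at_top sequentially \<or>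
      (\<exists>\<theta>>1. (\<lambda>n. real (r (Suc n)) / real (r n)) \<longlonglongrightarrow> \<theta> \<and>
         (algebraic \<theta> \<longrightarrow>
           (\<exists>k a. linear_recurrence r k a \<and> is_min_poly \<theta> (rec_char_poly k a)))))"


section \<open>First-order logic in the language \<open>(+, 0, R)\<close>\<close>

datatype tm = Var nat | Zero | Plus tm tm

datatype fm = Eq tm tm | InR tm | Neg fm | Conj fm fm | Ex nat fm

primrec fv_tm :: "tm \<Rightarrow> nat set" where
  "fv_tm (Var i) = {i}"
| "fv_tm Zero = {}"
| "fv_tm (Plus s t) = fv_tm s \<union> fv_tm t"

primrec fv :: "fm \<Rightarrow> nat set" where
  "fv (Eq s t) = fv_tm s \<union> fv_tm t"
| "fv (InR t) = fv_tm t"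
| "fv (Neg \<phi>) = fv \<phi>"
| "fv (Conj \<phi> \<psi>) = fv \<phi> \<union> fv \<psi>"
| "fv (Ex i \<phi>) = fv \<phi> - {i}"

text \<open>The universe of a structure is the whole type \<open>'m\<close>; arbitrary structures are covered by
  letting \<open>'m\<close> vary.\<close>

record 'm struc =
  zer :: 'm
  pls :: "'m \<Rightarrow> 'm \<Rightarrow> 'm"
  prd :: "'m set"

primrec eval :: "'m struc \<Rightarrow> (nat \<Rightarrow> 'm) \<Rightarrow> tm \<Rightarrow> 'm" where
  "eval M v (Var i) = v i"
| "eval M v Zero = zer M"
| "eval M v (Plus s t) = pls M (eval M v s) (eval M v t)"

primrec sat :: "'m struc \<Rightarrow> (nat \<Rightarrow> 'm) \<Rightarrow> fm \<Rightarrow> bool" where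
  "sat M v (Eq s t) \<longleftrightarrow> eval M v s = eval M v t"
| "sat M v (InR t) \<longleftrightarrow> eval M v t \<in> prd M"
| "sat M v (Neg \<phi>) \<longleftrightarrow> \<not> sat M v \<phi>"
| "sat M v (Conj \<phi> \<psi>) \<longleftrightarrow> sat M v \<phi> \<and> sat M v \<psi>"
| "sat M v (Ex i \<phi>) \<longleftrightarrow> (\<exists>x. sat M (v(i := x)) \<phi>)"

definition Th :: "'m struc \<Rightarrow> fm set" where
  "Th M = {\<phi>. fv \<phi> = {} \<and> (\<forall>v. sat M v \<phi>)}"

definition model :: "'m struc \<Rightarrow> fm set \<Rightarrow> bool" where
  "model M T \<longleftrightarrow> (\<forall>\<phi>\<in>T. \<forall>v. sat M v \<phi>)"

definition Z_struc :: "nat set \<Rightarrow> int struc" where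
  "Z_struc R = \<lparr>zer = 0, pls = (+), prd = int ` R\<rparr>"


section \<open>Types\<close>

text \<open>A formula with parameters is a pair \<open>(\<phi>, bs)\<close>. Among \<open>n\<close> object variables it stands for
  \<open>\<phi>(x\<^sub>0, \<dots>, x\<^sub>n\<^sub>-\<^sub>1, bs)\<close>: the variables \<open>0, \<dots>, n - 1\<close> are the object variables,
  and variable \<open>n + j\<close> is interpreted by the parameter \<open>bs ! j\<close>.\<close>

type_synonym 'm pfm = "fm \<times> 'm list"

definition Forms :: "nat \<Rightarrow> 'm set \<Rightarrow> 'm pfm set" where
  "Forms n A = {(\<phi>, bs). bs \<in> lists A \<and> fv \<phi> \<subseteq> {..<n + length bs}}"

definition holds :: "'m struc \<Rightarrow> 'm list \<Rightarrow> 'm pfm \<Rightarrow> bool" where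
  "holds M xs f \<longleftrightarrow> sat M ((!) (xs @ snd f)) (fst f)"

definition finitely_sat :: "'m struc \<Rightarrow> nat \<Rightarrow> 'm pfm set \<Rightarrow> bool" where
  "finitely_sat M n \<Phi> \<longleftrightarrow>
     (\<forall>\<Psi>. finite \<Psi> \<and> \<Psi> \<subseteq> \<Phi> \<longrightarrow> (\<exists>xs. length xs = n \<and> (\<forall>f\<in>\<Psi>. holds M xs f)))"

definition types :: "'m struc \<Rightarrow> nat \<Rightarrow> 'm set \<Rightarrow> 'm pfm set set" where
  "types M n A = {p. p \<subseteq> Forms n A \<and> finitely_sat M n p \<and>
     (\<forall>(\<phi>, bs) \<in> Forms n A. (\<phi>, bs) \<in> p \<or> (Neg \<phi>, bs) \<in> p)}"

definition tp :: "'m struc \<Rightarrow> 'm set \<Rightarrow> 'm list \<Rightarrow> 'm pfm set" where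
  "tp M A xs = {f \<in> Forms (length xs) A. holds M xs f}"


section \<open>Superstability\<close>

definition stable_in :: "'m itself \<Rightarrow> 'k rel \<Rightarrow> fm set \<Rightarrow> bool" where
  "stable_in _ \<kappa> T \<longleftrightarrow>
     (\<forall>(M :: 'm struc) A n. model M T \<longrightarrow> |A| \<le>o \<kappa> \<longrightarrow> |types M n A| \<le>o \<kappa>)"

text \<open>As the language is countable, \<open>T\<close> is superstable if it is stable in every cardinal
  \<open>\<kappa> \<ge> 2\<^bsup>\<aleph>\<^sub>0\<^esup>\<close>. The models range over the type \<open>'m\<close> and the cardinals over the type \<open>'k\<close>;
  HOL cannot quantify over types inside a definition, so superstability is the assertion for all
  instances of these two type parameters.\<close>

definition superstable :: "'m itself \<Rightarrow> 'k itself \<Rightarrow> fm set \<Rightarrow> bool" where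
  "superstable m _ T \<longleftrightarrow>
     (\<forall>\<kappa> :: 'k rel. Card_order \<kappa> \<and> |UNIV :: nat set set| \<le>o \<kappa> \<longrightarrow> stable_in m \<kappa> T)"


section \<open>Forking and the Lascar rank\<close>

text \<open>In this section \<open>M\<close> is a \<open>\<kappa>\<close>-saturated model with \<open>\<kappa>\<close> uncountable, playing the role of the
  monster model; a set of parameters is small if its cardinality is less than \<open>\<kappa>\<close>. An infinite
  \<open>\<kappa>\<close>-saturated structure has at least \<open>\<kappa>\<close> elements, so that it is no restriction to represent
  \<open>\<kappa>\<close> on the type \<open>'m\<close>.\<close>

definition saturated :: "'m rel \<Rightarrow> 'm struc \<Rightarrow> bool" where
  "saturated \<kappa> M \<longleftrightarrow>
     (\<forall>A n p. |A| <o \<kappa> \<longrightarrow> p \<in> types M n A \<longrightarrow>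
        (\<exists>xs. length xs = n \<and> (\<forall>f\<in>p. holds M xs f)))"

definition monster :: "'m rel \<Rightarrow> 'm struc \<Rightarrow> bool" where
  "monster \<kappa> M \<longleftrightarrow> Card_order \<kappa> \<and> natLeq <o \<kappa> \<and> saturated \<kappa> M"

text \<open>\<open>\<phi>(x, b)\<close> divides over \<open>A\<close> if there are realizations \<open>c\<^sub>0, c\<^sub>1, \<dots>\<close> of the type of \<open>b\<close>
  over \<open>A\<close> such that \<open>{\<phi>(x, c\<^sub>i)}\<close> is \<open>k\<close>-inconsistent for some \<open>k\<close>.\<close>

definition divides :: "'m struc \<Rightarrow> nat \<Rightarrow> 'm set \<Rightarrow> 'm pfm \<Rightarrow> bool" where
  "divides M n A f \<longleftrightarrow> f \<in> Forms n UNIV \<and>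
     (\<exists>(c :: nat \<Rightarrow> 'm list) k.
        (\<forall>i. length (c i) = length (snd f) \<and> tp M A (c i) = tp M A (snd f)) \<and>
        (\<forall>I. finite I \<and> card I = k \<longrightarrow>
           \<not> (\<exists>xs. length xs = n \<and> (\<forall>i\<in>I. holds M xs (fst f, c i)))))"

definition forks :: "'m struc \<Rightarrow> nat \<Rightarrow> 'm set \<Rightarrow> 'm pfm set \<Rightarrow> bool" where
  "forks M n A \<pi> \<longleftrightarrow>
     (\<exists>\<Delta>. finite \<Delta> \<and> (\<forall>d\<in>\<Delta>. divides M n A d) \<and>
        (\<forall>xs. length xs = n \<and> (\<forall>f\<in>\<pi>. holds M xs f) \<longrightarrow> (\<exists>d\<in>\<Delta>. holds M xs d)))"

definition forking_ext ::
    "'m rel \<Rightarrow> 'm struc \<Rightarrow> 'm set \<Rightarrow> 'm pfm set \<Rightarrow> 'm set \<Rightarrow> 'm pfm set \<Rightarrow> bool" where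
  "forking_ext \<kappa> M A p B q \<longleftrightarrow>
     A \<subseteq> B \<and> |B| <o \<kappa> \<and> q \<in> types M 1 B \<and> p \<subseteq> q \<and> forks M 1 A q"

text \<open>Ordinals are represented by well-orders and compared by \<open><o\<close>. For a complete 1-type \<open>p\<close>
  over \<open>A\<close>, \<open>U_ge \<kappa> M \<alpha> A p\<close> means \<open>U(p) \<ge> \<alpha>\<close>: for every \<open>\<beta> < \<alpha>\<close> there is a forking extension
  \<open>q\<close> of \<open>p\<close> with \<open>U(q) \<ge> \<beta>\<close>. As \<open><o\<close> is well-founded, this inductive definition is a
  recursion on \<open>\<alpha>\<close>. It suffices to let \<open>\<beta>\<close> range over the well-orders on the type of \<open>\<alpha>\<close>,
  because these include all proper initial segments of \<open>\<alpha>\<close>.\<close>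

inductive U_ge :: "'m rel \<Rightarrow> 'm struc \<Rightarrow> 'o rel \<Rightarrow> 'm set \<Rightarrow> 'm pfm set \<Rightarrow> bool"
  for \<kappa> M where
  "(\<And>\<beta>. \<beta> <o \<alpha> \<Longrightarrow> \<exists>B q. forking_ext \<kappa> M A p B q \<and> U_ge \<kappa> M \<beta> B q) \<Longrightarrow> U_ge \<kappa> M \<alpha> A p"

text \<open>\<open>U(p) > \<alpha>\<close>, that is, \<open>U(p) \<ge> \<alpha> + 1\<close>.\<close>

definition U_gt :: "'m rel \<Rightarrow> 'm struc \<Rightarrow> 'o rel \<Rightarrow> 'm set \<Rightarrow> 'm pfm set \<Rightarrow> bool" where
  "U_gt \<kappa> M \<alpha> A p \<longleftrightarrow> (\<exists>B q. forking_ext \<kappa> M A p B q \<and> U_ge \<kappa> M \<alpha> B q)"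

text \<open>The Lascar rank of \<open>T\<close> is the supremum of the ranks \<open>U(p)\<close> of the complete 1-types \<open>p\<close>
  over the empty set. It is computed in an arbitrary sufficiently saturated model; as above, the
  notion is the assertion for all instances of \<open>'m\<close>. (Already \<open>nat set\<close> carries
  \<open>\<aleph>\<^sub>1\<close>-saturated models of every theory with an infinite model.)\<close>

definition lascar_rank :: "'m itself \<Rightarrow> fm set \<Rightarrow> 'o rel \<Rightarrow> bool" where
  "lascar_rank _ T \<alpha> \<longleftrightarrow> Well_order \<alpha> \<and>
     (\<forall>\<kappa> (M :: 'm struc). model M T \<and> monster \<kappa> M \<longrightarrow>
        (\<forall>p \<in> types M 1 {}. \<not> U_gt \<kappa> M \<alpha> {} p) \<and>
        (\<forall>\<beta> :: 'o rel. \<beta> <o \<alpha> \<longrightarrow> (\<exists>p \<in> types M 1 {}. U_gt \<kappa> M \<beta> {} p)))"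

end

theory Submission
  imports Defs "HOL-Library.Countable_Set_Type"
begin

text \<open>Models of the theory are studied inside an ultrapower of \<open>\<int>\<close>: one that is
  \<open>\<aleph>\<^sub>1\<close>-saturated and into which the given model embeds elementarily, in such a way that all
  types over the model are realized there. In the ultrapower, \<open>R\<close> consists of the terms
  \<open>r\<^sub>m\<close> with a possibly nonstandard index \<open>m\<close>. These fall into chains: two of them belong
  to the same chain if their indices differ by a standard integer.

  Regularity of the sequence is used for two facts of growth. An integer combination
  \<open>\<Sum>\<^sub>k c\<^sub>k r\<^sub>n\<^sub>+\<^sub>k\<close> either vanishes for all \<open>n\<close> or is not small compared to \<open>r\<^sub>n\<close>
  (\<open>int_comb_dominates\<close>; the recurrence is needed when the combination vanishes at an
  algebraic limit), and \<open>r\<^sub>j\<close> is negligible against \<open>r\<^sub>n\<close> if \<open>j\<close> is far below \<open>n\<close>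
  (\<open>gaps_grow\<close>). Hence a linear relation between members of \<open>R\<close> splits into relations
  within the chains (\<open>chains_independent\<close>), and the relations within a nonstandard chain
  are the same for all of these (\<open>chain_relation_iff\<close>).

  A pure subgroup is called good if no combination of members of \<open>R\<close> outside it lies in it,
  except for those that vanish. Consider isomorphisms between good pure subgroups that
  respect \<open>R\<close> and divisibility by standard integers. They can be extended by a new chain,
  and by an element that is independent of the subgroup and \<open>R\<close>, and the only further
  condition is that the residues modulo standard integers agree (\<open>piso_chain\<close>,
  \<open>piso_generic\<close>). The countable ones therefore form a back-and-forth system and preserve
  all formulas (\<open>piso_sat\<close>). Conversely, if two tuples have the same type, then such an
  isomorphism takes one to the other (\<open>teq_piso\<close>).

  Superstability (\<open>card_types_le\<close>): a tuple is contained in the subgroup generated by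
  finitely many chains and independent elements over a good hull of the parameters, of
  cardinality at most \<open>\<kappa>\<close>. The type of the tuple is determined by the residues of these
  generators, for which there are \<open>2\<^bsup>\<aleph>\<^sub>0\<^esup>\<close> possibilities, and by finitely many elements of
  the hull.

  Upper bound for the rank (\<open>not_U_gt_omega\<close>): algebraic closures are good (\<open>good_Acl\<close>). If
  \<open>a\<close> is independent of \<open>acl(C)\<close> and \<open>R\<close>, or if a multiple of \<open>a\<close> is the sum of an element
  of \<open>acl(B)\<close> and of multiples of members of \<open>R\<close> that are not algebraic over \<open>C \<supseteq> B\<close>, then
  the type of \<open>a\<close> over \<open>C\<close> does not fork over \<open>B\<close> (\<open>free_not_forks\<close>). So the first forking
  extension yields a multiple of \<open>a\<close> that is the sum of an algebraic element and of
  multiples of finitely many members of \<open>R\<close>, and every further one makes one more of these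
  members algebraic. Hence the rank is finite after the first extension.

  Lower bound (\<open>U_gt_finite\<close>): the sum of \<open>L\<close> members of different nonstandard chains has
  rank at least \<open>L\<close>, because the type forks whenever one more summand is added to the
  parameters.\<close>

section \<open>Ultrafilters and internal saturation\<close>

definition ultra :: "'i filter \<Rightarrow> bool" where
  "ultra F \<longleftrightarrow> F \<noteq> bot \<and> (\<forall>P. eventually P F \<or> eventually (\<lambda>i. \<not> P i) F)"

lemma ex_ultra:
  fixes F0 :: "'i filter"
  assumes "F0 \<noteq> bot"
  shows "\<exists>F. ultra F \<and> F \<le> F0"
proof -
  define A where "A = {F. F \<noteq> bot \<and> F \<le> F0}"
  \<comment> \<open>A minimal proper filter is wanted, so the order is reversed for Zorn's lemma.\<close>
  define P where "P = (\<lambda>F G :: 'i filter. G \<le> F)"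
  have "\<exists>m\<in>A. \<forall>a\<in>A. P m a \<longrightarrow> a = m"
  proof (rule predicate_Zorn)
    show "partial_order_on A (relation_of P A)"
      by (rule partial_order_on_relation_ofI) (auto simp: P_def)
    fix C assume C: "C \<in> Chains (relation_of P A)"
    show "\<exists>u\<in>A. \<forall>a\<in>C. P a u"
    proof (cases "C = {}")
      case True then show ?thesis using assms by (auto simp: A_def)
    next
      case False
      have CA: "C \<subseteq> A" using C by (auto simp: Chains_def relation_of_def)
      have "eventually Q (Inf C) \<longleftrightarrow> (\<exists>b\<in>C. eventually Q b)" for Q
      proof (rule eventually_Inf_base[OF False])
        fix F G assume "F \<in> C" "G \<in> C"
        then have "F \<le> G \<or> G \<le> F"
          using C by (auto simp: Chains_def relation_of_def P_def)
        then show "\<exists>x\<in>C. x \<le> inf F G"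
          using \<open>F \<in> C\<close> \<open>G \<in> C\<close> by (auto simp: le_inf_iff)
      qed
      then have "Inf C \<noteq> bot"
        using CA by (auto simp: A_def trivial_limit_def)
      moreover have "Inf C \<le> F0"
        using CA False by (auto simp: A_def intro: Inf_lower2)
      ultimately have "Inf C \<in> A" by (simp add: A_def)
      then show ?thesis by (auto simp: P_def intro: Inf_lower)
    qed
  qed
  then obtain F where F: "F \<noteq> bot" "F \<le> F0"
    and max: "\<And>G. G \<noteq> bot \<Longrightarrow> G \<le> F \<Longrightarrow> G = F"
    by (auto simp: A_def P_def intro: order_trans)
  have "eventually Q F \<or> eventually (\<lambda>i. \<not> Q i) F" for Q
  proof (rule disjCI)
    assume "\<not> eventually (\<lambda>i. \<not> Q i) F"
    then have "inf F (principal {i. Q i}) \<noteq> bot"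
      by (simp add: trivial_limit_def eventually_inf_principal)
    then have "inf F (principal {i. Q i}) = F" by (rule max) simp
    moreover have "eventually Q (inf F (principal {i. Q i}))"
      by (simp add: eventually_inf_principal)
    ultimately show "eventually Q F" by simp
  qed
  with F show ?thesis by (auto simp: ultra_def)
qed

text \<open>The copy of the natural numbers in the index set makes the ultrafilter countably
  incomplete, which gives \<open>\<aleph>\<^sub>1\<close>-saturation of the ultrapower. The finite subsets of \<open>'a\<close>
  serve to satisfy conditions indexed by \<open>'a\<close> simultaneously, where any finitely many can
  be satisfied.\<close>

definition uf :: "(nat \<times> 'a set) filter" where
  "uf = (SOME F. ultra F \<and> F \<le> at_top \<times>\<^sub>F finite_subsets_at_top UNIV)"

lemma uf: "ultra (uf :: (nat \<times> 'a set) filter)"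
  and uf_le: "(uf :: (nat \<times> 'a set) filter) \<le> at_top \<times>\<^sub>F finite_subsets_at_top UNIV"
proof -
  have "(at_top \<times>\<^sub>F finite_subsets_at_top UNIV :: (nat \<times> 'a set) filter) \<noteq> bot"
    by (simp add: prod_filter_eq_bot)
  from someI_ex[OF ex_ultra[OF this]]
  show "ultra (uf :: (nat \<times> 'a set) filter)"
    "(uf :: (nat \<times> 'a set) filter) \<le> at_top \<times>\<^sub>F finite_subsets_at_top UNIV"
    unfolding uf_def by blast+
qed

lemma uf_neq_bot [simp]: "uf \<noteq> bot"
  using uf by (auto simp: ultra_def)

lemma ev_not: "(\<forall>\<^sub>F i in uf. \<not> P i) \<longleftrightarrow> \<not> (\<forall>\<^sub>F i in uf. P i)"
proof
  assume "\<forall>\<^sub>F i in uf. \<not> P i"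
  show "\<not> (\<forall>\<^sub>F i in uf. P i)"
  proof
    assume "\<forall>\<^sub>F i in uf. P i"
    with \<open>\<forall>\<^sub>F i in uf. \<not> P i\<close> have "\<forall>\<^sub>F i in uf. \<not> P i \<and> P i" by (rule eventually_conj)
    then show False by (simp add: eventually_False)
  qed
qed (use uf in \<open>auto simp: ultra_def\<close>)

lemma ev_disj: "(\<forall>\<^sub>F i in uf. P i \<or> Q i) \<longleftrightarrow> (\<forall>\<^sub>F i in uf. P i) \<or> (\<forall>\<^sub>F i in uf. Q i)"
proof -
  have "(\<forall>\<^sub>F i in uf. P i \<or> Q i) \<longleftrightarrow> \<not> (\<forall>\<^sub>F i in uf. \<not> P i \<and> \<not> Q i)"
    by (simp add: ev_not[symmetric])
  then show ?thesis by (simp add: eventually_conj_iff ev_not)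
qed

lemma ev_ex: "(\<forall>\<^sub>F i in uf. \<exists>y. P i y) \<longleftrightarrow> (\<exists>Y. \<forall>\<^sub>F i in uf. P i (Y i))"
proof
  assume "\<forall>\<^sub>F i in uf. \<exists>y. P i y"
  then have "\<forall>\<^sub>F i in uf. P i (SOME y. P i y)" by eventually_elim (rule someI_ex)
  then show "\<exists>Y. \<forall>\<^sub>F i in uf. P i (Y i)" by (rule exI[of _ "\<lambda>i. SOME y. P i y"])
qed (auto elim: eventually_mono)

lemma ev_finite_ex:
  assumes "finite K"
  shows "(\<forall>\<^sub>F i in uf. \<exists>k\<in>K. P k i) \<longleftrightarrow> (\<exists>k\<in>K. \<forall>\<^sub>F i in uf. P k i)"
  using assms by induction (auto simp: ev_disj)

text \<open>The three properties of the ultrafilter that are used besides its being an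
  ultrafilter.\<close>

lemma ev_contains: "\<forall>\<^sub>F i in uf. (x :: 'a) \<in> snd i"
  and ev_finite: "\<forall>\<^sub>F i in (uf :: (nat \<times> 'a set) filter). finite (snd i)"
  and ev_ge: "\<forall>\<^sub>F i in (uf :: (nat \<times> 'a set) filter). k \<le> fst i"
proof -
  have *: "eventually P (uf :: (nat \<times> 'a set) filter)" if
    "eventually P (at_top \<times>\<^sub>F finite_subsets_at_top UNIV)" for P
    using uf_le that by (rule filter_leD)
  have "\<forall>\<^sub>F X in finite_subsets_at_top UNIV. x \<in> X \<and> finite X"
    unfolding eventually_finite_subsets_at_top by (rule exI[of _ "{x}"]) auto
  moreover have "\<forall>\<^sub>F n in at_top. k \<le> (n :: nat)" by (rule eventually_ge_at_top)
  ultimately have "\<forall>\<^sub>F i in at_top \<times>\<^sub>F finite_subsets_at_top UNIV. k \<le> fst i \<and> x \<in> snd i \<and> finite (snd i)"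
    by (auto simp: eventually_prod_filter intro!: exI[of _ "\<lambda>n. k \<le> n"] exI[of _ "\<lambda>X. x \<in> X \<and> finite X"])
  from *[OF this] show "\<forall>\<^sub>F i in uf. x \<in> snd i" "\<forall>\<^sub>F i in (uf :: (nat \<times> 'a set) filter). finite (snd i)"
    "\<forall>\<^sub>F i in (uf :: (nat \<times> 'a set) filter). k \<le> fst i"
    by (auto simp: eventually_conj_iff)
qed

lemma finite_subset_Un_image:
  assumes "finite J" "J \<subseteq> f ` A \<union> g ` B"
  obtains F G where "finite F" "F \<subseteq> A" "finite G" "G \<subseteq> B" "J = f ` F \<union> g ` G"
proof -
  have "finite (J \<inter> f ` A)" "J \<inter> f ` A \<subseteq> f ` A" "finite (J \<inter> g ` B)" "J \<inter> g ` B \<subseteq> g ` B"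
    using assms(1) by auto
  then obtain F G where "F \<subseteq> A" "finite F" "J \<inter> f ` A = f ` F" "G \<subseteq> B" "finite G" "J \<inter> g ` B = g ` G"
    by (meson finite_subset_image)
  moreover have "J = (J \<inter> f ` A) \<union> (J \<inter> g ` B)" using assms(2) by blast
  ultimately show thesis by (intro that[of F G]) simp_all
qed

text \<open>At the index \<open>i\<close>, as many of the conditions are satisfied together as possible, but at
  most \<open>fst i\<close> of them; this bound makes the greatest such number exist, and it exceeds
  every \<open>k\<close> almost everywhere.\<close>

lemma internal_saturation:
  assumes "countable C"
    and fin: "\<And>J. finite J \<Longrightarrow> J \<subseteq> C \<Longrightarrow> \<forall>\<^sub>F i in uf. \<exists>x. \<forall>q\<in>J. q i x"
  shows "\<exists>X. \<forall>q\<in>C. \<forall>\<^sub>F i in uf. q i (X i)"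
proof (cases "C = {}")
  case False
  define q where "q = from_nat_into C"
  have C: "C = range q" by (simp add: q_def False assms(1) range_from_nat_into)
  define good where "good = (\<lambda>i K. \<exists>x. \<forall>k<K. q k i x)"
  define K where "K i = (GREATEST K. K \<le> fst i \<and> good i K)" for i
  have K: "K i \<le> fst i \<and> good i (K i)" for i
    unfolding K_def by (rule GreatestI_nat[of _ 0 "fst i"]) (auto simp: good_def)
  define X where "X i = (SOME x. \<forall>k<K i. q k i x)" for i
  have X: "k < K i \<Longrightarrow> q k i (X i)" for i k
    using someI_ex[of "\<lambda>x. \<forall>k<K i. q k i x"] K[of i] by (auto simp: X_def good_def)
  have "\<forall>\<^sub>F i in uf. q k i (X i)" for k
  proof -
    have "\<forall>\<^sub>F i in uf. \<exists>x. \<forall>p\<in>q ` {..k}. p i x" by (rule fin) (auto simp: C)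
    then have "\<forall>\<^sub>F i in uf. good i (Suc k)"
      by (rule eventually_mono) (auto simp: good_def less_Suc_eq_le)
    with ev_ge[of "Suc k"] show ?thesis
    proof eventually_elim
      case (elim i)
      have "Suc k \<le> K i" unfolding K_def by (rule Greatest_le_nat[of _ _ "fst i"]) (use elim in auto)
      then show ?case by (intro X) auto
    qed
  qed
  then show ?thesis by (intro exI[of _ X]) (auto simp: C)
qed auto


section \<open>Nonstandard integers\<close>

quotient_type 'a hyp = "nat \<times> 'a set \<Rightarrow> int" / "\<lambda>x y. \<forall>\<^sub>F i in uf. x i = y i"
proof (rule equivpI)
  show "reflp (\<lambda>x y :: nat \<times> 'a set \<Rightarrow> int. \<forall>\<^sub>F i in uf. x i = y i)" by (rule reflpI) simp
  show "symp (\<lambda>x y :: nat \<times> 'a set \<Rightarrow> int. \<forall>\<^sub>F i in uf. x i = y i)"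
    by (rule sympI) (auto elim: eventually_mono)
  show "transp (\<lambda>x y :: nat \<times> 'a set \<Rightarrow> int. \<forall>\<^sub>F i in uf. x i = y i)"
    by (rule transpI) (auto elim: eventually_elim2)
qed

instantiation hyp :: (type) idom
begin

lift_definition zero_hyp :: "'a hyp" is "\<lambda>_. 0" .
lift_definition one_hyp :: "'a hyp" is "\<lambda>_. 1" .
lift_definition plus_hyp :: "'a hyp \<Rightarrow> 'a hyp \<Rightarrow> 'a hyp" is "\<lambda>x y i. x i + y i"
  by (auto elim: eventually_elim2)
lift_definition times_hyp :: "'a hyp \<Rightarrow> 'a hyp \<Rightarrow> 'a hyp" is "\<lambda>x y i. x i * y i"
  by (auto elim: eventually_elim2)
lift_definition minus_hyp :: "'a hyp \<Rightarrow> 'a hyp \<Rightarrow> 'a hyp" is "\<lambda>x y i. x i - y i"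
  by (auto elim: eventually_elim2)
lift_definition uminus_hyp :: "'a hyp \<Rightarrow> 'a hyp" is "\<lambda>x i. - x i"
  by (auto elim: eventually_mono)

instance
proof
  fix a b c :: "'a hyp"
  show "a * b * c = a * (b * c)" "a * b = b * a" "1 * a = a" "a + b + c = a + (b + c)"
    "a + b = b + a" "0 + a = a" "- a + a = 0" "a - b = a + - b" "(a + b) * c = a * c + b * c"
    "0 * a = 0" "a * 0 = 0" "a * (b + c) = a * b + a * c"
    by (transfer; simp add: algebra_simps)+
  show "0 \<noteq> (1 :: 'a hyp)" by transfer (simp add: eventually_False)
  show "a \<noteq> 0 \<Longrightarrow> b \<noteq> 0 \<Longrightarrow> a * b \<noteq> 0"
    by transfer (simp add: ev_not[symmetric], erule (1) eventually_elim2, simp)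
qed

end

definition hyp :: "(nat \<times> 'a set \<Rightarrow> int) \<Rightarrow> 'a hyp" where
  "hyp = abs_hyp"

definition coord :: "'a hyp \<Rightarrow> nat \<times> 'a set \<Rightarrow> int" where
  "coord = rep_hyp"

lemma hyp_coord [simp]: "hyp (coord x) = x"
  unfolding hyp_def coord_def by (rule Quotient_abs_rep[OF Quotient_hyp])

lemma hyp_eq_iff: "hyp x = hyp y \<longleftrightarrow> (\<forall>\<^sub>F i in uf. x i = y i)"
  unfolding hyp_def by (rule hyp.abs_eq_iff)

lemma hyp_add: "hyp x + hyp y = hyp (\<lambda>i. x i + y i)"
  and hyp_mult: "hyp x * hyp y = hyp (\<lambda>i. x i * y i)"
  and hyp_diff: "hyp x - hyp y = hyp (\<lambda>i. x i - y i)"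
  and hyp_minus: "- hyp x = hyp (\<lambda>i. - x i)"
  unfolding hyp_def
  by (simp_all add: plus_hyp.abs_eq times_hyp.abs_eq minus_hyp.abs_eq uminus_hyp.abs_eq)

lemma hyp_zero: "0 = hyp (\<lambda>_. 0)" and hyp_one: "1 = hyp (\<lambda>_. 1)"
  by (simp_all add: hyp_def zero_hyp.abs_eq one_hyp.abs_eq)

lemma hyp_of_nat: "of_nat n = hyp (\<lambda>_. int n)"
  by (induction n) (simp_all add: hyp_zero hyp_one hyp_add)

lemma hyp_of_int: "of_int n = hyp (\<lambda>_. n)"
proof (cases n)
  case (nonneg n) then show ?thesis by (simp add: hyp_of_nat)
next
  case (neg k)
  then have "of_int n = - (of_nat (Suc k) :: 'a hyp)" by simp
  also have "\<dots> = hyp (\<lambda>_. - int (Suc k))" by (simp only: hyp_of_nat hyp_minus)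
  finally show ?thesis using neg by simp
qed

instance hyp :: (type) ring_char_0
proof
  show "inj (of_nat :: nat \<Rightarrow> 'a hyp)"
    by (rule injI) (simp add: hyp_of_nat hyp_eq_iff)
qed

lemma hyp_dvd_iff: "of_int n dvd hyp x \<longleftrightarrow> (\<forall>\<^sub>F i in uf. n dvd x i)"
proof
  assume "of_int n dvd hyp x"
  then obtain z where "hyp x = of_int n * z" by (auto elim: dvdE)
  then have "hyp x = hyp (\<lambda>i. n * coord z i)"
    using hyp_mult[of "\<lambda>_. n" "coord z"] by (simp add: hyp_of_int)
  then have "\<forall>\<^sub>F i in uf. x i = n * coord z i" by (simp add: hyp_eq_iff)
  then show "\<forall>\<^sub>F i in uf. n dvd x i" by (rule eventually_mono) simp
next
  assume "\<forall>\<^sub>F i in uf. n dvd x i"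
  then have "\<forall>\<^sub>F i in uf. \<exists>y. x i = n * y" by (simp add: dvd_def)
  then obtain y where "\<forall>\<^sub>F i in uf. x i = n * y i" by (auto simp: ev_ex)
  then have "hyp x = of_int n * hyp y" by (simp add: hyp_eq_iff hyp_of_int hyp_mult)
  then show "of_int n dvd hyp x" by simp
qed

lemma hyp_ex: "(\<exists>z. P z) \<longleftrightarrow> (\<exists>y. P (hyp y))"
  by (metis hyp_coord)

text \<open>There are only finitely many standard residues, so one of them occurs almost
  everywhere.\<close>

lemma residue_ex:
  assumes "n \<noteq> 0"
  shows "\<exists>j. of_int n dvd (x :: 'a hyp) - of_int j"
proof -
  have "\<forall>\<^sub>F i in uf. \<exists>j\<in>{0..<\<bar>n\<bar>}. n dvd coord x i - j"
  proof (rule always_eventually, rule allI)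
    fix i
    have "n dvd coord x i - coord x i mod \<bar>n\<bar>"
      by (metis abs_dvd_iff minus_mod_eq_mult_div dvd_triv_left)
    then show "\<exists>j\<in>{0..<\<bar>n\<bar>}. n dvd coord x i - j" using assms by (intro bexI) auto
  qed
  then obtain j where "\<forall>\<^sub>F i in uf. n dvd coord x i - j" by (subst (asm) ev_finite_ex) auto
  then have "of_int n dvd hyp (coord x) - of_int j"
    unfolding hyp_of_int[of j] hyp_diff hyp_dvd_iff .
  then show ?thesis by auto
qed


section \<open>Integer linear combinations\<close>

text \<open>Combinations are given by lists of coefficients and indices. Repetitions are harmless,
  and lists are easily concatenated, filtered and transported along maps of the indices.\<close>

definition lin :: "('z \<Rightarrow> 'n :: comm_ring_1) \<Rightarrow> (int \<times> 'z) list \<Rightarrow> 'n" where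
  "lin f l = (\<Sum>(c, z)\<leftarrow>l. of_int c * f z)"

lemma lin_simps [simp]:
  "lin f [] = 0" "lin f ((c, z) # l) = of_int c * f z + lin f l" "lin f (l @ l') = lin f l + lin f l'"
  by (simp_all add: lin_def)

definition scale :: "int \<Rightarrow> (int \<times> 'z) list \<Rightarrow> (int \<times> 'z) list" where
  "scale n = map (\<lambda>(c, z). (n * c, z))"

lemma lin_scale [simp]: "lin f (scale n l) = of_int n * lin f l"
  by (induction l) (auto simp: scale_def algebra_simps)

lemma snd_scale [simp]: "snd ` set (scale n l) = snd ` set l"
  by (force simp: scale_def)

lemma lin_map: "lin f (map (\<lambda>(c, z). (c, g z)) l) = lin (\<lambda>z. f (g z)) l"
  by (induction l) auto

lemma lin_cong: "(\<And>z. z \<in> snd ` set l \<Longrightarrow> f z = g z) \<Longrightarrow> lin f l = lin g l"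
  by (induction l) (auto simp: image_iff)

lemma lin_filter: "lin f l = lin f (filter P l) + lin f (filter (\<lambda>x. \<not> P x) l)"
  by (induction l) auto

lemma lin_hyp: "lin (\<lambda>z. hyp (f z)) l = hyp (\<lambda>i. lin (\<lambda>z. f z i) l)"
  by (induction l) (auto simp: hyp_zero hyp_add hyp_mult hyp_of_int)

lemma lin_abs_le:
  assumes "\<And>z. z \<in> snd ` set l \<Longrightarrow> \<bar>real_of_int (f z)\<bar> \<le> B"
  shows "\<bar>real_of_int (lin f l)\<bar> \<le> (\<Sum>(c, z)\<leftarrow>l. \<bar>real_of_int c\<bar>) * B"
  using assms
proof (induction l)
  case (Cons p l)
  obtain c z where p: "p = (c, z)" by (cases p)
  have "\<bar>real_of_int (c * f z)\<bar> \<le> \<bar>real_of_int c\<bar> * B"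
    using Cons.prems[of z] by (simp add: p abs_mult mult_left_mono)
  moreover have "\<bar>real_of_int (lin f l)\<bar> \<le> (\<Sum>(c, z)\<leftarrow>l. \<bar>real_of_int c\<bar>) * B"
    using Cons by simp
  ultimately show ?case
    by (simp add: p distrib_right)
qed simp

lemma lin_id_map: "lin id (map (\<lambda>(c, k). (c, f k)) l) = lin f l"
  by (simp add: lin_map)

text \<open>A combination of pairs \<open>(f k, g k)\<close> is the same combination of the \<open>f k\<close> and of the
  \<open>g k\<close>.\<close>

lemma pair_list:
  assumes "snd ` set l \<subseteq> (\<lambda>k. (f k, g k)) ` K"
  shows "\<exists>l'. snd ` set l' \<subseteq> K \<and> lin fst l = lin f l' \<and> lin snd l = lin g l'"
  using assms
proof (induction l)
  case Nil then show ?case by (intro exI[of _ "[]"]) simp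
next
  case (Cons p l)
  then obtain l' where l': "snd ` set l' \<subseteq> K" "lin fst l = lin f l'" "lin snd l = lin g l'" by auto
  from Cons.prems obtain c k where "p = (c, (f k, g k))" "k \<in> K" by (cases p) auto
  then show ?case using l' by (intro exI[of _ "(c, k) # l'"]) auto
qed

lemma snd_append: "snd ` set (l @ l') = snd ` set l \<union> snd ` set l'"
  by auto

lemma lin_ones: "lin f (map (\<lambda>e. (1, g e)) xs) = (\<Sum>e\<leftarrow>xs. f (g e))"
  by (induction xs) auto


section \<open>Pure subgroups\<close>

text \<open>Pure subgroups: divisibility of an element of the subgroup has the same meaning in the
  subgroup and in the whole group.\<close>

definition psub :: "'a hyp set \<Rightarrow> bool" where
  "psub A \<longleftrightarrow> 0 \<in> A \<and> (\<forall>x\<in>A. \<forall>y\<in>A. x - y \<in> A) \<and> (\<forall>n x. n \<noteq> 0 \<longrightarrow> of_int n * x \<in> A \<longrightarrow> x \<in> A)"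

lemma psubD:
  assumes "psub A"
  shows psub_0: "0 \<in> A"
    and psub_diff: "x \<in> A \<Longrightarrow> y \<in> A \<Longrightarrow> x - y \<in> A"
    and psub_pure: "n \<noteq> 0 \<Longrightarrow> of_int n * x \<in> A \<Longrightarrow> x \<in> A"
  using assms by (auto simp: psub_def)

lemma psub_minus: "psub A \<Longrightarrow> x \<in> A \<Longrightarrow> - x \<in> A"
  using psub_diff[of A 0 x] psub_0[of A] by simp

lemma psub_add: "psub A \<Longrightarrow> x \<in> A \<Longrightarrow> y \<in> A \<Longrightarrow> x + y \<in> A"
  using psub_diff[of A x "- y"] psub_minus[of A y] by simp

lemma psub_mult: "psub A \<Longrightarrow> x \<in> A \<Longrightarrow> of_int n * x \<in> A"
proof -
  assume A: "psub A" "x \<in> A"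
  have *: "of_nat k * x \<in> A" for k
    by (induction k) (use A in \<open>auto simp: distrib_right psub_0 intro: psub_add\<close>)
  show ?thesis
  proof (cases "n \<ge> 0")
    case True then show ?thesis using *[of "nat n"] by simp
  next
    case False then show ?thesis using psub_minus[OF A(1) *[of "nat (- n)"]] by simp
  qed
qed

lemma psub_lin: "psub A \<Longrightarrow> (\<And>z. z \<in> snd ` set l \<Longrightarrow> f z \<in> A) \<Longrightarrow> lin f l \<in> A"
  by (induction l) (auto simp: psub_0 intro!: psub_add psub_mult)

lemma psub_of_int: "psub A \<Longrightarrow> 1 \<in> A \<Longrightarrow> of_int n \<in> A"
  using psub_mult[of A 1 n] by simp

lemma psub_of_nat: "psub A \<Longrightarrow> 1 \<in> A \<Longrightarrow> of_nat n \<in> A"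
  using psub_of_int[of A "int n"] by simp

lemma psub_UNIV: "psub UNIV"
  by (simp add: psub_def)

text \<open>The pure subgroup generated by a set.\<close>

definition qspan :: "'a hyp set \<Rightarrow> 'a hyp set" where
  "qspan Y = {x. \<exists>n l. n \<noteq> 0 \<and> snd ` set l \<subseteq> Y \<and> of_int n * x = lin id l}"

lemma qspanI: "n \<noteq> 0 \<Longrightarrow> snd ` set l \<subseteq> Y \<Longrightarrow> of_int n * x = lin id l \<Longrightarrow> x \<in> qspan Y"
  unfolding qspan_def by blast

lemma qspanE:
  assumes "x \<in> qspan Y"
  obtains n l where "n \<noteq> 0" "snd ` set l \<subseteq> Y" "of_int n * x = lin id l"
  using assms unfolding qspan_def by blast

lemma qspan_base: "Y \<subseteq> qspan Y"
  by (auto intro!: qspanI[of 1 "[(1, y)]" for y])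

lemma psub_qspan: "psub (qspan Y)"
  unfolding psub_def
proof (intro conjI ballI allI impI)
  show "0 \<in> qspan Y" by (rule qspanI[of 1 "[]"]) auto
  show "x - y \<in> qspan Y" if "x \<in> qspan Y" "y \<in> qspan Y" for x y
  proof -
    obtain n l where 1: "n \<noteq> 0" "snd ` set l \<subseteq> Y" "of_int n * x = lin id l" using \<open>x \<in> qspan Y\<close> by (rule qspanE)
    obtain n' l' where 2: "n' \<noteq> 0" "snd ` set l' \<subseteq> Y" "of_int n' * y = lin id l'" using \<open>y \<in> qspan Y\<close> by (rule qspanE)
    have "of_int (n * n') * (x - y) = of_int n' * (of_int n * x) - of_int n * (of_int n' * y)"
      by (simp add: algebra_simps)
    then have "of_int (n * n') * (x - y) = lin id (scale n' l @ scale (- n) l')"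
      unfolding 1 2 by simp
    moreover have "snd ` set (scale n' l @ scale (- n) l') \<subseteq> Y"
      unfolding snd_append snd_scale using 1(2) 2(2) by blast
    ultimately show ?thesis using 1(1) 2(1) by (intro qspanI[of "n * n'" "scale n' l @ scale (- n) l'"]) auto
  qed
  show "x \<in> qspan Y" if n: "n \<noteq> 0" and x: "of_int n * x \<in> qspan Y" for n x
  proof -
    obtain k l where 1: "k \<noteq> 0" "snd ` set l \<subseteq> Y" "of_int k * (of_int n * x) = lin id l" using x by (rule qspanE)
    then show ?thesis using n by (intro qspanI[of "k * n" l]) (auto simp: mult.assoc)
  qed
qed

lemma qspan_subset: "psub C \<Longrightarrow> Y \<subseteq> C \<Longrightarrow> qspan Y \<subseteq> C"
proof
  fix x assume C: "psub C" "Y \<subseteq> C" and "x \<in> qspan Y"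
  from this(3) obtain n l where 1: "n \<noteq> 0" "snd ` set l \<subseteq> Y" "of_int n * x = lin id l" by (rule qspanE)
  have "lin id l \<in> C" by (rule psub_lin[OF C(1)]) (use 1 C in auto)
  then show "x \<in> C" using psub_pure[OF C(1) 1(1)] 1(3) by simp
qed


section \<open>Growth of regular sequences\<close>

text \<open>Polynomials act on sequences, with \<open>X\<close> as the shift. A sequence satisfies a linear
  recurrence if and only if its characteristic polynomial annihilates it.\<close>

definition rec_act :: "(nat \<Rightarrow> nat) \<Rightarrow> rat poly \<Rightarrow> nat \<Rightarrow> rat" where
  "rec_act r p n = (\<Sum>i\<le>degree p. coeff p i * of_nat (r (n + i)))"

lemma rec_act_eq:
  assumes "degree p \<le> N"
  shows "rec_act r p n = (\<Sum>i\<le>N. coeff p i * of_nat (r (n + i)))"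
  unfolding rec_act_def
  by (rule sum.mono_neutral_left) (use assms in \<open>auto simp: coeff_eq_0\<close>)

lemma rec_act_add: "rec_act r (p + q) n = rec_act r p n + rec_act r q n"
proof -
  define N where "N = max (degree p) (degree q)"
  have "degree p \<le> N" "degree q \<le> N" "degree (p + q) \<le> N"
    by (auto simp: N_def degree_add_le)
  then show ?thesis
    by (simp add: rec_act_eq[of _ N] sum.distrib algebra_simps)
qed

lemma rec_act_smult: "rec_act r (smult a p) n = a * rec_act r p n"
proof -
  have "degree (smult a p) \<le> degree p" by (rule degree_smult_le)
  then show ?thesis
    by (simp add: rec_act_eq[of _ "degree p"] sum_distrib_left mult.assoc)
qed

lemma rec_act_shift: "rec_act r (pCons 0 p) n = rec_act r p (Suc n)"
proof -
  have "degree (pCons 0 p) \<le> Suc (degree p)" by (rule degree_pCons_le)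
  then show ?thesis
    by (simp add: rec_act_eq[of "pCons 0 p" "Suc (degree p)"] rec_act_eq[of p "degree p"]
        sum.atMost_Suc_shift del: sum.atMost_Suc)
qed

lemma rec_act_mult_eq_0:
  assumes "\<And>n. rec_act r p n = 0"
  shows "rec_act r (p * q) n = 0"
proof (induction q arbitrary: n)
  case 0 then show ?case by (simp add: rec_act_def)
next
  case (pCons a q)
  have "p * pCons a q = smult a p + pCons 0 (p * q)" by simp
  then show ?case using pCons.IH assms by (simp only: rec_act_add rec_act_smult rec_act_shift)
qed

lemma rec_char_poly:
  assumes "satisfies_rec r k a"
  shows "rec_act r (rec_char_poly k a) n = 0" "rec_char_poly k a \<noteq> 0"
proof -
  have co: "coeff (rec_char_poly k a) i = (if i = k then 1 else if i < k then - a i else 0)" for i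
    by (auto simp: rec_char_poly_def coeff_sum)
  have deg: "degree (rec_char_poly k a) \<le> k"
    by (rule degree_le) (simp add: co)
  have "rec_act r (rec_char_poly k a) n
      = (\<Sum>i<k. - a i * of_nat (r (n + i))) + of_nat (r (n + k))"
    unfolding rec_act_eq[OF deg]
    by (simp add: co lessThan_Suc_atMost[symmetric])
  also have "\<dots> = 0" using assms by (simp add: satisfies_rec_def sum_negf)
  finally show "rec_act r (rec_char_poly k a) n = 0" .
  show "rec_char_poly k a \<noteq> 0" using co[of k] by auto
qed

lemma map_poly_of_rat_mult:
  "map_poly of_rat (p * q) = map_poly of_rat p * (map_poly of_rat q :: real poly)"
  by (rule poly_eqI) (simp add: coeff_map_poly coeff_mult of_rat_sum of_rat_mult)

lemma map_poly_of_rat_add: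
  "map_poly of_rat (p + q) = map_poly of_rat p + (map_poly of_rat q :: real poly)"
  by (rule poly_eqI) (simp add: coeff_map_poly of_rat_add)

text \<open>The remainder of \<open>q\<close> by \<open>p\<close> vanishes at \<open>\<theta>\<close> and is too small to be nonzero.\<close>

lemma is_min_poly_dvd:
  assumes p: "is_min_poly \<theta> p" and q: "poly (map_poly of_rat q) \<theta> = 0"
  shows "p dvd q"
proof -
  have p0: "p \<noteq> 0" and p\<theta>: "poly (map_poly of_rat p) \<theta> = 0"
    using p by (auto simp: is_min_poly_def)
  have "poly (map_poly of_rat (q div p * p + q mod p)) \<theta> = 0" using q by simp
  then have "poly (map_poly of_rat (q mod p)) \<theta> = 0"
    unfolding map_poly_of_rat_add map_poly_of_rat_mult by (simp add: p\<theta>)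
  moreover have "q mod p = 0 \<or> degree (q mod p) < degree p"
    using degree_mod_less[OF p0] by auto
  ultimately have "q mod p = 0" using p by (auto simp: is_min_poly_def)
  then show ?thesis by (simp add: mod_eq_0_iff_dvd)
qed

text \<open>If the quotients converge to a real number \<open>\<theta>\<close>, then the combination divided by \<open>r j\<close>
  converges to \<open>f = \<Sum> c\<^sub>k \<theta>\<^sup>k\<close>, which settles the case \<open>f \<noteq> 0\<close>. If \<open>f = 0\<close>, then \<open>\<theta>\<close> is
  algebraic, its minimal polynomial divides \<open>\<Sum> c\<^sub>k X\<^sup>k\<close>, and the combination vanishes by
  the recurrence.\<close>

lemma int_comb_dominates:
  assumes reg: "regular r"
  shows "(\<forall>j. (\<Sum>k<K. c k * int (r (j + k))) = 0) \<or>
    (\<exists>\<epsilon>>0. \<forall>\<^sub>F j in sequentially. \<epsilon> * real (r j) \<le> \<bar>real_of_int (\<Sum>k<K. c k * int (r (j + k)))\<bar>)"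
proof (cases "\<forall>k<K. c k = 0")
  case True then show ?thesis by simp
next
  case False
  have mono: "strict_mono r" using reg by (simp add: regular_def)
  have rpos: "0 < r j" if "0 < j" for j
    using strict_monoD[OF mono that] by linarith
  have rmono: "r i \<le> r j" if "i \<le> j" for i j
    using mono that by (simp add: strict_mono_less_eq)
  let ?S = "\<lambda>j. \<Sum>k<K. c k * int (r (j + k))"
  show ?thesis
  proof (cases "filterlim (\<lambda>n. real (r (Suc n)) / real (r n)) at_top sequentially")
    case inf: True
    \<comment> \<open>If the quotients tend to infinity, the last nonzero term dominates all others.\<close>
    define L where "L = Max {k. k < K \<and> c k \<noteq> 0}"
    have "L \<in> {k. k < K \<and> c k \<noteq> 0}"
      unfolding L_def by (rule Max_in) (use False in auto)
    then have L: "L < K" "c L \<noteq> 0" by auto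
    have Lmax: "c k = 0" if "k < K" "L < k" for k
      using Max_ge[of "{k. k < K \<and> c k \<noteq> 0}" k] that by (fastforce simp: L_def)
    define B where "B = (\<Sum>k<L. \<bar>real_of_int (c k)\<bar>)"
    have B0: "0 \<le> B" by (simp add: B_def sum_nonneg)
    have Seq: "?S j = c L * int (r (j + L)) + (\<Sum>k<L. c k * int (r (j + k)))" for j
    proof -
      have "?S j = (\<Sum>k<Suc L. c k * int (r (j + k)))"
        by (rule sum.mono_neutral_right) (use L Lmax in auto)
      then show ?thesis by simp
    qed
    have "\<forall>\<^sub>F j in sequentially. 2 * (B + 1) \<le> real (r (Suc j)) / real (r j)"
      using inf by (simp add: filterlim_at_top)
    then obtain N where N: "\<And>j. j \<ge> N \<Longrightarrow> 2 * (B + 1) \<le> real (r (Suc j)) / real (r j)"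
      by (auto simp: eventually_sequentially)
    have "1 / 2 * real (r j) \<le> \<bar>real_of_int (?S j)\<bar>" if j: "j \<ge> N" "j > 0" for j
    proof -
      have low: "\<bar>real_of_int (\<Sum>k<L. c k * int (r (j + k)))\<bar> \<le> real (r (j + L)) / 2"
      proof (cases L)
        case (Suc L')
        have "\<bar>real_of_int (\<Sum>k<L. c k * int (r (j + k)))\<bar>
            \<le> (\<Sum>k<L. \<bar>real_of_int (c k)\<bar> * real (r (j + k)))"
          by (simp add: order.trans[OF sum_abs] abs_mult)
        also have "\<dots> \<le> (\<Sum>k<L. \<bar>real_of_int (c k)\<bar> * real (r (j + L')))"
          by (intro sum_mono mult_left_mono) (use Suc in \<open>auto intro: rmono\<close>)
        also have "\<dots> = B * real (r (j + L'))" by (simp add: B_def sum_distrib_right)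
        also have "2 * (B + 1) * real (r (j + L')) \<le> real (r (Suc (j + L')))"
          using N[of "j + L'"] j rpos[of "j + L'"] by (simp add: field_simps)
        then have "B * real (r (j + L')) \<le> real (r (j + L)) / 2"
          using Suc rpos[of "j + L'"] j by (simp add: algebra_simps)
        finally show ?thesis .
      qed simp
      have "1 \<le> \<bar>real_of_int (c L)\<bar>" using L(2) by (metis of_int_abs of_int_1_le_iff zero_less_abs_iff int_one_le_iff_zero_less)
      from mult_right_mono[OF this, of "real (r (j + L))"]
      have "real (r (j + L)) \<le> \<bar>real_of_int (c L)\<bar> * real (r (j + L))" by simp
      then have "real (r (j + L)) \<le> \<bar>real_of_int (c L * int (r (j + L)))\<bar>" by (simp add: abs_mult)
      then have "real (r (j + L)) / 2 \<le> \<bar>real_of_int (?S j)\<bar>"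
        using low unfolding Seq of_int_add by linarith
      moreover have "real (r j) \<le> real (r (j + L))" by (simp add: rmono)
      ultimately show ?thesis by linarith
    qed
    then have "\<forall>\<^sub>F j in sequentially. 1 / 2 * real (r j) \<le> \<bar>real_of_int (?S j)\<bar>"
      by (auto simp: eventually_sequentially intro: exI[of _ "Suc N"])
    then show ?thesis by (intro disjI2 exI[of _ "1 / 2"]) simp
  next
    case fin: False
    then obtain \<theta> where \<theta>: "\<theta> > 1" "(\<lambda>n. real (r (Suc n)) / real (r n)) \<longlonglongrightarrow> \<theta>"
      and alg: "algebraic \<theta> \<Longrightarrow> \<exists>k a. linear_recurrence r k a \<and> is_min_poly \<theta> (rec_char_poly k a)"
      using reg by (auto simp: regular_def)
    have pow: "(\<lambda>j. real (r (j + k)) / real (r j)) \<longlonglongrightarrow> \<theta> ^ k" for k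
    proof (induction k)
      case 0
      have "\<forall>\<^sub>F j in sequentially. real (r j) / real (r j) = 1"
        unfolding eventually_sequentially by (rule exI[of _ 1]) (use rpos in force)
      then show ?case by (simp add: tendsto_eventually)
    next
      case (Suc k)
      have "(\<lambda>j. real (r (Suc (j + k))) / real (r (j + k)) * (real (r (j + k)) / real (r j)))
          \<longlonglongrightarrow> \<theta> * \<theta> ^ k"
        by (intro tendsto_mult Suc.IH LIMSEQ_ignore_initial_segment[OF \<theta>(2)])
      moreover have "\<forall>\<^sub>F j in sequentially. real (r (Suc (j + k))) / real (r (j + k)) *
          (real (r (j + k)) / real (r j)) = real (r (j + Suc k)) / real (r j)"
        unfolding eventually_sequentially
      proof (intro exI[of _ 1] allI impI)
        fix j :: nat assume "j \<ge> 1"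
        then have "r (j + k) \<noteq> 0" using rpos[of "j + k"] by simp
        then show "real (r (Suc (j + k))) / real (r (j + k)) *
          (real (r (j + k)) / real (r j)) = real (r (j + Suc k)) / real (r j)" by simp
      qed
      ultimately have "(\<lambda>j. real (r (j + Suc k)) / real (r j)) \<longlonglongrightarrow> \<theta> * \<theta> ^ k"
        by (rule Lim_transform_eventually)
      then show ?case by simp
    qed
    define f where "f = (\<Sum>k<K. real_of_int (c k) * \<theta> ^ k)"
    define q where "q = (\<Sum>k<K. monom (rat_of_int (c k)) k)"
    have qc: "coeff q i = (if i < K then rat_of_int (c i) else 0)" for i
      by (auto simp: q_def coeff_sum)
    have degq: "degree q \<le> K"
      by (rule degree_le) (auto simp: qc)
    have q0: "q \<noteq> 0" using False qc by (metis coeff_0 of_int_eq_0_iff)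
    have q\<theta>: "poly (map_poly of_rat q) \<theta> = f"
    proof -
      have "degree (map_poly of_rat q :: real poly) \<le> K"
        by (rule degree_le) (auto simp: coeff_map_poly qc)
      then have "poly (map_poly of_rat q) \<theta> = (\<Sum>i\<le>K. coeff (map_poly of_rat q) i * \<theta> ^ i)"
        unfolding poly_altdef by (intro sum.mono_neutral_left) (auto simp: coeff_eq_0)
      also have "\<dots> = f" by (simp add: coeff_map_poly qc f_def lessThan_Suc_atMost[symmetric])
      finally show ?thesis .
    qed
    show ?thesis
    proof (cases "f = 0")
      case True
      \<comment> \<open>The recurrence with the minimal polynomial of \<open>\<theta>\<close> kills every combination that vanishes
        at \<open>\<theta>\<close>.\<close>
      have "algebraic \<theta>"
      proof (rule algebraicI)
        show "poly (map_poly of_rat q) \<theta> = 0" using q\<theta> True by simp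
        show "map_poly of_rat q \<noteq> (0 :: real poly)"
          using q0 by (metis coeff_0 coeff_map_poly of_rat_0 of_rat_eq_0_iff poly_eqI)
      qed (auto simp: coeff_map_poly qc)
      from alg[OF this] obtain k a where ka: "linear_recurrence r k a" "is_min_poly \<theta> (rec_char_poly k a)"
        by blast
      from is_min_poly_dvd[OF ka(2)] q\<theta> True obtain g where g: "q = rec_char_poly k a * g"
        by (auto elim: dvdE)
      have "rec_act r q j = 0" for j
        unfolding g by (rule rec_act_mult_eq_0, rule rec_char_poly) (use ka in \<open>simp add: linear_recurrence_def\<close>)
      then have "(\<Sum>k<K. rat_of_int (c k) * of_nat (r (j + k))) = 0" for j
        unfolding rec_act_eq[OF degq] by (simp add: qc lessThan_Suc_atMost[symmetric])
      moreover have "(\<Sum>k<K. rat_of_int (c k) * of_nat (r (j + k))) = rat_of_int (?S j)" for j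
        by simp
      ultimately have "?S j = 0" for j by (metis of_int_eq_0_iff)
      then show ?thesis by blast
    next
      case f0: False
      have "(\<lambda>j. \<Sum>k<K. real_of_int (c k) * (real (r (j + k)) / real (r j))) \<longlonglongrightarrow> f"
        unfolding f_def by (intro tendsto_sum tendsto_mult tendsto_const pow)
      then have "(\<lambda>j. \<bar>\<Sum>k<K. real_of_int (c k) * (real (r (j + k)) / real (r j))\<bar>) \<longlonglongrightarrow> \<bar>f\<bar>"
        by (rule tendsto_rabs)
      from order_tendstoD(1)[OF this, of "\<bar>f\<bar> / 2"] f0
      have "\<forall>\<^sub>F j in sequentially. \<bar>f\<bar> / 2 < \<bar>\<Sum>k<K. real_of_int (c k) * (real (r (j + k)) / real (r j))\<bar>"
        by simp
      then have "\<forall>\<^sub>F j in sequentially. \<bar>f\<bar> / 2 * real (r j) \<le> \<bar>real_of_int (?S j)\<bar>"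
        using eventually_gt_at_top[of 0]
      proof eventually_elim
        case (elim j)
        have "real_of_int (?S j) = real (r j) * (\<Sum>k<K. real_of_int (c k) * (real (r (j + k)) / real (r j)))"
          using rpos[OF elim(2)] by (simp add: sum_distrib_left)
        then have "\<bar>real_of_int (?S j)\<bar> = real (r j) * \<bar>\<Sum>k<K. real_of_int (c k) * (real (r (j + k)) / real (r j))\<bar>"
          by (simp only: abs_mult abs_of_nat)
        moreover have "\<bar>f\<bar> / 2 * real (r j)
            \<le> \<bar>\<Sum>k<K. real_of_int (c k) * (real (r (j + k)) / real (r j))\<bar> * real (r j)"
          using elim(1) by (intro mult_right_mono) auto
        ultimately show ?case by (simp only: mult.commute)
      qed
      then show ?thesis using f0 by (intro disjI2 exI[of _ "\<bar>f\<bar> / 2"]) simp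
    qed
  qed
qed

text \<open>Eventually \<open>r\<close> grows by a factor \<open>q > 1\<close> in each step.\<close>

lemma gaps_grow:
  assumes reg: "regular r" and \<delta>: "\<delta> > 0"
  shows "\<exists>D. \<forall>\<^sub>F m in sequentially. \<forall>j. j + D \<le> m \<longrightarrow> real (r j) \<le> \<delta> * real (r m)"
proof -
  have mono: "strict_mono r" using reg by (simp add: regular_def)
  have rpos: "0 < r j" if "0 < j" for j
    using strict_monoD[OF mono that] by linarith
  have rmono: "r i \<le> r j" if "i \<le> j" for i j
    using mono that by (simp add: strict_mono_less_eq)
  have "\<exists>q>1. \<forall>\<^sub>F n in sequentially. q \<le> real (r (Suc n)) / real (r n)"
  proof -
    consider "filterlim (\<lambda>n. real (r (Suc n)) / real (r n)) at_top sequentially"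
      | \<theta> where "\<theta> > 1" "(\<lambda>n. real (r (Suc n)) / real (r n)) \<longlonglongrightarrow> \<theta>"
      using reg by (auto simp: regular_def)
    then show ?thesis
    proof cases
      case 1
      then have "\<forall>\<^sub>F n in sequentially. 2 \<le> real (r (Suc n)) / real (r n)" by (simp add: filterlim_at_top)
      then show ?thesis by (intro exI[of _ 2]) simp
    next
      case (2 \<theta>)
      from order_tendstoD(1)[OF 2(2), of "(1 + \<theta>) / 2"] 2(1)
      have "\<forall>\<^sub>F n in sequentially. (1 + \<theta>) / 2 < real (r (Suc n)) / real (r n)" by simp
      then have "\<forall>\<^sub>F n in sequentially. (1 + \<theta>) / 2 \<le> real (r (Suc n)) / real (r n)"
        by eventually_elim simp
      then show ?thesis using 2(1) by (intro exI[of _ "(1 + \<theta>) / 2"]) simp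
    qed
  qed
  then obtain q N where q: "q > 1" "\<And>n. n \<ge> N \<Longrightarrow> q \<le> real (r (Suc n)) / real (r n)"
    by (auto simp: eventually_sequentially)
  \<comment> \<open>Index \<open>0\<close> is skipped because \<open>r 0\<close> may be \<open>0\<close>.\<close>
  define N0 where "N0 = Suc N"
  have step: "q * real (r n) \<le> real (r (Suc n))" if "n \<ge> N0" for n
    using q(2)[of n] that rpos[of n] by (simp add: N0_def field_simps)
  have pow: "q ^ d * real (r n) \<le> real (r (n + d))" if "n \<ge> N0" for n d
  proof (induction d)
    case (Suc d)
    have "q ^ Suc d * real (r n) = q * (q ^ d * real (r n))" by simp
    also have "\<dots> \<le> q * real (r (n + d))" using Suc q(1) by (intro mult_left_mono) auto
    also have "\<dots> \<le> real (r (n + Suc d))" using step[of "n + d"] that by simp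
    finally show ?case .
  qed simp
  obtain D where D: "1 / \<delta> < q ^ D" using real_arch_pow[OF q(1)] by blast
  have "real (r j) \<le> \<delta> * real (r m)" if "m \<ge> N0 + D" "j + D \<le> m" for j m
  proof -
    \<comment> \<open>The estimate is only available from \<open>N0\<close> on; smaller terms are bounded by \<open>r N0\<close>.\<close>
    define j' where "j' = max j N0"
    have j': "j' + D \<le> m" "N0 \<le> j'" "j \<le> j'" using that by (auto simp: j'_def)
    have "real (r j) \<le> real (r j')" using j' by (simp add: rmono)
    also have "\<dots> \<le> \<delta> * (q ^ D * real (r j'))"
    proof -
      have "1 \<le> \<delta> * q ^ D" using D \<delta> by (simp add: field_simps)
      from mult_right_mono[OF this, of "real (r j')"] show ?thesis by (simp add: mult.assoc)
    qed
    also have "\<dots> \<le> \<delta> * real (r (j' + D))" using pow[OF j'(2), of D] \<delta> by simp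
    also have "\<dots> \<le> \<delta> * real (r m)" using rmono[OF j'(1)] \<delta> by simp
    finally show ?thesis .
  qed
  then show ?thesis by (auto simp: eventually_sequentially)
qed

section \<open>Cardinalities of lists\<close>

lemma card_of_image_le: "|A| \<le>o \<kappa> \<Longrightarrow> |f ` A| \<le>o \<kappa>"
  using card_of_image ordLeq_transitive by blast

lemma card_of_subset_le: "A \<subseteq> B \<Longrightarrow> |B| \<le>o \<kappa> \<Longrightarrow> |A| \<le>o \<kappa>"
  using card_of_mono1 ordLeq_transitive by blast

lemma countable_le_infinite:
  assumes "Card_order \<kappa>" "\<not> finite (Field \<kappa>)" "countable A"
  shows "|A| \<le>o \<kappa>"
proof -
  have "|A| \<le>o natLeq" using assms(3) by (simp add: countable_card_le_natLeq)
  also have "natLeq \<le>o |Field \<kappa>|" using assms(2) infinite_iff_natLeq_ordLeq[of "Field \<kappa>"] by blast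
  also have "|Field \<kappa>| =o \<kappa>" using assms(1) by (rule card_of_Field_ordIso)
  finally show ?thesis .
qed

lemma card_of_lists_le:
  fixes A :: "'b set"
  assumes \<kappa>: "Card_order \<kappa>" "\<not> finite (Field \<kappa>)" and A: "|A| \<le>o \<kappa>"
  shows "|lists A| \<le>o \<kappa>"
proof -
  have *: "|{l \<in> lists A. length l = n}| \<le>o \<kappa>" for n
  proof (induction n)
    case 0
    have "{l \<in> lists A. length l = 0} = {[]}" by auto
    moreover have "|{[] :: 'b list}| \<le>o \<kappa>" by (rule countable_le_infinite[OF \<kappa>]) simp
    ultimately show ?case by simp
  next
    case (Suc n)
    have "{l \<in> lists A. length l = Suc n} = (\<lambda>(x, l). x # l) ` (A \<times> {l \<in> lists A. length l = n})"
      by (auto simp: length_Suc_conv image_iff)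
    moreover have "|(\<lambda>(x, l). x # l) ` (A \<times> {l \<in> lists A. length l = n})| \<le>o \<kappa>"
      by (intro card_of_image_le card_of_Times_ordLeq_infinite_Field \<kappa> A Suc)
    ultimately show ?case by (simp only:)
  qed
  have "lists A = (\<Union>n. {l \<in> lists A. length l = n})" by auto
  moreover have "|\<Union>n. {l \<in> lists A. length l = n}| \<le>o \<kappa>"
    by (rule card_of_UNION_ordLeq_infinite_Field[OF \<kappa>(2,1)])
      (simp_all add: * countable_le_infinite[OF \<kappa>])
  ultimately show ?thesis by simp
qed

lemma card_of_coeff_lists_le:
  assumes \<kappa>: "Card_order \<kappa>" "\<not> finite (Field \<kappa>)" and A: "|A| \<le>o \<kappa>"
  shows "|lists ((UNIV :: int set) \<times> A)| \<le>o \<kappa>"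
  by (intro card_of_lists_le card_of_Times_ordLeq_infinite_Field \<kappa> A countable_le_infinite) simp


section \<open>First-order formulas\<close>

instance tm :: countable by countable_datatype
instance fm :: countable by countable_datatype

lemma eval_cong: "(\<And>n. n \<in> fv_tm t \<Longrightarrow> v n = w n) \<Longrightarrow> eval M v t = eval M w t"
  by (induction t) auto

lemma sat_cong: "(\<And>n. n \<in> fv \<phi> \<Longrightarrow> v n = w n) \<Longrightarrow> sat M v \<phi> \<longleftrightarrow> sat M w \<phi>"
proof (induction \<phi> arbitrary: v w)
  case (Eq s t) then show ?case using eval_cong[of s v w M] eval_cong[of t v w M] by simp
next
  case (InR t) then show ?case using eval_cong[of t v w M] by simp
next
  case (Neg \<phi>) then show ?case by (metis fv.simps(3) sat.simps(3))
next
  case (Conj \<phi> \<psi>)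
  have "sat M v \<phi> = sat M w \<phi>" "sat M v \<psi> = sat M w \<psi>"
    by (rule Conj.IH, simp add: Conj.prems)+
  then show ?case by simp
next
  case (Ex i \<phi>)
  have "sat M (v(i := x)) \<phi> = sat M (w(i := x)) \<phi>" for x
    by (rule Ex.IH) (simp add: Ex.prems)
  then show ?case by simp
qed

lemma finite_fv_tm [simp]: "finite (fv_tm t)" by (induction t) auto

lemma finite_fv [simp]: "finite (fv \<phi>)" by (induction \<phi>) auto

text \<open>Blocks of quantifiers and finite conjunctions turn finitely many conditions on
  finitely many elements into one formula.\<close>

definition Exs :: "nat list \<Rightarrow> fm \<Rightarrow> fm" where
  "Exs xs \<phi> = foldr Ex xs \<phi>"

lemma sat_Exs: "sat M v (Exs xs \<phi>) \<longleftrightarrow> (\<exists>w. (\<forall>i. i \<notin> set xs \<longrightarrow> w i = v i) \<and> sat M w \<phi>)"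
proof (induction xs arbitrary: v)
  case Nil
  have "w = v" if "\<forall>i. w i = v i" for w using that by auto
  then show ?case by (auto simp: Exs_def)
next
  case (Cons x xs)
  have "sat M v (Exs (x # xs) \<phi>) \<longleftrightarrow> (\<exists>y w. (\<forall>i. i \<notin> set xs \<longrightarrow> w i = (v(x := y)) i) \<and> sat M w \<phi>)"
    using Cons.IH by (simp add: Exs_def)
  also have "\<dots> \<longleftrightarrow> (\<exists>w. (\<forall>i. i \<notin> set (x # xs) \<longrightarrow> w i = v i) \<and> sat M w \<phi>)"
  proof
    assume "\<exists>w. (\<forall>i. i \<notin> set (x # xs) \<longrightarrow> w i = v i) \<and> sat M w \<phi>"
    then obtain w where "\<forall>i. i \<notin> set (x # xs) \<longrightarrow> w i = v i" "sat M w \<phi>" by blast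
    then show "\<exists>y w. (\<forall>i. i \<notin> set xs \<longrightarrow> w i = (v(x := y)) i) \<and> sat M w \<phi>"
      by (intro exI[of _ "w x"] exI[of _ w]) auto
  qed (auto split: if_splits)
  finally show ?case .
qed

lemma fv_Exs [simp]: "fv (Exs xs \<phi>) = fv \<phi> - set xs"
  by (induction xs) (auto simp: Exs_def)

definition Conjs :: "fm list \<Rightarrow> fm" where
  "Conjs \<phi>s = foldr Conj \<phi>s (Eq Zero Zero)"

lemma sat_Conjs [simp]: "sat M v (Conjs \<phi>s) \<longleftrightarrow> (\<forall>\<phi>\<in>set \<phi>s. sat M v \<phi>)"
  by (induction \<phi>s) (auto simp: Conjs_def)

lemma fv_Conjs [simp]: "fv (Conjs \<phi>s) = (\<Union>\<phi>\<in>set \<phi>s. fv \<phi>)"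
  by (induction \<phi>s) (auto simp: Conjs_def)

text \<open>The term \<open>n t\<close>.\<close>

definition Vs :: "nat \<Rightarrow> tm \<Rightarrow> tm" where
  "Vs n t = (Plus t ^^ n) Zero"

text \<open>The equation \<open>\<Sum> c\<^sub>i v\<^sub>i = 0\<close>; negative coefficients are moved to the right-hand side.\<close>

definition Lin :: "(int \<times> nat) list \<Rightarrow> fm" where
  "Lin l = Eq (foldr (\<lambda>(c, i). Plus (Vs (nat c) (Var i))) l Zero)
              (foldr (\<lambda>(c, i). Plus (Vs (nat (- c)) (Var i))) l Zero)"

lemma eval_Vs:
  fixes M :: "('n :: comm_ring_1) struc"
  assumes "zer M = 0" "pls M = (+)"
  shows "eval M v (Vs n t) = of_nat n * eval M v t"
  by (induction n) (simp_all add: Vs_def assms algebra_simps)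

lemma sat_Lin:
  fixes M :: "('n :: comm_ring_1) struc"
  assumes "zer M = 0" "pls M = (+)"
  shows "sat M v (Lin l) \<longleftrightarrow> lin v l = 0"
proof -
  have *: "eval M v (foldr (\<lambda>(c, i). Plus (Vs (f c) (Var i))) l Zero) = (\<Sum>(c, i)\<leftarrow>l. of_nat (f c) * v i)" for f
    by (induction l) (auto simp: assms eval_Vs)
  have "lin v l = (\<Sum>(c, i)\<leftarrow>l. of_nat (nat c) * v i) - (\<Sum>(c, i)\<leftarrow>l. of_nat (nat (- c)) * v i)"
  proof (induction l)
    case (Cons p l)
    obtain c i where p: "p = (c, i)" by (cases p)
    have "(of_int c :: 'n) = of_nat (nat c) - of_nat (nat (- c))" by (cases "c \<ge> 0") auto
    then have "of_int c * v i = of_nat (nat c) * v i - of_nat (nat (- c)) * v i"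
      by (simp only: left_diff_distrib)
    then show ?case using Cons by (simp add: p)
  qed simp
  then show ?thesis by (simp add: Lin_def *)
qed

lemma fv_Vs: "fv_tm (Vs n t) \<subseteq> fv_tm t"
  by (induction n) (auto simp: Vs_def)

lemma fv_Lin: "fv (Lin l) \<subseteq> snd ` set l"
proof -
  have "fv_tm (foldr (\<lambda>(c, i). Plus (Vs (f c) (Var i))) l Zero) \<subseteq> snd ` set l" for f
    by (induction l) (use fv_Vs in force)+
  then show ?thesis by (simp add: Lin_def)
qed


section \<open>Indices at finite distance\<close>

text \<open>Indices into the sequence are themselves nonstandard numbers, represented by
  functions.\<close>

definition near :: "(nat \<times> 'a set \<Rightarrow> nat) \<Rightarrow> (nat \<times> 'a set \<Rightarrow> nat) \<Rightarrow> bool" where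
  "near m m' \<longleftrightarrow> (\<exists>k. \<forall>\<^sub>F i in uf. int (m' i) = int (m i) + k)"

lemma near_refl [simp]: "near m m"
  by (auto simp: near_def intro: exI[of _ 0])

lemma near_sym: "near m m' \<Longrightarrow> near m' m"
proof -
  assume "near m m'"
  then obtain k where k: "\<forall>\<^sub>F i in uf. int (m' i) = int (m i) + k" by (auto simp: near_def)
  have "\<forall>\<^sub>F i in uf. int (m i) = int (m' i) + (- k)" using k by eventually_elim simp
  then show ?thesis unfolding near_def by blast
qed

lemma near_trans: "near m m' \<Longrightarrow> near m' m'' \<Longrightarrow> near m m''"
proof -
  assume "near m m'" "near m' m''"
  then obtain k k' where k: "\<forall>\<^sub>F i in uf. int (m' i) = int (m i) + k"
    "\<forall>\<^sub>F i in uf. int (m'' i) = int (m' i) + k'" by (auto simp: near_def)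
  have "\<forall>\<^sub>F i in uf. int (m'' i) = int (m i) + (k + k')" using k by eventually_elim simp
  then show ?thesis unfolding near_def by blast
qed

lemma near_bounded:
  assumes "\<forall>\<^sub>F i in uf. \<bar>int (m' i) - int (m i)\<bar> \<le> D"
  shows "near m m'"
proof -
  have "\<forall>\<^sub>F i in uf. \<exists>k\<in>{-D..D}. int (m' i) = int (m i) + k"
    using assms
  proof eventually_elim
    case (elim i)
    then show ?case by (intro bexI[of _ "int (m' i) - int (m i)"]) auto
  qed
  then show ?thesis by (subst (asm) ev_finite_ex) (auto simp: near_def)
qed

definition nonstd :: "(nat \<times> 'a set \<Rightarrow> nat) \<Rightarrow> bool" where
  "nonstd m \<longleftrightarrow> (\<forall>D. \<forall>\<^sub>F i in uf. D \<le> m i)"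

lemma not_nonstdE:
  assumes "\<not> nonstd m"
  obtains j where "\<forall>\<^sub>F i in uf. m i = j"
proof -
  from assms obtain D where "\<forall>\<^sub>F i in uf. \<not> D \<le> m i" by (auto simp: nonstd_def ev_not)
  then have "\<forall>\<^sub>F i in uf. \<exists>j\<in>{..<D}. m i = j" by eventually_elim auto
  then show thesis using that by (subst (asm) ev_finite_ex) auto
qed

lemma nonstd_near:
  assumes "nonstd m" "near m m'" shows "nonstd m'"
  unfolding nonstd_def
proof
  fix D
  from assms(2) obtain k where k: "\<forall>\<^sub>F i in uf. int (m' i) = int (m i) + k" by (auto simp: near_def)
  have "\<forall>\<^sub>F i in uf. nat (int D - k) \<le> m i" using assms(1) by (auto simp: nonstd_def)
  with k show "\<forall>\<^sub>F i in uf. D \<le> m' i" by eventually_elim linarith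
qed

lemma nonstd_ge_int: "nonstd m \<Longrightarrow> \<forall>\<^sub>F i in uf. k \<le> int (m i)"
  using nonstd_def by (metis (mono_tags, lifting) eventually_mono nat_le_iff)

lemma nonstd_eventually:
  assumes "nonstd m" "\<forall>\<^sub>F t in sequentially. P t"
  shows "\<forall>\<^sub>F i in uf. P (nat (int (m i) + k))"
proof -
  from assms(2) obtain T where T: "\<And>t. t \<ge> T \<Longrightarrow> P t" by (auto simp: eventually_sequentially)
  from nonstd_ge_int[OF assms(1), of "int T - k"] show ?thesis
    by eventually_elim (rule T, linarith)
qed

text \<open>Negative values are truncated to \<open>0\<close>; for a nonstandard index this happens almost
  nowhere.\<close>

definition shift :: "(nat \<times> 'a set \<Rightarrow> nat) \<Rightarrow> int \<Rightarrow> nat \<times> 'a set \<Rightarrow> nat" where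
  "shift m k i = nat (int (m i) + k)"


section \<open>The nonstandard model\<close>

locale regular_sequence =
  fixes r :: "nat \<Rightarrow> nat"
  assumes reg: "regular r"
begin

lemma r_strict_mono: "strict_mono r" using reg by (simp add: regular_def)

lemma r_eq_iff [simp]: "r i = r j \<longleftrightarrow> i = j"
  using r_strict_mono by (simp add: strict_mono_eq)

lemma r_less_iff [simp]: "r i < r j \<longleftrightarrow> i < j"
  using r_strict_mono by (simp add: strict_mono_less)

lemma r_pos: "0 < j \<Longrightarrow> 0 < r j"
  using strict_monoD[OF r_strict_mono, of 0 j] by linarith

abbreviation Z :: "int struc" where "Z \<equiv> Z_struc (range r)"

text \<open>The term with index \<open>m\<close>; \<open>RN\<close> is the interpretation of \<open>R\<close> in the ultrapower \<open>N\<close>.\<close>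

definition rho :: "(nat \<times> 'a set \<Rightarrow> nat) \<Rightarrow> 'a hyp" where
  "rho m = hyp (\<lambda>i. int (r (m i)))"

definition RN :: "'a hyp set" where "RN = range rho"

definition N :: "'a hyp struc" where "N = \<lparr>zer = 0, pls = (+), prd = RN\<rparr>"

lemma N_simps [simp]: "zer N = 0" "pls N = (+)" "prd N = RN"
  by (simp_all add: N_def)

lemma Z_simps [simp]: "zer Z = 0" "pls Z = (+)" "prd Z = int ` range r"
  by (simp_all add: Z_struc_def)

lemma rho_RN [simp]: "rho m \<in> RN" by (simp add: RN_def)

lemma hyp_in_RN: "hyp x \<in> RN \<longleftrightarrow> (\<forall>\<^sub>F i in uf. x i \<in> int ` range r)"
proof -
  have "hyp x \<in> RN \<longleftrightarrow> (\<exists>m. \<forall>\<^sub>F i in uf. x i = int (r (m i)))"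
    by (auto simp: RN_def rho_def hyp_eq_iff)
  also have "\<dots> \<longleftrightarrow> (\<forall>\<^sub>F i in uf. \<exists>j. x i = int (r j))" by (simp add: ev_ex)
  also have "\<dots> \<longleftrightarrow> (\<forall>\<^sub>F i in uf. x i \<in> int ` range r)"
    by (rule arg_cong[where f = "\<lambda>P. eventually P uf"]) auto
  finally show ?thesis .
qed

lemma eval_Los: "eval N (\<lambda>n. hyp (x n)) t = hyp (\<lambda>i. eval Z (\<lambda>n. x n i) t)"
  by (induction t) (auto simp: hyp_zero hyp_add)

theorem Los: "sat N (\<lambda>n. hyp (x n)) \<phi> \<longleftrightarrow> (\<forall>\<^sub>F i in uf. sat Z (\<lambda>n. x n i) \<phi>)"
proof (induction \<phi> arbitrary: x)
  case (Ex k \<phi>)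
  have upd: "(\<lambda>n. hyp (x n))(k := hyp y) = (\<lambda>n. hyp ((x(k := y)) n))" for y by auto
  have upd': "(\<lambda>n. (x(k := y)) n i) = (\<lambda>n. x n i)(k := y i)" for y i by auto
  have "sat N (\<lambda>n. hyp (x n)) (Ex k \<phi>) \<longleftrightarrow> (\<exists>y. sat N ((\<lambda>n. hyp (x n))(k := hyp y)) \<phi>)"
    unfolding sat.simps by (rule hyp_ex)
  also have "\<dots> \<longleftrightarrow> (\<exists>y. \<forall>\<^sub>F i in uf. sat Z (\<lambda>n. (x(k := y)) n i) \<phi>)"
    unfolding upd Ex.IH ..
  also have "\<dots> \<longleftrightarrow> (\<exists>y. \<forall>\<^sub>F i in uf. sat Z ((\<lambda>n. x n i)(k := y i)) \<phi>)"
    unfolding upd' ..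
  also have "\<dots> \<longleftrightarrow> (\<forall>\<^sub>F i in uf. sat Z (\<lambda>n. x n i) (Ex k \<phi>))"
    by (simp add: ev_ex)
  finally show ?case .
qed (simp_all add: eval_Los hyp_eq_iff hyp_in_RN ev_not eventually_conj_iff del: image_iff)

lemma Los_coord: "sat N v \<phi> \<longleftrightarrow> (\<forall>\<^sub>F i in uf. sat Z (\<lambda>n. coord (v n) i) \<phi>)"
  using Los[of "\<lambda>n. coord (v n)" \<phi>] by simp

text \<open>\<open>\<aleph>\<^sub>1\<close>-saturation of \<open>N\<close>. The variables outside \<open>V\<close> carry the parameters, those in \<open>V\<close>
  are sought; infinitely many variables can be treated at once. The set of formulas is
  countable because the language is.\<close>

lemma fm_saturation:
  fixes v :: "nat \<Rightarrow> 'a hyp"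
  assumes fin: "\<And>J. finite J \<Longrightarrow> J \<subseteq> C \<Longrightarrow> \<exists>w. (\<forall>i. i \<notin> V \<longrightarrow> w i = v i) \<and> (\<forall>\<phi>\<in>J. sat N w \<phi>)"
  shows "\<exists>w. (\<forall>i. i \<notin> V \<longrightarrow> w i = v i) \<and> (\<forall>\<phi>\<in>C. sat N w \<phi>)"
proof -
  define q where "q = (\<lambda>\<phi> i (x :: nat \<Rightarrow> int). sat Z (\<lambda>n. if n \<in> V then x n else coord (v n) i) \<phi>)"
  have "\<exists>X. \<forall>p\<in>q ` C. \<forall>\<^sub>F i in uf. p i (X i)"
  proof (rule internal_saturation)
    fix J assume "finite J" "J \<subseteq> q ` C"
    from finite_subset_image[OF this]
    obtain J' where J': "J' \<subseteq> C" "finite J'" "J = q ` J'" by blast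
    from fin[OF J'(2,1)] obtain w where w: "\<forall>i. i \<notin> V \<longrightarrow> w i = v i" "\<forall>\<phi>\<in>J'. sat N w \<phi>" by blast
    have "\<forall>\<^sub>F i in uf. \<forall>\<phi>\<in>J'. sat Z (\<lambda>n. coord (w n) i) \<phi>"
      using w(2) J'(2) by (simp add: Los_coord eventually_ball_finite)
    then show "\<forall>\<^sub>F i in uf. \<exists>x. \<forall>q\<in>J. q i x"
    proof (rule eventually_mono)
      fix i assume "\<forall>\<phi>\<in>J'. sat Z (\<lambda>n. coord (w n) i) \<phi>"
      moreover have "(\<lambda>n. coord (w n) i) = (\<lambda>n. if n \<in> V then coord (w n) i else coord (v n) i)"
        using w(1) by auto
      ultimately have "\<forall>\<phi>\<in>J'. q \<phi> i (\<lambda>n. coord (w n) i)" unfolding q_def by simp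
      then show "\<exists>x. \<forall>q\<in>J. q i x" unfolding J'(3) by blast
    qed
  qed simp
  then obtain X where X: "\<And>\<phi>. \<phi> \<in> C \<Longrightarrow> \<forall>\<^sub>F i in uf. q \<phi> i (X i)" by blast
  define w where "w n = (if n \<in> V then hyp (\<lambda>i. X i n) else v n)" for n
  have "sat N w \<phi>" if "\<phi> \<in> C" for \<phi>
  proof -
    have "w = (\<lambda>n. hyp (\<lambda>i. if n \<in> V then X i n else coord (v n) i))"
      by (auto simp: w_def)
    then show ?thesis using X[OF that] by (simp add: Los q_def)
  qed
  then show ?thesis by (intro exI[of _ w]) (auto simp: w_def)
qed

text \<open>A combination of terms at fixed distances from each other is one with coefficients
  indexed by an initial segment of the natural numbers, so that the dichotomy for these
  applies.\<close>

lemma shape_dichotomy: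
  fixes l :: "(int \<times> int) list"
  assumes "\<And>k. k \<in> snd ` set l \<Longrightarrow> k0 \<le> k"
  shows "(\<forall>t. lin (\<lambda>k. int (r (t + nat (k - k0)))) l = 0) \<or>
    (\<exists>\<epsilon>>0. \<forall>\<^sub>F t in sequentially. \<epsilon> * real (r t) \<le> \<bar>real_of_int (lin (\<lambda>k. int (r (t + nat (k - k0)))) l)\<bar>)"
proof -
  have "\<exists>c. \<forall>t. lin (\<lambda>k. int (r (t + nat (k - k0)))) l = (\<Sum>e<K. c e * int (r (t + e)))"
    if "\<And>k. k \<in> snd ` set l \<Longrightarrow> nat (k - k0) < K" for K
    using that
  proof (induction l)
    case Nil then show ?case by (intro exI[of _ "\<lambda>_. 0"]) simp
  next
    case (Cons p l)
    obtain a k where p: "p = (a, k)" by (cases p)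
    from Cons obtain c where c: "\<And>t. lin (\<lambda>k. int (r (t + nat (k - k0)))) l = (\<Sum>e<K. c e * int (r (t + e)))"
      by auto
    have "lin (\<lambda>k. int (r (t + nat (k - k0)))) (p # l)
        = (\<Sum>e<K. (if e = nat (k - k0) then a + c e else c e) * int (r (t + e)))" for t
    proof -
      have "(\<Sum>e<K. (if e = nat (k - k0) then a + c e else c e) * int (r (t + e)))
          = (\<Sum>e<K. (if e = nat (k - k0) then a * int (r (t + e)) else 0) + c e * int (r (t + e)))"
        by (rule sum.cong) (auto simp: algebra_simps)
      also have "\<dots> = a * int (r (t + nat (k - k0))) + (\<Sum>e<K. c e * int (r (t + e)))"
        using Cons.prems[of k] by (simp add: sum.distrib p)
      finally show ?thesis by (simp add: p c)
    qed
    then show ?case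
      by (intro exI[of _ "\<lambda>e. if e = nat (k - k0) then a + c e else c e"] allI)
  qed
  moreover define K where "K = Suc (Max (insert 0 ((\<lambda>k. nat (k - k0)) ` snd ` set l)))"
  have "nat (k - k0) < K" if "k \<in> snd ` set l" for k
    unfolding K_def less_Suc_eq_le by (rule Max_ge) (use that in auto)
  ultimately obtain c where "\<And>t. lin (\<lambda>k. int (r (t + nat (k - k0)))) l = (\<Sum>e<K. c e * int (r (t + e)))"
    by blast
  then show ?thesis using int_comb_dominates[OF reg, of c K] by simp
qed

end

section \<open>Independence of the chains\<close>

context regular_sequence
begin

lemma lin_rho: "lin rho l = hyp (\<lambda>i. lin (\<lambda>m. int (r (m i))) l)"
  unfolding rho_def by (rule lin_hyp)

text \<open>If the contribution of the chain of the largest index did not vanish, it would be at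
  least a fixed multiple of its lowest term. All the other terms are infinitely far below
  and negligible.\<close>

lemma top_chain_vanishes:
  fixes ms :: "nat \<times> 'a set \<Rightarrow> nat"
  assumes l: "lin rho l = 0" and ms: "ms \<in> snd ` set l"
    and top: "\<forall>\<^sub>F i in uf. \<forall>m\<in>snd ` set l. m i \<le> ms i"
  shows "lin rho (filter (\<lambda>(c, m). near ms m) l) = 0"
proof (cases "nonstd ms")
  case False
  then obtain j where j: "\<forall>\<^sub>F i in uf. ms i = j" by (rule not_nonstdE)
  have "near ms m" if "m \<in> snd ` set l" for m
  proof (rule near_bounded)
    show "\<forall>\<^sub>F i in uf. \<bar>int (m i) - int (ms i)\<bar> \<le> int j"
      using top j by eventually_elim (use that in auto)
  qed
  then have "filter (\<lambda>(c, m). near ms m) l = l" by (force intro: filter_True)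
  then show ?thesis using l by simp
next
  case True
  define l0 where "l0 = filter (\<lambda>(c, m). near ms m) l"
  define l1 where "l1 = filter (\<lambda>(c, m). \<not> near ms m) l"
  have sum0: "lin rho l0 + lin rho l1 = 0"
    using lin_filter[of rho l "\<lambda>(c, m). near ms m"] l by (simp add: l0_def l1_def case_prod_unfold)
  define kk where "kk m = (SOME k. \<forall>\<^sub>F i in uf. int (m i) = int (ms i) + k)" for m
  have kk: "\<forall>\<^sub>F i in uf. int (m i) = int (ms i) + kk m" if "near ms m" for m
    unfolding kk_def by (rule someI_ex) (use that in \<open>auto simp: near_def\<close>)
  define sh where "sh = map (\<lambda>(c, m). (c, kk m)) l0"
  obtain k0 where k0: "\<And>k. k \<in> snd ` set sh \<Longrightarrow> k0 \<le> k"
    using bdd_below_finite[of "snd ` set sh"] by (auto simp: bdd_below_def)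
  define S where "S t = lin (\<lambda>k. int (r (t + nat (k - k0)))) sh" for t
  define t where "t i = nat (int (ms i) + k0)" for i
  have l0S: "\<forall>\<^sub>F i in uf. lin (\<lambda>m. int (r (m i))) l0 = S (t i)"
  proof -
    have "\<forall>\<^sub>F i in uf. \<forall>m\<in>snd ` set l0. int (m i) = int (ms i) + kk m"
      by (rule eventually_ball_finite) (auto simp: l0_def kk)
    then show ?thesis using nonstd_ge_int[OF True, of "- k0"]
    proof eventually_elim
      case (elim i)
      have "S (t i) = lin (\<lambda>m. int (r (t i + nat (kk m - k0)))) l0"
        unfolding S_def sh_def by (rule lin_map)
      also have "\<dots> = lin (\<lambda>m. int (r (m i))) l0"
      proof (rule lin_cong)
        fix m assume m: "m \<in> snd ` set l0"
        then have "kk m \<in> snd ` set sh" by (force simp: sh_def)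
        then have "t i + nat (kk m - k0) = m i"
          using elim(1)[rule_format, OF m] elim(2) k0[of "kk m"] by (simp add: t_def)
        then show "int (r (t i + nat (kk m - k0))) = int (r (m i))" by simp
      qed
      finally show ?case by simp
    qed
  qed
  have "\<forall>t. S t = 0"
  proof (rule ccontr)
    assume "\<not> (\<forall>t. S t = 0)"
    then obtain \<epsilon> where \<epsilon>: "\<epsilon> > 0" "\<forall>\<^sub>F t in sequentially. \<epsilon> * real (r t) \<le> \<bar>real_of_int (S t)\<bar>"
      using shape_dichotomy[OF k0] unfolding S_def by blast
    define B where "B = (\<Sum>(c, m)\<leftarrow>l1. \<bar>real_of_int c\<bar>)"
    have B0: "0 \<le> B" unfolding B_def by (rule sum_list_nonneg) auto
    define \<delta> where "\<delta> = \<epsilon> / (B + 1)"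
    have \<delta>: "\<delta> > 0" "B * \<delta> < \<epsilon>" using \<epsilon>(1) B0 by (simp_all add: \<delta>_def field_simps)
    from gaps_grow[OF reg \<delta>(1)] obtain D where
      D: "\<forall>\<^sub>F m in sequentially. \<forall>j. j + D \<le> m \<longrightarrow> real (r j) \<le> \<delta> * real (r m)" by blast
    have far: "\<forall>\<^sub>F i in uf. \<forall>m\<in>snd ` set l1. \<bar>int (m i) - int (ms i)\<bar> > int D + \<bar>k0\<bar>"
    proof (rule eventually_ball_finite)
      show "\<forall>m\<in>snd ` set l1. \<forall>\<^sub>F i in uf. \<bar>int (m i) - int (ms i)\<bar> > int D + \<bar>k0\<bar>"
        using near_bounded[where m = ms and D = "int D + \<bar>k0\<bar>"]
        by (fastforce simp: l1_def not_le[symmetric] ev_not)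
    qed simp
    have "\<forall>\<^sub>F i in uf. lin (\<lambda>m. int (r (m i))) l0 + lin (\<lambda>m. int (r (m i))) l1 = 0"
      using sum0 by (simp add: lin_rho hyp_add hyp_zero hyp_eq_iff)
    with l0S far top nonstd_eventually[OF True \<epsilon>(2), of k0] nonstd_eventually[OF True D, of k0]
      nonstd_ge_int[OF True, of "1 - k0"]
    have "\<forall>\<^sub>F i :: nat \<times> 'a set in uf. i \<noteq> i"
    proof eventually_elim
      case (elim i)
      have tpos: "0 < t i" using elim(6) by (simp add: t_def)
      have small: "real (r (m i)) \<le> \<delta> * real (r (t i))" if "m \<in> snd ` set l1" for m
      proof -
        have "m \<in> snd ` set l" using that by (auto simp: l1_def)
        then have "m i \<le> ms i" using elim(3) by auto
        then have "m i + D \<le> t i" using elim(2)[rule_format, OF that] elim(6) by (auto simp: t_def)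
        then show ?thesis using elim(5) by (auto simp: t_def)
      qed
      have "\<bar>real_of_int (lin (\<lambda>m. int (r (m i))) l1)\<bar> \<le> B * (\<delta> * real (r (t i)))"
        unfolding B_def by (rule lin_abs_le) (use small in auto)
      also have "\<dots> = B * \<delta> * real (r (t i))" by simp
      also have "\<dots> < \<epsilon> * real (r (t i))"
        using \<delta>(2) r_pos[OF tpos] by (intro mult_strict_right_mono) auto
      also have "\<dots> \<le> \<bar>real_of_int (S (t i))\<bar>" using elim(4) by (simp add: t_def)
      finally show ?case using elim(1,7) by linarith
    qed
    then show False by (simp add: eventually_False)
  qed
  then have "\<forall>\<^sub>F i in uf. lin (\<lambda>m. int (r (m i))) l0 = 0" using l0S by simp
  then show ?thesis unfolding l0_def[symmetric] by (simp add: lin_rho hyp_zero hyp_eq_iff)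
qed

text \<open>The largest index occurring in a relation depends on the coordinate, but there are
  only finitely many candidates, so one of them is the largest almost everywhere. Its
  chain can be split off, and the rest is a shorter relation.\<close>

theorem chains_independent:
  assumes "lin rho l = 0"
  shows "lin rho (filter (\<lambda>(c, m). near m0 m) l) = 0"
  using assms
proof (induction "length l" arbitrary: l rule: less_induct)
  case less
  show ?case
  proof (cases "l = []")
    case False
    have "\<forall>\<^sub>F i in uf. \<exists>ms\<in>snd ` set l. \<forall>m\<in>snd ` set l. m i \<le> ms i"
    proof (rule always_eventually, rule allI)
      fix i
      define X where "X = (\<lambda>m. m i) ` snd ` set l"
      have "Max X \<in> X" using False by (intro Max_in) (auto simp: X_def)
      moreover have "m i \<le> Max X" if "m \<in> snd ` set l" for m
        by (rule Max_ge) (use that in \<open>auto simp: X_def\<close>)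
      moreover from \<open>Max X \<in> X\<close> obtain ms where "ms \<in> snd ` set l" "Max X = ms i"
        unfolding X_def by (rule imageE) blast
      ultimately show "\<exists>ms\<in>snd ` set l. \<forall>m\<in>snd ` set l. m i \<le> ms i"
        by (intro bexI[of _ ms]) auto
    qed
    then obtain ms where ms: "ms \<in> snd ` set l" "\<forall>\<^sub>F i in uf. \<forall>m\<in>snd ` set l. m i \<le> ms i"
      by (subst (asm) ev_finite_ex) auto
    let ?l0 = "filter (\<lambda>(c, m). near ms m) l" and ?l1 = "filter (\<lambda>(c, m). \<not> near ms m) l"
    have l0: "lin rho ?l0 = 0" by (rule top_chain_vanishes[OF less.prems ms])
    then have l1: "lin rho ?l1 = 0"
      using lin_filter[of rho l "\<lambda>(c, m). near ms m"] less.prems by (simp add: case_prod_unfold)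
    show ?thesis
    proof (cases "near m0 ms")
      case True
      then have "filter (\<lambda>(c, m). near m0 m) l = ?l0"
        by (intro filter_cong) (auto intro: near_trans near_sym)
      then show ?thesis using l0 by simp
    next
      case False
      have "near m0 m \<longrightarrow> \<not> near ms m" for m
        using False near_trans near_sym by blast
      then have "filter (\<lambda>(c, m). near m0 m) l = filter (\<lambda>(c, m). near m0 m) ?l1"
        by (auto simp: filter_filter intro!: filter_cong)
      moreover have "length ?l1 < length l"
      proof -
        from ms(1) obtain c where "(c, ms) \<in> set l" by auto
        then show ?thesis by (intro length_filter_less[of "(c, ms)"]) auto
      qed
      ultimately show ?thesis using less.hyps l1 by metis
    qed
  qed simp
qed

text \<open>A relation that holds at a nonstandard position holds at all positions, because a
  combination that does not vanish identically is eventually nonzero. Hence the relations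
  along a nonstandard chain do not depend on the chain.\<close>

lemma chain_relation_iff:
  fixes m :: "nat \<times> 'a set \<Rightarrow> nat"
  assumes m: "nonstd m"
  shows "lin (\<lambda>k. rho (shift m k)) l = 0 \<longleftrightarrow>
    (\<forall>j. (\<forall>k\<in>snd ` set l. 0 \<le> j + k) \<longrightarrow> lin (\<lambda>k. int (r (nat (j + k)))) l = 0)"
proof -
  define k0 where "k0 = Min (snd ` set l)"
  have k0: "k0 \<le> k" if "k \<in> snd ` set l" for k
    unfolding k0_def by (rule Min_le) (use that in auto)
  define S where "S t = lin (\<lambda>k. int (r (t + nat (k - k0)))) l" for t
  have S: "lin (\<lambda>k. int (r (nat (j + k)))) l = S (nat (j + k0))" if "0 \<le> j + k0" for j
    unfolding S_def using that k0 by (intro lin_cong) (force intro: arg_cong[where f = r])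
  have L: "lin (\<lambda>k. rho (shift m k)) l = hyp (\<lambda>i. lin (\<lambda>k. int (r (nat (int (m i) + k)))) l)"
    unfolding rho_def shift_def by (rule lin_hyp)
  show ?thesis
  proof
    assume "lin (\<lambda>k. rho (shift m k)) l = 0"
    then have "\<forall>\<^sub>F i in uf. lin (\<lambda>k. int (r (nat (int (m i) + k)))) l = 0"
      by (simp add: L hyp_zero hyp_eq_iff)
    then have z: "\<forall>\<^sub>F i in uf. S (nat (int (m i) + k0)) = 0"
      using nonstd_ge_int[OF m, of "- k0"] by eventually_elim (simp add: S)
    have "\<forall>t. S t = 0"
    proof (rule ccontr)
      assume "\<not> (\<forall>t. S t = 0)"
      then obtain \<epsilon> where \<epsilon>: "\<epsilon> > 0" "\<forall>\<^sub>F t in sequentially. \<epsilon> * real (r t) \<le> \<bar>real_of_int (S t)\<bar>"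
        using shape_dichotomy[OF k0] unfolding S_def by blast
      from z nonstd_eventually[OF m \<epsilon>(2), of k0] nonstd_ge_int[OF m, of "1 - k0"]
      have "\<forall>\<^sub>F i :: nat \<times> 'a set in uf. i \<noteq> i"
      proof eventually_elim
        case (elim i)
        then have "\<epsilon> * real (r (nat (int (m i) + k0))) \<le> 0" by simp
        moreover have "0 < r (nat (int (m i) + k0))" using elim(3) by (intro r_pos) simp
        ultimately show ?case using \<epsilon>(1) by (simp add: mult_le_0_iff)
      qed
      then show False by (simp add: eventually_False)
    qed
    have "k0 \<in> snd ` set l" if "l \<noteq> []" unfolding k0_def by (rule Min_in) (use that in auto)
    then show "\<forall>j. (\<forall>k\<in>snd ` set l. 0 \<le> j + k) \<longrightarrow> lin (\<lambda>k. int (r (nat (j + k)))) l = 0"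
      using \<open>\<forall>t. S t = 0\<close> S by (cases "l = []") auto
  next
    assume a: "\<forall>j. (\<forall>k\<in>snd ` set l. 0 \<le> j + k) \<longrightarrow> lin (\<lambda>k. int (r (nat (j + k)))) l = 0"
    from nonstd_ge_int[OF m, of "- k0"]
    have "\<forall>\<^sub>F i in uf. lin (\<lambda>k. int (r (nat (int (m i) + k)))) l = 0"
      by eventually_elim (rule a[rule_format], use k0 in force)
    then show "lin (\<lambda>k. rho (shift m k)) l = 0" by (simp add: L hyp_zero hyp_eq_iff)
  qed
qed

end

section \<open>Chains of members of \<open>R\<close>\<close>

context regular_sequence
begin

text \<open>The index of a member of \<open>R\<close> is unique up to equality almost everywhere. The notions
  below are invariant under such changes, and meaningful for members of \<open>R\<close> only.\<close>

definition idx :: "'a hyp \<Rightarrow> nat \<times> 'a set \<Rightarrow> nat" where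
  "idx x = (SOME m. x = rho m)"

definition linked :: "'a hyp \<Rightarrow> 'a hyp \<Rightarrow> bool" where
  "linked x y \<longleftrightarrow> near (idx x) (idx y)"

definition nonstandard :: "'a hyp \<Rightarrow> bool" where
  "nonstandard x \<longleftrightarrow> nonstd (idx x)"

definition shifted :: "'a hyp \<Rightarrow> int \<Rightarrow> 'a hyp" where
  "shifted x k = rho (shift (idx x) k)"

lemma rho_idx [simp]: "x \<in> RN \<Longrightarrow> rho (idx x) = x"
  unfolding idx_def RN_def by (metis (mono_tags) imageE someI_ex)

lemma rho_eq_iff: "rho m = rho m' \<longleftrightarrow> (\<forall>\<^sub>F i in uf. m i = m' i)"
  by (simp add: rho_def hyp_eq_iff)

lemma near_eq: "\<forall>\<^sub>F i in uf. m i = m' i \<Longrightarrow> near m m'"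
  unfolding near_def by (intro exI[of _ 0]) (auto elim: eventually_mono)

lemma idx_rho: "\<forall>\<^sub>F i in uf. idx (rho m) i = m i"
  using rho_idx[OF rho_RN, of m] unfolding rho_eq_iff .

lemma linked_refl [simp]: "linked x x" by (simp add: linked_def)

lemma linked_sym: "linked x y \<Longrightarrow> linked y x" by (auto simp: linked_def near_sym)

lemma linked_trans: "linked x y \<Longrightarrow> linked y z \<Longrightarrow> linked x z" by (auto simp: linked_def intro: near_trans)

lemma shifted_RN [simp]: "shifted x k \<in> RN" by (simp add: shifted_def)

lemma nonstandard_linked: "nonstandard x \<Longrightarrow> linked x y \<Longrightarrow> nonstandard y"
  by (auto simp: nonstandard_def linked_def intro: nonstd_near)

lemma idx_shifted: "nonstandard x \<Longrightarrow> \<forall>\<^sub>F i in uf. int (idx (shifted x k) i) = int (idx x i) + k"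
proof -
  assume "nonstandard x"
  then have "\<forall>\<^sub>F i in uf. - k \<le> int (idx x i)" unfolding nonstandard_def by (rule nonstd_ge_int)
  with idx_rho[of "shift (idx x) k"] show ?thesis
    unfolding shifted_def by eventually_elim (simp add: shift_def)
qed

lemma linked_shifted: "nonstandard x \<Longrightarrow> linked x (shifted x k)"
  using idx_shifted[of x k] by (auto simp: linked_def near_def)

lemma nonstandard_shifted: "nonstandard x \<Longrightarrow> nonstandard (shifted x k)"
  using linked_shifted nonstandard_linked by blast

lemma RN_eqI: "x \<in> RN \<Longrightarrow> y \<in> RN \<Longrightarrow> \<forall>\<^sub>F i in uf. idx x i = idx y i \<Longrightarrow> x = y"
  using rho_eq_iff[of "idx x" "idx y"] by simp

lemma linkedE:
  assumes "nonstandard x" "y \<in> RN" "linked x y"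
  obtains k where "y = shifted x k"
proof -
  from assms(3) obtain k where k: "\<forall>\<^sub>F i in uf. int (idx y i) = int (idx x i) + k"
    by (auto simp: linked_def near_def)
  have "y = shifted x k"
  proof (rule RN_eqI[OF assms(2) shifted_RN])
    show "\<forall>\<^sub>F i in uf. idx y i = idx (shifted x k) i"
      using k idx_shifted[OF assms(1), of k] by eventually_elim simp
  qed
  then show thesis by (rule that)
qed

lemma shifted_0 [simp]: "x \<in> RN \<Longrightarrow> shifted x 0 = x"
  unfolding shifted_def by (simp add: shift_def[abs_def])

lemma shifted_shifted: "nonstandard x \<Longrightarrow> shifted (shifted x j) k = shifted x (j + k)"
proof -
  assume x: "nonstandard x"
  have "\<forall>\<^sub>F i in uf. idx (shifted (shifted x j) k) i = idx (shifted x (j + k)) i"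
    using idx_shifted[OF x, of j] idx_shifted[OF nonstandard_shifted[OF x], of j k] idx_shifted[OF x, of "j + k"]
    by eventually_elim simp
  then show ?thesis by (intro RN_eqI) auto
qed

text \<open>An index that is bounded almost everywhere is constant almost everywhere.\<close>

lemma std_iff:
  assumes "x \<in> RN"
  shows "\<not> nonstandard x \<longleftrightarrow> (\<exists>j. x = of_nat (r j))"
proof
  assume "\<not> nonstandard x"
  then obtain j where "\<forall>\<^sub>F i in uf. idx x i = j" unfolding nonstandard_def by (rule not_nonstdE)
  then have "rho (idx x) = rho (\<lambda>_. j)" by (simp add: rho_eq_iff)
  then have "x = of_nat (r j)"
    using rho_idx[OF assms] by (simp add: rho_def[of "\<lambda>_. j"] hyp_of_nat)
  then show "\<exists>j. x = of_nat (r j)" by blast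
next
  assume "\<exists>j. x = of_nat (r j)"
  then obtain j where "x = rho (\<lambda>_. j)" by (auto simp: rho_def hyp_of_nat)
  with idx_rho[of "\<lambda>_. j"] have j: "\<forall>\<^sub>F i in uf. idx x i = j" by simp
  show "\<not> nonstandard x"
  proof
    assume "nonstandard x"
    then have "\<forall>\<^sub>F i in uf. Suc j \<le> idx x i" by (auto simp: nonstandard_def nonstd_def)
    with j have "\<forall>\<^sub>F i :: nat \<times> 'a set in uf. i \<noteq> i" by eventually_elim simp
    then show False by (simp add: eventually_False)
  qed
qed

lemma std_RN: "of_nat (r j) \<in> RN"
  using rho_RN[of "\<lambda>_. j"] by (simp add: rho_def hyp_of_nat)

text \<open>This is \<open>chains_independent\<close> for the members of \<open>R\<close> instead of their indices.\<close>

lemma lin_chain: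
  assumes "snd ` set l \<subseteq> RN" "lin id l = 0"
  shows "lin id (filter (\<lambda>p. linked x (snd p)) l) = 0"
proof -
  have conv: "lin id l' = lin rho (map (\<lambda>(c, y). (c, idx y)) l')" if "snd ` set l' \<subseteq> RN" for l'
    unfolding lin_map by (rule lin_cong) (use that in auto)
  have "filter (\<lambda>(c, m). near (idx x) m) (map (\<lambda>(c, y). (c, idx y)) l)
      = map (\<lambda>(c, y). (c, idx y)) (filter (\<lambda>p. linked x (snd p)) l)"
    by (simp add: filter_map linked_def o_def case_prod_unfold)
  moreover have "lin rho (filter (\<lambda>(c, m). near (idx x) m) (map (\<lambda>(c, y). (c, idx y)) l)) = 0"
    by (intro chains_independent) (simp add: conv[OF assms(1), symmetric] assms(2))
  ultimately show ?thesis using assms(1) by (subst conv) auto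
qed

lemma lin_shifted_iff: "nonstandard x \<Longrightarrow> nonstandard y \<Longrightarrow> lin (shifted x) l = 0 \<longleftrightarrow> lin (shifted y) l = 0"
  unfolding shifted_def nonstandard_def by (simp only: chain_relation_iff)

lemma RN_nonstandard_nonzero: "nonstandard x \<Longrightarrow> x \<in> RN \<Longrightarrow> x \<noteq> 0"
proof
  assume "nonstandard x" "x \<in> RN" "x = 0"
  then have "rho (idx x) = 0" by simp
  then have "\<forall>\<^sub>F i in uf. r (idx x i) = 0" by (simp add: rho_def hyp_zero hyp_eq_iff)
  moreover have "\<forall>\<^sub>F i in uf. 1 \<le> idx x i" using \<open>nonstandard x\<close> by (auto simp: nonstandard_def nonstd_def)
  ultimately have "\<forall>\<^sub>F i :: nat \<times> 'a set in uf. i \<noteq> i"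
  proof eventually_elim
    case (elim i) then show ?case using r_pos[of "idx x i"] by simp
  qed
  then show False by (simp add: eventually_False)
qed

section \<open>Good subgroups and partial isomorphisms\<close>

text \<open>Whether a combination of members of \<open>R\<close> vanishes depends only on the relations in
  their chains. In a good subgroup the outside members of \<open>R\<close> satisfy no further relations
  modulo the subgroup.\<close>

definition good :: "'a hyp set \<Rightarrow> bool" where
  "good A \<longleftrightarrow> (\<forall>l. snd ` set l \<subseteq> RN - A \<longrightarrow> lin id l \<in> A \<longrightarrow> lin id l = 0)"

lemma goodD: "good A \<Longrightarrow> snd ` set l \<subseteq> RN - A \<Longrightarrow> lin id l \<in> A \<Longrightarrow> lin id l = 0"
  by (auto simp: good_def)

text \<open>Partial isomorphisms between good pure subgroups. The case \<open>n = 0\<close> of divisibility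
  says that \<open>\<Gamma>\<close> is single-valued and injective. The unit belongs to the domain; so do the
  standard members of \<open>R\<close>, and only nonstandard chains remain to be added.\<close>

definition piso :: "('a hyp \<times> 'a hyp) set \<Rightarrow> bool" where
  "piso \<Gamma> \<longleftrightarrow> (1, 1) \<in> \<Gamma> \<and> (\<forall>x y x' y'. (x, y) \<in> \<Gamma> \<longrightarrow> (x', y') \<in> \<Gamma> \<longrightarrow> (x - x', y - y') \<in> \<Gamma>) \<and>
     (\<forall>n x y. n \<noteq> 0 \<longrightarrow> (of_int n * x, of_int n * y) \<in> \<Gamma> \<longrightarrow> (x, y) \<in> \<Gamma>) \<and>
     (\<forall>x y. (x, y) \<in> \<Gamma> \<longrightarrow> (x \<in> RN \<longleftrightarrow> y \<in> RN)) \<and>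
     (\<forall>x y n. (x, y) \<in> \<Gamma> \<longrightarrow> (of_int n dvd x \<longleftrightarrow> of_int n dvd y)) \<and>
     good (Domain \<Gamma>) \<and> good (Range \<Gamma>)"

lemma piso_D:
  assumes "piso \<Gamma>"
  shows piso_1: "(1, 1) \<in> \<Gamma>"
    and piso_diff: "(x, y) \<in> \<Gamma> \<Longrightarrow> (x', y') \<in> \<Gamma> \<Longrightarrow> (x - x', y - y') \<in> \<Gamma>"
    and piso_pure: "n \<noteq> 0 \<Longrightarrow> (of_int n * x, of_int n * y) \<in> \<Gamma> \<Longrightarrow> (x, y) \<in> \<Gamma>"
    and piso_RN: "(x, y) \<in> \<Gamma> \<Longrightarrow> x \<in> RN \<longleftrightarrow> y \<in> RN"
    and piso_dvd: "(x, y) \<in> \<Gamma> \<Longrightarrow> of_int n dvd x \<longleftrightarrow> of_int n dvd y"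
    and piso_good: "good (Domain \<Gamma>)" "good (Range \<Gamma>)"
  using assms unfolding piso_def by blast+

lemma piso_converse: "piso \<Gamma> \<Longrightarrow> piso (\<Gamma>\<inverse>)"
  unfolding piso_def by (simp add: Domain_converse Range_converse)

lemma piso_0: "piso \<Gamma> \<Longrightarrow> (0, 0) \<in> \<Gamma>"
  using piso_diff[OF _ piso_1 piso_1] by fastforce

lemma piso_zero: "piso \<Gamma> \<Longrightarrow> (x, y) \<in> \<Gamma> \<Longrightarrow> x = 0 \<longleftrightarrow> y = 0"
  using piso_dvd[of \<Gamma> x y 0] by simp

lemma piso_minus: "piso \<Gamma> \<Longrightarrow> (x, y) \<in> \<Gamma> \<Longrightarrow> (- x, - y) \<in> \<Gamma>"
  using piso_diff[OF _ piso_0, of \<Gamma> x y] by simp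

lemma piso_add: "piso \<Gamma> \<Longrightarrow> (x, y) \<in> \<Gamma> \<Longrightarrow> (x', y') \<in> \<Gamma> \<Longrightarrow> (x + x', y + y') \<in> \<Gamma>"
  using piso_diff[OF _ _ piso_minus, of \<Gamma> x y x' y'] by simp

lemma piso_mult: "piso \<Gamma> \<Longrightarrow> (x, y) \<in> \<Gamma> \<Longrightarrow> (of_int n * x, of_int n * y) \<in> \<Gamma>"
proof -
  assume A: "piso \<Gamma>" "(x, y) \<in> \<Gamma>"
  have *: "(of_nat k * x, of_nat k * y) \<in> \<Gamma>" for k
    by (induction k) (use A in \<open>auto simp: distrib_right piso_0 intro: piso_add\<close>)
  show ?thesis
  proof (cases "n \<ge> 0")
    case True then show ?thesis using *[of "nat n"] by simp
  next
    case False then show ?thesis using piso_minus[OF A(1) *[of "nat (- n)"]] by simp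
  qed
qed

lemma piso_of_int: "piso \<Gamma> \<Longrightarrow> (of_int n, of_int n) \<in> \<Gamma>"
  using piso_mult[OF _ piso_1, of \<Gamma> n] by simp

lemma piso_lin: "piso \<Gamma> \<Longrightarrow> (\<And>z. z \<in> snd ` set l \<Longrightarrow> (f z, g z) \<in> \<Gamma>) \<Longrightarrow> (lin f l, lin g l) \<in> \<Gamma>"
  by (induction l) (auto simp: piso_0 intro!: piso_add piso_mult)

lemma piso_fun: "piso \<Gamma> \<Longrightarrow> (x, y) \<in> \<Gamma> \<Longrightarrow> (x, y') \<in> \<Gamma> \<Longrightarrow> y = y'"
  using piso_zero[OF _ piso_diff, of \<Gamma> x y x y'] by simp

lemma piso_inj: "piso \<Gamma> \<Longrightarrow> (x, y) \<in> \<Gamma> \<Longrightarrow> (x', y) \<in> \<Gamma> \<Longrightarrow> x = x'"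
  using piso_zero[OF _ piso_diff, of \<Gamma> x y x' y] by simp

lemma piso_psub_Domain: "piso \<Gamma> \<Longrightarrow> psub (Domain \<Gamma>)"
proof -
  assume G: "piso \<Gamma>"
  have "x \<in> Domain \<Gamma>" if "n \<noteq> 0" "(of_int n * x, y) \<in> \<Gamma>" for n x y
  proof -
    have "of_int n dvd y" using piso_dvd[OF G that(2), of n] by simp
    then obtain y' where "y = of_int n * y'" by (auto elim: dvdE)
    then show ?thesis using piso_pure[OF G that(1)] that(2) by blast
  qed
  then show ?thesis unfolding psub_def using piso_0[OF G] piso_diff[OF G] by blast
qed

lemma piso_psub_Range: "piso \<Gamma> \<Longrightarrow> psub (Range \<Gamma>)"
  using piso_psub_Domain[OF piso_converse] by (simp add: Domain_converse)

text \<open>Divisibility determines the residues, because differences with standard integers are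
  in the domain.\<close>

lemma piso_residue:
  assumes "piso \<Gamma>" "(x, y) \<in> \<Gamma>" "n \<noteq> 0"
  shows "of_int n dvd x - y"
proof -
  obtain j where j: "of_int n dvd x - of_int j" using residue_ex[OF assms(3)] by blast
  have "(x - of_int j, y - of_int j) \<in> \<Gamma>" by (intro piso_diff piso_of_int assms)
  from piso_dvd[OF assms(1) this] j have "of_int n dvd y - of_int j" by blast
  with j have "of_int n dvd (x - of_int j) - (y - of_int j)" by (rule dvd_diff)
  then show ?thesis by simp
qed

subsection \<open>Extending partial isomorphisms\<close>

text \<open>The pure relation generated by \<open>\<Gamma>\<close> and the pairs in \<open>P\<close>.\<close>

definition ext :: "('a hyp \<times> 'a hyp) set \<Rightarrow> ('a hyp \<times> 'a hyp) set \<Rightarrow> ('a hyp \<times> 'a hyp) set" where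
  "ext \<Gamma> P = {(x, y). \<exists>n a b l. n \<noteq> 0 \<and> (a, b) \<in> \<Gamma> \<and> snd ` set l \<subseteq> P \<and>
     of_int n * x = a + lin fst l \<and> of_int n * y = b + lin snd l}"

lemma extI:
  "n \<noteq> 0 \<Longrightarrow> (a, b) \<in> \<Gamma> \<Longrightarrow> snd ` set l \<subseteq> P \<Longrightarrow> of_int n * x = a + lin fst l \<Longrightarrow>
    of_int n * y = b + lin snd l \<Longrightarrow> (x, y) \<in> ext \<Gamma> P"
  unfolding ext_def by blast

lemma extE:
  assumes "(x, y) \<in> ext \<Gamma> P"
  obtains n a b l where "n \<noteq> 0" "(a, b) \<in> \<Gamma>" "snd ` set l \<subseteq> P" "of_int n * x = a + lin fst l"
    "of_int n * y = b + lin snd l"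
  using assms unfolding ext_def by blast

lemma ext_base: "\<Gamma> \<subseteq> ext \<Gamma> P"
  by (auto intro!: extI[of 1 _ _ _ "[]"])

lemma ext_new: "piso \<Gamma> \<Longrightarrow> P \<subseteq> ext \<Gamma> P"
  by (auto intro!: extI[of 1 0 0 _ "[(1, p)]" for p] piso_0)

text \<open>Divisibility of \<open>x\<close> by \<open>m\<close>, where \<open>n x = a + \<dots>\<close>, is a matter of the residues modulo
  \<open>n m\<close>. These agree on \<open>\<Gamma>\<close> and on \<open>P\<close>.\<close>

lemma piso_ext:
  assumes G: "piso \<Gamma>"
    and cong: "\<And>u v n. (u, v) \<in> P \<Longrightarrow> n \<noteq> 0 \<Longrightarrow> of_int n dvd u - v"
    and zero: "\<And>a b l. (a, b) \<in> \<Gamma> \<Longrightarrow> snd ` set l \<subseteq> P \<Longrightarrow> a + lin fst l = 0 \<longleftrightarrow> b + lin snd l = 0"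
    and R: "\<And>x y. (x, y) \<in> ext \<Gamma> P \<Longrightarrow> x \<in> RN \<longleftrightarrow> y \<in> RN"
    and good: "good (Domain (ext \<Gamma> P))" "good (Range (ext \<Gamma> P))"
  shows "piso (ext \<Gamma> P)"
  unfolding piso_def
proof (intro conjI allI impI R good)
  show "(1, 1) \<in> ext \<Gamma> P" using ext_base piso_1[OF G] by blast
  show "(x - x', y - y') \<in> ext \<Gamma> P" if xy: "(x, y) \<in> ext \<Gamma> P" and xy': "(x', y') \<in> ext \<Gamma> P" for x y x' y'
  proof -
    obtain n a b l where 1: "n \<noteq> 0" "(a, b) \<in> \<Gamma>" "snd ` set l \<subseteq> P" "of_int n * x = a + lin fst l"
      "of_int n * y = b + lin snd l" by (rule extE[OF xy])
    obtain n' a' b' l' where 2: "n' \<noteq> 0" "(a', b') \<in> \<Gamma>" "snd ` set l' \<subseteq> P" "of_int n' * x' = a' + lin fst l'"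
      "of_int n' * y' = b' + lin snd l'" by (rule extE[OF xy'])
    show ?thesis
    proof (rule extI[where n = "n * n'" and l = "scale n' l @ scale (- n) l'"])
      show "(of_int n' * a - of_int n * a', of_int n' * b - of_int n * b') \<in> \<Gamma>"
        by (intro piso_diff[OF G] piso_mult[OF G] 1 2)
      have "of_int (n * n') * (x - x') = of_int n' * (of_int n * x) - of_int n * (of_int n' * x')"
        "of_int (n * n') * (y - y') = of_int n' * (of_int n * y) - of_int n * (of_int n' * y')"
        by (simp_all add: algebra_simps)
      then show "of_int (n * n') * (x - x')
          = of_int n' * a - of_int n * a' + lin fst (scale n' l @ scale (- n) l')"
        "of_int (n * n') * (y - y')
          = of_int n' * b - of_int n * b' + lin snd (scale n' l @ scale (- n) l')"
        unfolding 1 2 by (simp_all add: algebra_simps)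
      show "snd ` set (scale n' l @ scale (- n) l') \<subseteq> P"
        using 1(3) 2(3) by (simp add: image_Un)
    qed (use 1 2 in simp)
  qed
  show "(x, y) \<in> ext \<Gamma> P" if n: "n \<noteq> 0" and xy: "(of_int n * x, of_int n * y) \<in> ext \<Gamma> P" for n x y
  proof -
    obtain k a b l where 1: "k \<noteq> 0" "(a, b) \<in> \<Gamma>" "snd ` set l \<subseteq> P"
      "of_int k * (of_int n * x) = a + lin fst l" "of_int k * (of_int n * y) = b + lin snd l"
      by (rule extE[OF xy])
    then show ?thesis using n by (intro extI[where n = "k * n"]) (auto simp: mult.assoc)
  qed
  show "of_int m dvd x \<longleftrightarrow> of_int m dvd y" if xy: "(x, y) \<in> ext \<Gamma> P" for x y m
  proof -
    obtain n a b l where 1: "n \<noteq> 0" "(a, b) \<in> \<Gamma>" "snd ` set l \<subseteq> P" "of_int n * x = a + lin fst l"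
      "of_int n * y = b + lin snd l" by (rule extE[OF xy])
    show ?thesis
    proof (cases "m = 0")
      case True
      have "x = 0 \<longleftrightarrow> of_int n * x = 0" "y = 0 \<longleftrightarrow> of_int n * y = 0" using 1(1) by auto
      then show ?thesis unfolding 1(4,5) using True zero[OF 1(2,3)] by simp
    next
      case False
      have nm: "n * m \<noteq> 0" using 1(1) False by simp
      have "of_int (n * m) dvd lin (\<lambda>p. fst p - snd p) l" using 1(3)
      proof (induction l)
        case (Cons q l)
        obtain c u v where q: "q = (c, (u, v))" by (cases q) auto
        have "of_int (n * m) dvd u - v" by (rule cong[OF _ nm]) (use Cons q in auto)
        moreover have "of_int (n * m) dvd lin (\<lambda>p. fst p - snd p) l" using Cons by auto
        ultimately show ?case unfolding q by (simp del: of_int_mult)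
      qed simp
      moreover have "lin (\<lambda>p. fst p - snd p) l = lin fst l - lin snd l" by (induction l) (auto simp: algebra_simps)
      moreover have "of_int (n * m) dvd a - b" by (rule piso_residue[OF G 1(2) nm])
      ultimately have "of_int (n * m) dvd (a - b) + (lin fst l - lin snd l)" by (metis dvd_add)
      then have d: "of_int (n * m) dvd of_int n * x - of_int n * y"
        unfolding 1(4,5) by (simp add: algebra_simps)
      have n0: "(of_int n :: 'a hyp) \<noteq> 0" using 1(1) by simp
      have "of_int m dvd x - y"
        using d n0 unfolding of_int_mult right_diff_distrib[symmetric] by (simp only: dvd_mult_cancel_left) blast
      then show ?thesis by (metis dvd_add_right_iff diff_add_cancel)
    qed
  qed
qed



lemma good_add_eq_0:
  assumes A: "psub A" "good A" and l: "\<And>z. z \<in> snd ` set l \<Longrightarrow> f z \<in> RN - A"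
    and a: "a \<in> A" and n: "of_int n * x = a + lin f l" "x \<in> A"
  shows "lin f l = 0"
proof -
  have "lin f l = of_int n * x - a" using n by simp
  also have "\<dots> \<in> A" by (intro psub_diff psub_mult A n a)
  finally have "lin id (map (\<lambda>(c, k). (c, f k)) l) \<in> A" by (simp add: lin_id_map)
  moreover have "snd ` set (map (\<lambda>(c, k). (c, f k)) l) \<subseteq> RN - A" using l by force
  ultimately show ?thesis using goodD[OF A(2)] lin_id_map[of f l] by metis
qed

text \<open>Adjoining the chain of \<open>s\<close> to a good subgroup adds no members of \<open>R\<close> except that
  chain: if \<open>x\<close> is not in \<open>A\<close>, a relation between \<open>x\<close>, the chain and \<open>A\<close> forces \<open>x\<close> to be
  linked to \<open>s\<close>, since otherwise \<open>x\<close> would be alone in its chain.\<close>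

lemma chain_element:
  assumes A: "psub A" "good A" and s: "nonstandard s" "s \<in> RN"
    and l: "\<And>k. k \<in> snd ` set l \<Longrightarrow> shifted s k \<notin> A"
    and a: "a \<in> A" and n: "n \<noteq> 0" "of_int n * x = a + lin (shifted s) l" and x: "x \<in> RN"
  shows "lin (shifted s) l = 0 \<and> x \<in> A \<or> a = 0 \<and> (\<exists>j. x = shifted s j)"
proof (cases "x \<in> A")
  case True
  have "lin (shifted s) l = 0" by (rule good_add_eq_0[OF A _ a n(2) True]) (use l in auto)
  then show ?thesis using True by blast
next
  case False
  define L where "L = (n, x) # scale (- 1) (map (\<lambda>(c, k). (c, shifted s k)) l)"
  have linL: "lin id L = a" using n(2) by (simp add: L_def lin_id_map)
  have LR: "snd ` set L \<subseteq> RN - A" using l x False by (force simp: L_def scale_def)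
  have a0: "a = 0" using goodD[OF A(2) LR] linL a by simp
  have "linked s x"
  proof (rule ccontr)
    assume "\<not> linked s x"
    then have "\<not> linked x (shifted s k)" for k using linked_shifted[OF s(1)] linked_trans linked_sym by blast
    then have "filter (\<lambda>p. linked x (snd p)) L = [(n, x)]"
      by (auto simp: L_def scale_def filter_empty_conv)
    moreover have "lin id (filter (\<lambda>p. linked x (snd p)) L) = 0"
      by (rule lin_chain) (use LR linL a0 in auto)
    ultimately have "x = 0" using n(1) by simp
    then show False using False psub_0[OF A(1)] by simp
  qed
  then show ?thesis using a0 linkedE[OF s(1) x] by blast
qed

text \<open>The chain of \<open>t\<close> is matched with the chain of \<open>s\<close>. A good subgroup may contain a part
  of the chain of \<open>s\<close>, and this part has its images already.\<close>

definition chain_pairs :: "'a hyp set \<Rightarrow> 'a hyp \<Rightarrow> 'a hyp \<Rightarrow> ('a hyp \<times> 'a hyp) set" where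
  "chain_pairs A s t = (\<lambda>k. (shifted s k, shifted t k)) ` {k. shifted s k \<notin> A}"

text \<open>By goodness, the elements \<open>a + \<Sum> c\<^sub>k s\<^sub>k\<close> satisfy no relations except those within \<open>A\<close>
  and within the chain of \<open>s\<close>, and the latter are the same for the chain of \<open>t\<close>.\<close>

lemma piso_chain:
  assumes G: "piso \<Gamma>" and s: "s \<in> RN" "nonstandard s" and t: "t \<in> RN" "nonstandard t"
    and new: "\<And>k. shifted t k \<notin> Range \<Gamma>"
    and cong: "\<And>n k. n \<noteq> 0 \<Longrightarrow> of_int n dvd shifted s k - shifted t k"
  shows "piso (ext \<Gamma> (chain_pairs (Domain \<Gamma>) s t))"
proof -
  define K where "K = {k. shifted s k \<notin> Domain \<Gamma>}"
  define P where "P = (\<lambda>k. (shifted s k, shifted t k)) ` K"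
  let ?A = "Domain \<Gamma>" and ?B = "Range \<Gamma>"
  note A = piso_psub_Domain[OF G] piso_good(1)[OF G] and B = piso_psub_Range[OF G] piso_good(2)[OF G]
  have norm: thesis if xy: "(x, y) \<in> ext \<Gamma> P"
    and th: "\<And>n a b l. n \<noteq> 0 \<Longrightarrow> (a, b) \<in> \<Gamma> \<Longrightarrow> snd ` set l \<subseteq> K \<Longrightarrow>
      of_int n * x = a + lin (shifted s) l \<Longrightarrow> of_int n * y = b + lin (shifted t) l \<Longrightarrow> thesis" for x y thesis
  proof -
    obtain n a b l where 1: "n \<noteq> 0" "(a, b) \<in> \<Gamma>" "snd ` set l \<subseteq> P" "of_int n * x = a + lin fst l"
      "of_int n * y = b + lin snd l" by (rule extE[OF xy])
    obtain l' where "snd ` set l' \<subseteq> K" "lin fst l = lin (shifted s) l'" "lin snd l = lin (shifted t) l'"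
      using pair_list[OF 1(3)[unfolded P_def]] by blast
    then show thesis using th[of n a b l'] 1 by simp
  qed
  have rel: "lin (shifted s) l = 0 \<longleftrightarrow> lin (shifted t) l = 0" for l by (rule lin_shifted_iff[OF s(2) t(2)])
  have KA: "shifted s k \<in> RN - ?A" if "snd ` set l \<subseteq> K" "k \<in> snd ` set l" for k and l :: "(int \<times> int) list"
    using that by (auto simp: K_def)
  have "piso (ext \<Gamma> P)"
  proof (rule piso_ext[OF G])
    show "of_int n dvd u - v" if "(u, v) \<in> P" "n \<noteq> 0" for u v n
      using that cong by (auto simp: P_def)
    show "a + lin fst l = 0 \<longleftrightarrow> b + lin snd l = 0" if ab: "(a, b) \<in> \<Gamma>" and l: "snd ` set l \<subseteq> P" for a b l
    proof -
      obtain l' where l': "snd ` set l' \<subseteq> K" "lin fst l = lin (shifted s) l'" "lin snd l = lin (shifted t) l'"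
        using pair_list[OF l[unfolded P_def]] by blast
      have "lin (shifted s) l' = 0" if "a + lin (shifted s) l' = 0"
        by (rule good_add_eq_0[OF A, where a = a and n = 0 and x = 0])
          (use l' KA ab that psub_0[OF A(1)] in auto)
      moreover have "lin (shifted t) l' = 0" if "b + lin (shifted t) l' = 0"
        by (rule good_add_eq_0[OF B, where a = b and n = 0 and x = 0])
          (use l' new ab that psub_0[OF B(1)] in auto)
      ultimately show ?thesis unfolding l' using rel[of l'] piso_zero[OF G ab] by fastforce
    qed
    show "x \<in> RN \<longleftrightarrow> y \<in> RN" if xy: "(x, y) \<in> ext \<Gamma> P" for x y
    proof -
      obtain n a b l where 1: "n \<noteq> 0" "(a, b) \<in> \<Gamma>" "snd ` set l \<subseteq> K"
        "of_int n * x = a + lin (shifted s) l" "of_int n * y = b + lin (shifted t) l" by (rule norm[OF xy])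
      have both: "(x, y) \<in> \<Gamma>" if "lin (shifted s) l = 0"
        using that 1 rel[of l] piso_pure[OF G 1(1), of x y] by simp
      have ab: "a = 0 \<longleftrightarrow> b = 0" by (rule piso_zero[OF G 1(2)])
      have chain: "x = shifted s j \<longleftrightarrow> y = shifted t j" if "a = 0" for j
      proof -
        have "x = shifted s j \<longleftrightarrow> of_int n * shifted s j - lin (shifted s) l = 0"
          using 1(1,4) that mult_cancel_left[of "of_int n" x "shifted s j"] by auto
        also have "\<dots> \<longleftrightarrow> lin (shifted s) ((n, j) # scale (- 1) l) = 0" by simp
        also have "\<dots> \<longleftrightarrow> lin (shifted t) ((n, j) # scale (- 1) l) = 0" by (rule rel)
        also have "\<dots> \<longleftrightarrow> y = shifted t j" using 1(1,5) that ab mult_cancel_left[of "of_int n" y "shifted t j"] by auto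
        finally show ?thesis .
      qed
      have "y \<in> RN" if "x \<in> RN"
        using chain_element[OF A s(2,1) _ _ 1(1,4) that] KA[OF 1(3)] 1(2) both chain that piso_RN[OF G]
        by fastforce
      moreover have "x \<in> RN" if "y \<in> RN"
        using chain_element[OF B t(2,1) _ _ 1(1,5) that] new 1(2) both chain rel ab that piso_RN[OF G]
        by fastforce
      ultimately show ?thesis by blast
    qed
    show "good (Domain (ext \<Gamma> P))" unfolding good_def
    proof (intro allI impI)
      fix w assume w: "snd ` set w \<subseteq> RN - Domain (ext \<Gamma> P)" and "lin id w \<in> Domain (ext \<Gamma> P)"
      then obtain y where "(lin id w, y) \<in> ext \<Gamma> P" by blast
      then obtain n a b l where 1: "n \<noteq> 0" "(a, b) \<in> \<Gamma>" "snd ` set l \<subseteq> K"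
        "of_int n * lin id w = a + lin (shifted s) l" by (rule norm)
      define L where "L = scale n w @ scale (- 1) (map (\<lambda>(c, k). (c, shifted s k)) l)"
      have linL: "lin id L = a" using 1(4) by (simp add: L_def lin_id_map)
      have LR: "snd ` set L \<subseteq> RN - ?A"
      proof -
        have "snd ` set w \<subseteq> RN - ?A" using w ext_base by blast
        moreover have "snd ` set (map (\<lambda>(c, k). (c, shifted s k)) l) \<subseteq> RN - ?A"
          using KA[OF 1(3)] by force
        ultimately show ?thesis by (simp add: L_def image_Un)
      qed
      have a0: "a = 0" using goodD[OF A(2) LR] linL 1(2) by auto
      have "shifted s k \<in> Domain (ext \<Gamma> P)" for k
      proof (cases "k \<in> K")
        case True
        then have "(shifted s k, shifted t k) \<in> P" by (simp add: P_def)
        then show ?thesis using ext_new[OF G] by blast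
      next
        case False then show ?thesis using ext_base by (auto simp: K_def)
      qed
      then have unlinked: "\<not> linked s z" if "z \<in> snd ` set w" for z
        by (metis DiffE linkedE s(2) subsetD that w)
      have "filter (\<lambda>p. linked s (snd p)) L = scale (- 1) (map (\<lambda>(c, k). (c, shifted s k)) l)"
      proof -
        have "filter (\<lambda>p. linked s (snd p)) (scale n w) = []"
          unfolding filter_empty_conv using unlinked snd_scale[of n w]
          by (metis image_eqI)
        moreover have "filter (\<lambda>p. linked s (snd p)) (scale (- 1) (map (\<lambda>(c, k). (c, shifted s k)) l))
            = scale (- 1) (map (\<lambda>(c, k). (c, shifted s k)) l)"
          by (rule filter_True) (auto simp: scale_def linked_shifted[OF s(2)])
        ultimately show ?thesis by (simp add: L_def)
      qed
      moreover have "lin id (filter (\<lambda>p. linked s (snd p)) L) = 0"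
        by (rule lin_chain) (use LR linL a0 in auto)
      ultimately have "lin (shifted s) l = 0" by (simp add: lin_id_map)
      then show "lin id w = 0" using 1(1,4) a0 by simp
    qed
    show "good (Range (ext \<Gamma> P))" unfolding good_def
    proof (intro allI impI)
      fix w assume w: "snd ` set w \<subseteq> RN - Range (ext \<Gamma> P)" and "lin id w \<in> Range (ext \<Gamma> P)"
      then obtain x where "(x, lin id w) \<in> ext \<Gamma> P" by blast
      then obtain n a b l where 1: "n \<noteq> 0" "(a, b) \<in> \<Gamma>" "snd ` set l \<subseteq> K"
        "of_int n * lin id w = b + lin (shifted t) l" by (rule norm)
      define L where "L = scale n w @ scale (- 1) (map (\<lambda>(c, k). (c, shifted t k)) l)"
      have linL: "lin id L = b" using 1(4) by (simp add: L_def lin_id_map)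
      have LR: "snd ` set L \<subseteq> RN - ?B"
      proof -
        have "snd ` set w \<subseteq> RN - ?B" using w ext_base by blast
        moreover have "snd ` set (map (\<lambda>(c, k). (c, shifted t k)) l) \<subseteq> RN - ?B"
          using new by force
        ultimately show ?thesis by (simp add: L_def image_Un)
      qed
      have b0: "b = 0" using goodD[OF B(2) LR] linL 1(2) by auto
      \<comment> \<open>The members of \<open>w\<close> in the chain of \<open>t\<close> correspond to members of the chain of \<open>s\<close> in the
        old domain, so goodness of the old domain separates them from \<open>l\<close>.\<close>
      have "\<exists>l'. (\<forall>k\<in>snd ` set l'. shifted s k \<in> ?A) \<and>
          lin id (filter (\<lambda>p. linked t (snd p)) w) = lin (shifted t) l'" using w
      proof (induction w)
        case Nil then show ?case by (intro exI[of _ "[]"]) simp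
      next
        case (Cons p w)
        obtain c z where p: "p = (c, z)" by (cases p)
        have "snd ` set w \<subseteq> RN - Range (ext \<Gamma> P)" using Cons.prems by simp
        from Cons.IH[OF this] obtain l' where l': "\<forall>k\<in>snd ` set l'. shifted s k \<in> ?A"
          "lin id (filter (\<lambda>p. linked t (snd p)) w) = lin (shifted t) l'" by blast
        show ?case
        proof (cases "linked t z")
          case True
          then obtain k where k: "z = shifted t k" using linkedE[OF t(2), of z] Cons.prems p by auto
          have "k \<notin> K"
          proof
            assume "k \<in> K"
            then have "(shifted s k, shifted t k) \<in> P" by (simp add: P_def)
            then show False using ext_new[OF G] Cons.prems k p by fastforce
          qed
          then show ?thesis using True k l' p by (intro exI[of _ "(c, k) # l'"]) (auto simp: K_def simp flip: id_def)
        qed (use l' p in \<open>auto simp flip: id_def\<close>)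
      qed
      then obtain l' where l': "\<forall>k\<in>snd ` set l'. shifted s k \<in> ?A"
        "lin id (filter (\<lambda>p. linked t (snd p)) w) = lin (shifted t) l'" by blast
      have "filter (\<lambda>p. linked t (snd p)) L
          = scale n (filter (\<lambda>p. linked t (snd p)) w) @ scale (- 1) (map (\<lambda>(c, k). (c, shifted t k)) l)"
        by (auto simp: L_def scale_def filter_map o_def case_prod_unfold linked_shifted[OF t(2)]
            intro!: filter_True)
      moreover have "lin id (filter (\<lambda>p. linked t (snd p)) L) = 0"
        by (rule lin_chain) (use LR linL b0 in auto)
      ultimately have "lin (shifted t) (scale n l' @ scale (- 1) l) = 0"
        by (simp add: lin_id_map l')
      then have "lin (shifted s) (scale n l' @ scale (- 1) l) = 0" by (simp only: rel)
      then have eq: "of_int n * lin (shifted s) l' = 0 + lin (shifted s) l" by simp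
      have "lin (shifted s) l = 0"
      proof (rule good_add_eq_0[OF A _ psub_0[OF A(1)] eq])
        show "lin (shifted s) l' \<in> ?A" by (rule psub_lin[OF A(1)]) (use l'(1) in blast)
      qed (rule KA[OF 1(3)])
      then show "lin id w = 0" using 1(1,4) b0 by (simp add: rel)
    qed
  qed
  then show ?thesis by (simp add: chain_pairs_def P_def K_def)
qed

text \<open>A generic element is independent of \<open>A\<close> and \<open>R\<close> over the rationals.\<close>

definition generic :: "'a hyp set \<Rightarrow> 'a hyp \<Rightarrow> bool" where
  "generic A x \<longleftrightarrow> (\<forall>n a l. n \<noteq> 0 \<longrightarrow> a \<in> A \<longrightarrow> snd ` set l \<subseteq> RN \<longrightarrow> of_int n * x \<noteq> a + lin id l)"

lemma genericD:
  assumes "generic A x" "a \<in> A" "snd ` set l \<subseteq> RN" "of_int n * x = a + lin id l" shows "n = 0"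
  using assms by (auto simp: generic_def)

text \<open>No element whose representation involves \<open>x\<close> nontrivially is in the span of \<open>A\<close> and
  \<open>R\<close>. So neither members of \<open>R\<close> nor relations between them are added.\<close>

lemma piso_generic:
  assumes G: "piso \<Gamma>" and x: "generic (Domain \<Gamma>) x" and x': "generic (Range \<Gamma>) x'"
    and cong: "\<And>n. n \<noteq> 0 \<Longrightarrow> of_int n dvd x - x'"
  shows "piso (ext \<Gamma> {(x, x')})"
proof -
  let ?A = "Domain \<Gamma>" and ?B = "Range \<Gamma>"
  note A = piso_psub_Domain[OF G] piso_good(1)[OF G] and B = piso_psub_Range[OF G] piso_good(2)[OF G]
  have single: "\<exists>c. lin fst l = of_int c * x \<and> lin snd l = of_int c * x'" if "snd ` set l \<subseteq> {(x, x')}" for l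
    using that
  proof (induction l)
    case Nil then show ?case by (intro exI[of _ 0]) simp
  next
    case (Cons p l)
    then obtain c where c: "lin fst l = of_int c * x" "lin snd l = of_int c * x'" by auto
    from Cons.prems obtain d where "p = (d, (x, x'))" by (cases p) auto
    then show ?case using c by (intro exI[of _ "d + c"]) (simp add: algebra_simps)
  qed
  have norm: thesis if uv: "(u, v) \<in> ext \<Gamma> {(x, x')}"
    and th: "\<And>n a b c. n \<noteq> 0 \<Longrightarrow> (a, b) \<in> \<Gamma> \<Longrightarrow>
      of_int n * u = a + of_int c * x \<Longrightarrow> of_int n * v = b + of_int c * x' \<Longrightarrow> thesis" for u v thesis
  proof -
    obtain n a b l where 1: "n \<noteq> 0" "(a, b) \<in> \<Gamma>" "snd ` set l \<subseteq> {(x, x')}" "of_int n * u = a + lin fst l"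
      "of_int n * v = b + lin snd l" by (rule extE[OF uv])
    obtain c where "lin fst l = of_int c * x" "lin snd l = of_int c * x'" using single[OF 1(3)] by blast
    then show thesis using th[of n a b c] 1 by simp
  qed
  \<comment> \<open>The coefficient of a generic element in a combination of members of \<open>R\<close>, taken modulo \<open>C\<close>, vanishes.\<close>
  have span: "c = 0" if "generic C z" "psub C" "n \<noteq> 0" "a \<in> C" "snd ` set l \<subseteq> RN"
    "of_int n * lin id l = a + of_int c * z" for C z n a c l
  proof -
    have "of_int c * z = - a + lin id (scale n l)" using that(6) by (simp add: algebra_simps)
    then show ?thesis using genericD[OF that(1), of "- a" "scale n l" c] psub_minus[OF that(2,4)] that(5)
      by simp
  qed
  have base: "(u, v) \<in> \<Gamma>" if "n \<noteq> 0" "(a, b) \<in> \<Gamma>" "of_int n * u = a" "of_int n * v = b" for n a b u v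
    using piso_pure[OF G that(1)] that by simp
  show ?thesis
  proof (rule piso_ext[OF G])
    show "of_int n dvd u - v" if "(u, v) \<in> {(x, x')}" "n \<noteq> 0" for u v n
      using that cong by auto
    show "a + lin fst l = 0 \<longleftrightarrow> b + lin snd l = 0" if ab: "(a, b) \<in> \<Gamma>" and l: "snd ` set l \<subseteq> {(x, x')}" for a b l
    proof -
      obtain c where c: "lin fst l = of_int c * x" "lin snd l = of_int c * x'" using single[OF l] by blast
      have "c = 0" if "a + of_int c * x = 0"
        using span[OF x A(1), of 1 a "[]" c] ab that by auto
      moreover have "c = 0" if "b + of_int c * x' = 0"
        using span[OF x' B(1), of 1 b "[]" c] ab that by auto
      ultimately show ?thesis unfolding c using piso_zero[OF G ab] by fastforce
    qed
    show "u \<in> RN \<longleftrightarrow> v \<in> RN" if uv: "(u, v) \<in> ext \<Gamma> {(x, x')}" for u v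
    proof -
      obtain n a b c where 1: "n \<noteq> 0" "(a, b) \<in> \<Gamma>" "of_int n * u = a + of_int c * x"
        "of_int n * v = b + of_int c * x'" by (rule norm[OF uv])
      have "c = 0" if "u \<in> RN"
        using span[OF x A(1) 1(1), of a "[(1, u)]" c] 1 that by auto
      moreover have "c = 0" if "v \<in> RN"
        using span[OF x' B(1) 1(1), of b "[(1, v)]" c] 1 that by auto
      moreover have "u \<in> RN \<longleftrightarrow> v \<in> RN" if "c = 0"
        using base[OF 1(1,2)] 1 that piso_RN[OF G] by simp
      ultimately show ?thesis by blast
    qed
    show "good (Domain (ext \<Gamma> {(x, x')}))" unfolding good_def
    proof (intro allI impI)
      fix w assume w: "snd ` set w \<subseteq> RN - Domain (ext \<Gamma> {(x, x')})" and "lin id w \<in> Domain (ext \<Gamma> {(x, x')})"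
      then obtain y where "(lin id w, y) \<in> ext \<Gamma> {(x, x')}" by blast
      then obtain n a b c where 1: "n \<noteq> 0" "(a, b) \<in> \<Gamma>" "of_int n * lin id w = a + of_int c * x"
        by (rule norm)
      have "c = 0" by (rule span[OF x A(1) 1(1) _ _ 1(3)]) (use 1 w in auto)
      then have "lin id w \<in> ?A" using 1 psub_pure[OF A(1) 1(1), of "lin id w"] by auto
      moreover have "snd ` set w \<subseteq> RN - ?A" using w ext_base by blast
      ultimately show "lin id w = 0" by (intro goodD[OF A(2)])
    qed
    show "good (Range (ext \<Gamma> {(x, x')}))" unfolding good_def
    proof (intro allI impI)
      fix w assume w: "snd ` set w \<subseteq> RN - Range (ext \<Gamma> {(x, x')})" and "lin id w \<in> Range (ext \<Gamma> {(x, x')})"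
      then obtain y where "(y, lin id w) \<in> ext \<Gamma> {(x, x')}" by blast
      then obtain n a b c where 1: "n \<noteq> 0" "(a, b) \<in> \<Gamma>" "of_int n * lin id w = b + of_int c * x'"
        by (rule norm)
      have "c = 0" by (rule span[OF x' B(1) 1(1) _ _ 1(3)]) (use 1 w in auto)
      then have "lin id w \<in> ?B" using 1 psub_pure[OF B(1) 1(1), of "lin id w"] by auto
      moreover have "snd ` set w \<subseteq> RN - ?B" using w ext_base by blast
      ultimately show "lin id w = 0" by (intro goodD[OF B(2)])
    qed
  qed
qed



section \<open>Good hulls\<close>

lemma lin_chains:
  assumes "snd ` set l \<subseteq> RN" "lin id l = 0" and Q: "\<And>x y. linked x y \<Longrightarrow> Q x \<Longrightarrow> Q y"
  shows "lin id (filter (\<lambda>p. Q (snd p)) l) = 0"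
  using assms(1,2)
proof (induction "length l" arbitrary: l rule: less_induct)
  case less
  show ?case
  proof (cases "\<exists>p\<in>set l. Q (snd p)")
    case False
    then have "filter (\<lambda>p. Q (snd p)) l = []" by (auto simp: filter_empty_conv)
    then show ?thesis by simp
  next
    case True
    then obtain q where q: "q \<in> set l" "Q (snd q)" by blast
    let ?z = "snd q"
    let ?l0 = "filter (\<lambda>p. linked ?z (snd p)) l" and ?l1 = "filter (\<lambda>p. \<not> linked ?z (snd p)) l"
    have l0: "lin id ?l0 = 0" by (rule lin_chain[OF less.prems])
    have l1: "lin id ?l1 = 0" using lin_filter[of id l "\<lambda>p. linked ?z (snd p)"] l0 less.prems by simp
    have "length ?l1 < length l" using q(1) by (intro length_filter_less) auto
    then have IH: "lin id (filter (\<lambda>p. Q (snd p)) ?l1) = 0"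
      using less.prems(1) l1 by (intro less.hyps) auto
    have "filter (\<lambda>p. linked ?z (snd p)) (filter (\<lambda>p. Q (snd p)) l) = ?l0"
      using Q q(2) by (auto simp: filter_filter intro!: filter_cong)
    moreover have "filter (\<lambda>p. \<not> linked ?z (snd p)) (filter (\<lambda>p. Q (snd p)) l) = filter (\<lambda>p. Q (snd p)) ?l1"
      by (auto simp: filter_filter intro!: filter_cong)
    ultimately show ?thesis
      using lin_filter[of id "filter (\<lambda>p. Q (snd p)) l" "\<lambda>p. linked ?z (snd p)"] l0 IH by simp
  qed
qed

lemma good_UNIV: "good UNIV"
  by (auto simp: good_def)

lemma card_of_qspan_le:
  assumes \<kappa>: "Card_order \<kappa>" "\<not> finite (Field \<kappa>)" and Y: "|Y| \<le>o \<kappa>"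
  shows "|qspan Y| \<le>o \<kappa>"
proof -
  have "qspan Y \<subseteq> (\<lambda>(n, l). THE x. of_int n * x = lin id l) ` (UNIV \<times> lists (UNIV \<times> Y))"
  proof
    fix x assume "x \<in> qspan Y"
    then obtain n l where 1: "n \<noteq> 0" "snd ` set l \<subseteq> Y" "of_int n * x = lin id l" by (rule qspanE)
    have "x' = x" if "of_int n * x' = lin id l" for x'
    proof -
      have "of_int n * x' = of_int n * x" using that 1(3) by simp
      then show ?thesis using 1(1) by simp
    qed
    then have "x = (THE x. of_int n * x = lin id l)" using 1(3) by (intro the_equality[symmetric])
    moreover have "l \<in> lists (UNIV \<times> Y)" using 1(2) by (force simp: in_lists_conv_set)
    ultimately show "x \<in> (\<lambda>(n, l). THE x. of_int n * x = lin id l) ` (UNIV \<times> lists (UNIV \<times> Y))"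
      by (intro image_eqI[of _ _ "(n, l)"]) auto
  qed
  then show ?thesis
    by (rule card_of_subset_le)
      (intro card_of_image_le card_of_Times_ordLeq_infinite_Field card_of_coeff_lists_le countable_le_infinite \<kappa> Y, simp)
qed

text \<open>Goodness of \<open>A\<close> does not imply that \<open>A\<close> contains with one member of a chain the
  others.\<close>

definition chain_closed_in :: "'a hyp set \<Rightarrow> 'a hyp set \<Rightarrow> bool" where
  "chain_closed_in C A \<longleftrightarrow> (\<forall>t t'. t \<in> RN \<inter> A \<longrightarrow> t' \<in> RN \<inter> C \<longrightarrow> linked t t' \<longrightarrow> t' \<in> A)"

lemma countable_chain:
  assumes z: "z \<in> RN"
  shows "countable {t \<in> RN. linked z t}"
proof -
  have "{t \<in> RN. linked z t} \<subseteq> range (shifted z) \<union> range (\<lambda>j. of_nat (r j))"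
  proof
    fix t assume "t \<in> {t \<in> RN. linked z t}"
    then have t: "t \<in> RN" "linked z t" by auto
    show "t \<in> range (shifted z) \<union> range (\<lambda>j. of_nat (r j))"
    proof (cases "nonstandard z")
      case True then show ?thesis using linkedE[OF True t] by blast
    next
      case False
      then have "\<not> nonstandard t" using nonstandard_linked linked_sym t(2) by blast
      then show ?thesis using std_iff[OF t(1)] by blast
    qed
  qed
  then show ?thesis by (rule countable_subset) simp
qed

text \<open>For every combination of \<open>X\<close> that has a multiple in the span of the members of \<open>R\<close> in
  \<open>C\<close>, choose one such representation. The chains of all members of \<open>R\<close> in these
  representations, together with \<open>X\<close> and the standard members of \<open>R\<close>, generate the hull:
  two representations of the same element differ by a relation, which holds chainwise.\<close>

lemma good_hull:
  assumes C: "psub C" "good C" "1 \<in> C" and XC: "X \<subseteq> C"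
    and \<kappa>: "Card_order \<kappa>" "\<not> finite (Field \<kappa>)" and X: "|X| \<le>o \<kappa>"
  obtains A where "X \<subseteq> A" "A \<subseteq> C" "psub A" "good A" "1 \<in> A" "chain_closed_in C A" "|A| \<le>o \<kappa>"
proof -
  define rep where "rep l = (SOME w. snd ` set w \<subseteq> RN \<inter> C \<and> (\<exists>m. m \<noteq> 0 \<and> of_int m * lin id l = lin id w))"
    for l :: "(int \<times> 'a hyp) list"
  define T where "T = {t. \<exists>l\<in>lists (UNIV \<times> X). t \<in> snd ` set (rep l)} \<inter> RN"
  define S where "S = {t \<in> RN \<inter> C. (\<exists>z\<in>T. linked z t) \<or> \<not> nonstandard t}"
  define Y where "Y = insert 1 (X \<union> S)"
  have "S \<subseteq> C" by (auto simp: S_def)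
  then have YC: "Y \<subseteq> C" using XC C(3) by (auto simp: Y_def)
  then have AC: "qspan Y \<subseteq> C" by (rule qspan_subset[OF C(1)])
  have S_RN: "S \<subseteq> RN" by (auto simp: S_def)
  have S_closed: "t' \<in> S" if "t \<in> S" "t' \<in> RN" "t' \<in> C" "linked t t'" for t t'
    using that nonstandard_linked[OF _ linked_sym] by (auto simp: S_def intro: linked_trans)
  have YA: "Y \<subseteq> qspan Y" by (rule qspan_base)
  \<comment> \<open>The unit is a rational multiple of a standard member of \<open>R\<close>.\<close>
  have no1: "x \<in> qspan (X \<union> S)" if "x \<in> qspan Y" for x
  proof -
    have "of_nat (r 1) \<in> S"
      using psub_of_nat[OF C(1,3)] std_RN[of 1] std_iff[OF std_RN[of 1]] by (auto simp: S_def)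
    then have "1 \<in> qspan (X \<union> S)"
      using r_pos[of 1] by (intro qspanI[of "int (r 1)" "[(1, of_nat (r 1))]"]) auto
    then have "Y \<subseteq> qspan (X \<union> S)" using qspan_base[of "X \<union> S"] by (auto simp: Y_def)
    then show ?thesis using qspan_subset[OF psub_qspan] that by blast
  qed
  \<comment> \<open>Comparison of \<open>u\<close> with the chosen representation \<open>v\<close> in terms of \<open>S\<close>: if no member of \<open>u\<close> is in
    \<open>S\<close>, then the chains of \<open>S\<close> and of \<open>u\<close> are disjoint and both sides vanish.\<close>
  have key: "lin id (filter (\<lambda>p. snd p \<in> C) u) = 0 \<or> (\<exists>t\<in>snd ` set u. t \<in> S)"
    if u: "snd ` set u \<subseteq> RN" and uA: "lin id u \<in> qspan Y"
      and out: "lin id (filter (\<lambda>p. snd p \<notin> C) u) = 0" for u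
  proof -
    obtain n l where 1: "n \<noteq> 0" "snd ` set l \<subseteq> X \<union> S" "of_int n * lin id u = lin id l"
      using no1[OF uA] by (rule qspanE)
    define lX where "lX = filter (\<lambda>p. snd p \<in> X) l"
    define lS where "lS = filter (\<lambda>p. snd p \<notin> X) l"
    have l: "lin id l = lin id lX + lin id lS" unfolding lX_def lS_def by (rule lin_filter)
    have lS: "snd ` set lS \<subseteq> S" using 1(2) by (auto simp: lS_def)
    have lX: "lX \<in> lists (UNIV \<times> X)" by (force simp: lX_def)
    let ?u = "filter (\<lambda>p. snd p \<in> C) u"
    have uC: "lin id u = lin id ?u" using lin_filter[of id u "\<lambda>p. snd p \<in> C"] out by simp
    have "\<exists>w. snd ` set w \<subseteq> RN \<inter> C \<and> (\<exists>m. m \<noteq> 0 \<and> of_int m * lin id lX = lin id w)"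
    proof (intro exI conjI)
      show "of_int 1 * lin id lX = lin id (scale n ?u @ scale (- 1) lS)"
        using 1(3) l uC by (simp add: algebra_simps)
      show "snd ` set (scale n ?u @ scale (- 1) lS) \<subseteq> RN \<inter> C"
        unfolding snd_append snd_scale using u lS S_RN \<open>S \<subseteq> C\<close> by auto
    qed simp
    from someI_ex[OF this] obtain m where m: "snd ` set (rep lX) \<subseteq> RN \<inter> C" "m \<noteq> 0"
      "of_int m * lin id lX = lin id (rep lX)" unfolding rep_def by blast
    have repS: "snd ` set (rep lX) \<subseteq> S"
    proof
      fix t assume t: "t \<in> snd ` set (rep lX)"
      then have "t \<in> T" using lX m(1) unfolding T_def by blast
      then show "t \<in> S" using t m(1) linked_refl[of t] unfolding S_def by blast
    qed
    define v where "v = rep lX @ scale m lS"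
    have v: "snd ` set v \<subseteq> S" using repS lS by (simp add: v_def image_Un)
    have "of_int (m * n) * lin id u = lin id v"
      using 1(3) l m(3) by (simp add: v_def algebra_simps)
    then have eq: "of_int (m * n) * lin id ?u = lin id v" using uC by simp
    show ?thesis
    proof (cases "\<exists>t\<in>snd ` set u. t \<in> S")
      case False
      define Q where "Q t \<longleftrightarrow> (\<exists>z\<in>S. linked z t)" for t
      define L where "L = scale (m * n) ?u @ scale (- 1) v"
      have "lin id (filter (\<lambda>p. Q (snd p)) L) = 0"
      proof (rule lin_chains)
        show "snd ` set L \<subseteq> RN" unfolding L_def snd_append snd_scale using u v S_RN by auto
        show "lin id L = 0" using eq by (simp add: L_def)
        show "Q y" if "linked x y" "Q x" for x y using that linked_trans unfolding Q_def by blast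
      qed
      moreover have "filter (\<lambda>p. Q (snd p)) L = scale (- 1) v"
      proof -
        have "\<not> Q t" if t: "t \<in> snd ` set (scale (m * n) ?u)" for t
        proof
          assume "Q t"
          have "t \<in> RN" "t \<in> C" "t \<in> snd ` set u" using t u unfolding snd_scale by auto
          then show False using \<open>Q t\<close> S_closed False unfolding Q_def by blast
        qed
        then have "filter (\<lambda>p. Q (snd p)) (scale (m * n) ?u) = []"
          unfolding filter_empty_conv by (metis image_eqI)
        moreover have "Q t" if "t \<in> snd ` set (scale (- 1) v)" for t
          using that v linked_refl unfolding snd_scale Q_def by blast
        then have "filter (\<lambda>p. Q (snd p)) (scale (- 1) v) = scale (- 1) v"
          by (intro filter_True) (metis image_eqI)
        ultimately show ?thesis by (simp add: L_def)
      qed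
      ultimately have "lin id v = 0" by simp
      then show ?thesis using eq m(2) 1(1) by simp
    qed blast
  qed
  show thesis
  proof (rule that)
    show "X \<subseteq> qspan Y" "1 \<in> qspan Y" using YA by (auto simp: Y_def)
    show "qspan Y \<subseteq> C" by (rule AC)
    show "psub (qspan Y)" by (rule psub_qspan)
    show "good (qspan Y)" unfolding good_def
    proof (intro allI impI)
      fix u assume u: "snd ` set u \<subseteq> RN - qspan Y" and uA: "lin id u \<in> qspan Y"
      let ?u = "filter (\<lambda>p. snd p \<in> C) u"
      have out: "lin id (filter (\<lambda>p. snd p \<notin> C) u) = 0"
      proof (rule goodD[OF C(2)])
        show "snd ` set (filter (\<lambda>p. snd p \<notin> C) u) \<subseteq> RN - C" using u by auto
        have "lin id ?u \<in> C" by (rule psub_lin[OF C(1)]) auto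
        moreover have "lin id u \<in> C" using uA AC by blast
        moreover have "lin id (filter (\<lambda>p. snd p \<notin> C) u) = lin id u - lin id ?u"
          using lin_filter[of id u "\<lambda>p. snd p \<in> C"] by simp
        ultimately show "lin id (filter (\<lambda>p. snd p \<notin> C) u) \<in> C" using psub_diff[OF C(1)] by simp
      qed
      have "\<not> (\<exists>t\<in>snd ` set u. t \<in> S)" using u YA by (auto simp: Y_def)
      with key[OF _ uA out] u have "lin id ?u = 0" by blast
      then show "lin id u = 0" using lin_filter[of id u "\<lambda>p. snd p \<in> C"] out by simp
    qed
    show "chain_closed_in C (qspan Y)" unfolding chain_closed_in_def
    proof (intro allI impI)
      fix t t' assume t: "t \<in> RN \<inter> qspan Y" and t': "t' \<in> RN \<inter> C" and l: "linked t t'"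
      have tC: "t \<in> C" using t AC by blast
      have "t \<in> S"
      proof (cases "nonstandard t")
        case True
        have "lin id (filter (\<lambda>p. snd p \<in> C) [(1, t)]) \<noteq> 0"
          using RN_nonstandard_nonzero[OF True] t tC by simp
        then show ?thesis using key[of "[(1, t)]"] t tC by auto
      next
        case False
        then show ?thesis using t tC by (auto simp: S_def)
      qed
      then have "t' \<in> S" using S_closed t' l by blast
      then show "t' \<in> qspan Y" using YA by (auto simp: Y_def)
    qed
    have "|T| \<le>o \<kappa>"
    proof -
      have "T \<subseteq> (\<Union>l\<in>lists (UNIV \<times> X). snd ` set (rep l))" by (auto simp: T_def)
      moreover have "|\<Union>l\<in>lists ((UNIV :: int set) \<times> X). snd ` set (rep l)| \<le>o \<kappa>"
        by (rule card_of_UNION_ordLeq_infinite_Field[OF \<kappa>(2,1) card_of_coeff_lists_le[OF \<kappa> X]])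
          (auto intro!: countable_le_infinite[OF \<kappa>] intro: countable_finite)
      ultimately show ?thesis by (rule card_of_subset_le)
    qed
    have "|S| \<le>o \<kappa>"
    proof -
      have "S \<subseteq> (\<Union>z\<in>T. {t \<in> RN. linked z t}) \<union> range (\<lambda>j. of_nat (r j))"
        using std_iff by (auto simp: S_def)
      moreover have "|(\<Union>z\<in>T. {t \<in> RN. linked z t}) \<union> range (\<lambda>j. of_nat (r j))| \<le>o \<kappa>"
        by (intro card_of_Un_ordLeq_infinite_Field \<kappa> card_of_UNION_ordLeq_infinite_Field \<open>|T| \<le>o \<kappa>\<close> ballI
            countable_le_infinite) (auto simp: T_def countable_chain)
      ultimately show ?thesis by (rule card_of_subset_le)
    qed
    then have "|Y| \<le>o \<kappa>"
      unfolding Y_def using card_of_Un_ordLeq_infinite_Field[OF \<kappa>(2) countable_le_infinite[OF \<kappa>, of "{1}"]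
        card_of_Un_ordLeq_infinite_Field[OF \<kappa>(2) X \<open>|S| \<le>o \<kappa>\<close> \<kappa>(1)] \<kappa>(1)] by simp
    then show "|qspan Y| \<le>o \<kappa>" by (rule card_of_qspan_le[OF \<kappa>])
  qed
qed

lemma countable_good_hull:
  assumes "psub C" "good C" "1 \<in> C" "X \<subseteq> C" "countable X"
  obtains A where "X \<subseteq> A" "A \<subseteq> C" "psub A" "good A" "1 \<in> A" "chain_closed_in C A" "countable A"
proof (rule good_hull[OF assms(1-4), of natLeq])
  show "Card_order natLeq" by (rule natLeq_Card_order)
  show "\<not> finite (Field natLeq)" by (simp add: Field_natLeq)
  show "|X| \<le>o natLeq" using assms(5) by (simp add: countable_card_le_natLeq)
  fix A assume "X \<subseteq> A" "A \<subseteq> C" "psub A" "good A" "1 \<in> A" "chain_closed_in C A" "|A| \<le>o natLeq"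
  then show thesis by (intro that) (auto simp: countable_card_le_natLeq)
qed



section \<open>Back and forth\<close>

lemma finite_val_eq: "finite {x. int (r (nat (int x + k))) = c}"
proof (cases "\<exists>y. int (r (nat (int y + k))) = c")
  case True
  then obtain y where y: "int (r (nat (int y + k))) = c" by blast
  have "{x. int (r (nat (int x + k))) = c} \<subseteq> {..y + nat \<bar>k\<bar>}"
  proof
    fix x assume "x \<in> {x. int (r (nat (int x + k))) = c}"
    then have "int (r (nat (int x + k))) = int (r (nat (int y + k)))" using y by simp
    then have "nat (int x + k) = nat (int y + k)" by (simp only: of_nat_eq_iff r_eq_iff)
    then show "x \<in> {..y + nat \<bar>k\<bar>}" by (simp add: nat_eq_iff split: if_splits)
  qed
  then show ?thesis by (rule finite_subset) simp
qed simp

lemma shifted_hyp: "shifted x k = hyp (\<lambda>i. int (r (nat (int (idx x i) + k))))"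
  by (simp add: shifted_def rho_def shift_def)

text \<open>Only finitely many residues have to be copied at a time. The residue pattern of the
  terms near the nonstandard index of \<open>s\<close> is attained infinitely often, and only finitely
  many indices conflict with finitely many elements of \<open>E\<close>. Saturation does the rest.\<close>

lemma chain_copy:
  fixes s :: "'a hyp"
  assumes s: "s \<in> RN" "nonstandard s" and E: "countable E"
  obtains t where "t \<in> RN" "nonstandard t" "\<And>k. shifted t k \<notin> E"
    "\<And>n k. n \<noteq> 0 \<Longrightarrow> of_int n dvd shifted s k - shifted t k"
proof -
  define m where "m = idx s"
  \<comment> \<open>Avoiding the standard members of \<open>R\<close> makes the new chain nonstandard.\<close>
  define E' where "E' = E \<union> range (\<lambda>j. of_nat (r j))"
  define val where "val k x = int (r (nat (int x + k)))" for k x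
  define q1 where "q1 = (\<lambda>(n, k) (i :: nat \<times> 'a set) x. n dvd val k (m i) - val k x)"
  define q2 where "q2 = (\<lambda>(e, k) (i :: nat \<times> 'a set) x. coord e i \<noteq> val k x)"
  define C1 where "C1 = {n :: int. n \<noteq> 0} \<times> (UNIV :: int set)"
  define C2 where "C2 = E' \<times> (UNIV :: int set)"
  have "\<exists>X. \<forall>q\<in>q1 ` C1 \<union> q2 ` C2. \<forall>\<^sub>F i in uf. q i (X i)"
  proof (rule internal_saturation)
    show "countable (q1 ` C1 \<union> q2 ` C2)" using E by (auto simp: C1_def C2_def E'_def)
    fix J assume "finite J" "J \<subseteq> q1 ` C1 \<union> q2 ` C2"
    then obtain F1 F2 where F: "finite F1" "F1 \<subseteq> C1" "finite F2" "F2 \<subseteq> C2" "J = q1 ` F1 \<union> q2 ` F2"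
      by (rule finite_subset_Un_image)
    define M where "M = (\<Prod>p\<in>F1. fst p)"
    have M0: "M \<noteq> 0" using F(1,2) by (auto simp: M_def C1_def)
    have Mdvd: "fst p dvd M" if "p \<in> F1" for p
      unfolding M_def using F(1) that by (rule dvd_prodI)
    define pat where "pat x = (\<lambda>p. if p \<in> F1 then val (snd p) x mod \<bar>M\<bar> else 0)" for x
    have "range pat \<subseteq> {f. \<forall>p. (p \<in> F1 \<longrightarrow> f p \<in> {0..<\<bar>M\<bar>}) \<and> (p \<notin> F1 \<longrightarrow> f p = 0)}"
      using M0 by (auto simp: pat_def)
    then have fin: "finite (range pat)"
      by (rule finite_subset) (rule finite_set_of_finite_funs, use F(1) in auto)
    have "\<forall>\<^sub>F i in uf. \<exists>\<pi>\<in>range pat. pat (m i) = \<pi>" by simp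
    then obtain \<pi> where \<pi>: "\<forall>\<^sub>F i in uf. pat (m i) = \<pi>" unfolding ev_finite_ex[OF fin] by blast
    have "infinite {x. pat x = \<pi>}"
      unfolding infinite_nat_iff_unbounded_le
    proof
      fix D
      have "\<forall>\<^sub>F i in uf. D \<le> m i" using s(2) by (auto simp: nonstandard_def nonstd_def m_def)
      with \<pi> have "\<forall>\<^sub>F i in uf. D \<le> m i \<and> pat (m i) = \<pi>" by eventually_elim simp
      then obtain i where "D \<le> m i" "pat (m i) = \<pi>" using eventually_happens'[OF uf_neq_bot] by blast
      then show "\<exists>x\<ge>D. x \<in> {x. pat x = \<pi>}" by blast
    qed
    from \<pi> show "\<forall>\<^sub>F i in uf. \<exists>x. \<forall>q\<in>J. q i x"
    proof eventually_elim
      case (elim i)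
      define bad where "bad = (\<Union>p\<in>F2. {x. val (snd p) x = coord (fst p) i})"
      have "finite bad" unfolding bad_def val_def by (intro finite_UN_I F(3) finite_val_eq)
      then have "infinite ({x. pat x = \<pi>} - bad)" using \<open>infinite {x. pat x = \<pi>}\<close> by (rule Diff_infinite_finite)
      then obtain x where x: "pat x = \<pi>" "x \<notin> bad" using infinite_imp_nonempty by blast
      have "q1 p i x" if "p \<in> F1" for p
      proof -
        have "val (snd p) (m i) mod \<bar>M\<bar> = val (snd p) x mod \<bar>M\<bar>"
        proof -
          have "pat (m i) p = pat x p" using elim x(1) by simp
          then show ?thesis using that by (simp add: pat_def)
        qed
        then have "M dvd val (snd p) (m i) - val (snd p) x" by (simp add: mod_eq_dvd_iff)
        then show ?thesis using Mdvd[OF that] dvd_trans by (auto simp: q1_def case_prod_unfold)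
      qed
      moreover have "q2 p i x" if "p \<in> F2" for p
        using x(2) that by (cases p) (auto simp: q2_def bad_def)
      ultimately show ?case unfolding F(5) by blast
    qed
  qed
  then obtain X where X1: "\<And>n k. n \<noteq> 0 \<Longrightarrow> \<forall>\<^sub>F i in uf. n dvd val k (m i) - val k (X i)"
    and X2: "\<And>e k. e \<in> E' \<Longrightarrow> \<forall>\<^sub>F i in uf. coord e i \<noteq> val k (X i)"
    unfolding q1_def q2_def C1_def C2_def by fastforce
  have sftX: "shifted (rho X) k = hyp (\<lambda>i. val k (X i))" for k
    unfolding shifted_hyp hyp_eq_iff val_def using idx_rho[of X] by (auto elim: eventually_mono)
  have avoid: "shifted (rho X) k \<notin> E'" for k
  proof
    assume "shifted (rho X) k \<in> E'"
    from X2[OF this, of k] have "\<not> (\<forall>\<^sub>F i in uf. coord (shifted (rho X) k) i = val k (X i))"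
      by (simp add: ev_not)
    moreover have "hyp (coord (shifted (rho X) k)) = hyp (\<lambda>i. val k (X i))" by (simp add: sftX)
    ultimately show False unfolding hyp_eq_iff by blast
  qed
  show thesis
  proof (rule that[of "rho X"])
    show "nonstandard (rho X)" using avoid[of 0] std_iff[OF rho_RN, of X] by (auto simp: E'_def)
    show "shifted (rho X) k \<notin> E" for k using avoid[of k] by (simp add: E'_def)
    show "of_int n dvd shifted s k - shifted (rho X) k" if "n \<noteq> 0" for n k
      unfolding sftX unfolding shifted_hyp hyp_diff hyp_dvd_iff
      using X1[OF that, of k] by (simp add: val_def m_def)
  qed simp
qed

lemma nonstandard_exists: "\<exists>s \<in> RN. nonstandard (s :: 'a hyp)"
proof (intro bexI)
  have "nonstd (fst :: nat \<times> 'a set \<Rightarrow> nat)" unfolding nonstd_def using ev_ge by blast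
  then show "nonstandard (rho (fst :: nat \<times> 'a set \<Rightarrow> nat))"
    unfolding nonstandard_def by (rule nonstd_near) (rule near_sym, rule near_eq, rule idx_rho)
qed simp

lemma many_chains:
  assumes "countable E"
  shows "\<exists>ss :: 'a hyp list. length ss = K \<and> distinct ss \<and> set ss \<subseteq> RN \<and>
    (\<forall>s\<in>set ss. nonstandard s \<and> (\<forall>k. shifted s k \<notin> E)) \<and> (\<forall>s\<in>set ss. \<forall>s'\<in>set ss. s \<noteq> s' \<longrightarrow> \<not> linked s s')"
proof (induction K)
  case 0 then show ?case by simp
next
  case (Suc K)
  then obtain ss :: "'a hyp list" where ss: "length ss = K" "distinct ss" "set ss \<subseteq> RN"
    "\<forall>s\<in>set ss. nonstandard s \<and> (\<forall>k. shifted s k \<notin> E)" "\<forall>s\<in>set ss. \<forall>s'\<in>set ss. s \<noteq> s' \<longrightarrow> \<not> linked s s'" by blast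
  obtain s0 :: "'a hyp" where s0: "s0 \<in> RN" "nonstandard s0" using nonstandard_exists by blast
  have "countable (E \<union> (\<Union>s\<in>set ss. range (shifted s)))" using assms by (simp add: countable_finite)
  from chain_copy[OF s0 this] obtain t where t: "t \<in> RN" "nonstandard t"
    "\<And>k. shifted t k \<notin> E \<union> (\<Union>s\<in>set ss. range (shifted s))" by metis
  have unl: "\<not> linked s t" if "s \<in> set ss" for s
  proof
    assume "linked s t"
    moreover have "nonstandard s" using ss(4) that by blast
    ultimately obtain k where "t = shifted s k" using t(1) by (elim linkedE)
    then show False using t(3)[of 0] t(1) that by auto
  qed
  then have "t \<notin> set ss" using linked_refl by blast
  then show ?case using ss t unl by (intro exI[of _ "t # ss"]) (auto dest: linked_sym)
qed

text \<open>By saturation, only combinations of boundedly many members of \<open>R\<close> have to be avoided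
  at a time. A sum of more members of different chains outside \<open>B\<close>, multiplied by \<open>M\<close> to
  keep the residues, is not equal to one.\<close>

lemma generic_copy:
  fixes x :: "'a hyp"
  assumes B: "psub B" "good B" "1 \<in> B" "countable B"
  obtains x' where "generic B x'" "\<And>n. n \<noteq> 0 \<Longrightarrow> of_int n dvd x - x'"
proof -
  define q1 where "q1 = (\<lambda>n (i :: nat \<times> 'a set) y. n dvd coord x i - y)"
  \<comment> \<open>The condition that \<open>n y\<close> is not \<open>b\<close> plus a combination of \<open>R\<close> with coefficients \<open>cs\<close>.\<close>
  define q2 where "q2 = (\<lambda>(n, b, cs) (i :: nat \<times> 'a set) y. \<forall>js :: nat list. length js = length cs \<longrightarrow>
    n * y \<noteq> coord b i + lin (\<lambda>j. int (r j)) (zip cs js))"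
  define C1 where "C1 = {n :: int. n \<noteq> 0}"
  define C2 where "C2 = {n :: int. n \<noteq> 0} \<times> B \<times> (UNIV :: int list set)"
  have "\<exists>X. \<forall>q\<in>q1 ` C1 \<union> q2 ` C2. \<forall>\<^sub>F i in uf. q i (X i)"
  proof (rule internal_saturation)
    show "countable (q1 ` C1 \<union> q2 ` C2)" using B(4) by (auto simp: C1_def C2_def)
    fix J assume "finite J" "J \<subseteq> q1 ` C1 \<union> q2 ` C2"
    then obtain F1 F2 where F: "finite F1" "F1 \<subseteq> C1" "finite F2" "F2 \<subseteq> C2" "J = q1 ` F1 \<union> q2 ` F2"
      by (rule finite_subset_Un_image)
    define M where "M = \<Prod>F1"
    have M0: "M \<noteq> 0" using F(1,2) by (auto simp: M_def C1_def)
    have Mdvd: "n dvd M" if "n \<in> F1" for n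
      unfolding M_def using F(1) that by (rule dvd_prodI[where f = "\<lambda>x. x", simplified])
    obtain j where j: "of_int M dvd x - of_int j" using residue_ex[OF M0] by blast
    define K where "K = Suc (Max (insert 0 ((\<lambda>(n, b, cs). length cs) ` F2)))"
    have K: "length cs < K" if "(n, b, cs) \<in> F2" for n b cs
      unfolding K_def less_Suc_eq_le by (rule Max_ge) (use that F(3) in force)+
    obtain ss :: "'a hyp list" where ss: "length ss = K" "distinct ss" "set ss \<subseteq> RN"
      "\<And>s. s \<in> set ss \<Longrightarrow> nonstandard s \<and> (\<forall>k. shifted s k \<notin> B)"
      "\<And>s s'. s \<in> set ss \<Longrightarrow> s' \<in> set ss \<Longrightarrow> s \<noteq> s' \<Longrightarrow> \<not> linked s s'"
      using many_chains[OF B(4), of K] by blast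
    \<comment> \<open>Modulo \<open>B\<close>, no multiple of a sum of more than \<open>length cs\<close> members of different chains outside \<open>B\<close>
      is a combination of \<open>length cs\<close> members of \<open>R\<close>.\<close>
    define y where "y = of_int j + of_int M * lin id (map (Pair 1) ss)"
    have gen: "of_int n * y \<noteq> b + lin id w"
      if nb: "n \<noteq> 0" "b \<in> B" and w: "snd ` set w \<subseteq> RN" "length w < K" for n b w
    proof
      assume eq: "of_int n * y = b + lin id w"
      define w0 where "w0 = filter (\<lambda>p. snd p \<notin> B) w"
      define w1 where "w1 = filter (\<lambda>p. snd p \<in> B) w"
      define L where "L = map (Pair (n * M)) ss @ scale (- 1) w0"
      have nM: "n * M \<noteq> 0" using nb M0 by simp
      have lin_map_Pair: "lin id (map (Pair c) xs) = of_int c * lin id (map (Pair 1) xs)" for c and xs :: "'a hyp list"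
        by (induction xs) (auto simp: algebra_simps)
      have "lin id w = lin id w1 + lin id w0" unfolding w0_def w1_def by (rule lin_filter)
      moreover have "lin id L = of_int (n * M) * lin id (map (Pair 1) ss) - lin id w0"
        unfolding L_def lin_simps lin_scale lin_map_Pair[of "n * M" ss] by simp
      moreover have "of_int (n * M) * lin id (map (Pair 1) ss) = of_int n * y - of_int (n * j)"
        by (simp add: y_def algebra_simps)
      ultimately have linL: "lin id L = b + lin id w1 - of_int (n * j)" using eq by simp
      have "lin id w1 \<in> B" by (rule psub_lin[OF B(1)]) (auto simp: w1_def)
      then have "lin id L \<in> B"
        unfolding linL by (intro psub_diff psub_add B psub_of_int nb)
      moreover have LR: "snd ` set L \<subseteq> RN - B"
      proof -
        have "s \<notin> B" if "s \<in> set ss" for s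
          using ss(4)[OF that] ss(3) that shifted_0[of s] by (metis subsetD)
        then show ?thesis unfolding L_def snd_append snd_scale using ss(3) w(1) by (auto simp: w0_def)
      qed
      ultimately have L0: "lin id L = 0" by (intro goodD[OF B(2)])
      have "\<exists>z\<in>snd ` set w. linked s z" if s: "s \<in> set ss" for s
      proof (rule ccontr)
        assume no: "\<not> (\<exists>z\<in>snd ` set w. linked s z)"
        have "lin id (filter (\<lambda>p. linked s (snd p)) (map (Pair c) xs)) = of_int c * s"
          if "distinct xs" "s \<in> set xs" "set xs \<subseteq> set ss" for xs c
          using that
        proof (induction xs)
          case (Cons a xs)
          show ?case
          proof (cases "a = s")
            case True
            then have "filter (\<lambda>p. linked s (snd p)) (map (Pair c) xs) = []"
              using Cons.prems ss(5)[OF s] by (force simp: filter_empty_conv)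
            then show ?thesis using True by simp
          next
            case False
            then show ?thesis using Cons ss(5)[OF s, of a] by auto
          qed
        qed simp
        from this[OF ss(2) s, of "n * M"]
        have "lin id (filter (\<lambda>p. linked s (snd p)) (map (Pair (n * M)) ss)) = of_int (n * M) * s" by simp
        moreover have "filter (\<lambda>p. linked s (snd p)) (scale (- 1) w0) = []"
          unfolding filter_empty_conv using no by (auto simp: scale_def w0_def)
        moreover have "lin id (filter (\<lambda>p. linked s (snd p)) L) = 0"
          by (rule lin_chain) (use LR L0 in auto)
        ultimately have "of_int (n * M) * s = 0" by (simp add: L_def)
        then have "s = 0" using nM by simp
        then show False using RN_nonstandard_nonzero[of s] ss s by blast
      qed
      then obtain g where g: "\<And>s. s \<in> set ss \<Longrightarrow> g s \<in> snd ` set w \<and> linked s (g s)" by metis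
      have "inj_on g (set ss)"
      proof (rule inj_onI)
        fix s s' assume "s \<in> set ss" "s' \<in> set ss" "g s = g s'"
        then have "linked s s'" using g linked_trans linked_sym by metis
        then show "s = s'" using ss(5) \<open>s \<in> set ss\<close> \<open>s' \<in> set ss\<close> by blast
      qed
      then have "card (set ss) \<le> card (snd ` set w)" using g by (intro card_inj_on_le[of g]) auto
      also have "\<dots> \<le> card (set w)" by (rule card_image_le) simp
      also have "\<dots> \<le> length w" by (rule card_length)
      finally show False using w(2) ss(1) distinct_card[OF ss(2)] by simp
    qed
    have "\<forall>\<^sub>F i in uf. q1 n i (coord y i)" if "n \<in> F1" for n
    proof -
      have "of_int M dvd x - y" unfolding y_def diff_diff_add[symmetric]
        by (rule dvd_diff[OF j]) simp
      moreover have "(of_int n :: 'a hyp) dvd of_int M" using Mdvd[OF that] by (auto elim!: dvdE)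
      ultimately have "of_int n dvd hyp (coord x) - hyp (coord y)" using dvd_trans by auto
      then show ?thesis unfolding hyp_diff hyp_dvd_iff q1_def .
    qed
    moreover have "\<forall>\<^sub>F i in uf. q2 p i (coord y i)" if p: "p \<in> F2" for p
    proof (rule ccontr)
      obtain n b cs where p': "p = (n, b, cs)" by (cases p)
      have nb: "n \<noteq> 0" "b \<in> B" using F(4) p p' by (auto simp: C2_def)
      assume "\<not> (\<forall>\<^sub>F i in uf. q2 p i (coord y i))"
      then have "\<forall>\<^sub>F i in uf. \<exists>js. length js = length cs \<and> n * coord y i = coord b i + lin (\<lambda>j. int (r j)) (zip cs js)"
        unfolding ev_not[symmetric] by (simp add: q2_def p')
      then obtain js where js: "\<forall>\<^sub>F i in uf. length (js i) = length cs \<and>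
          n * coord y i = coord b i + lin (\<lambda>j. int (r j)) (zip cs (js i))" unfolding ev_ex by blast
      define ts where "ts = map (\<lambda>e i. js i ! e) [0..<length cs]"
      define w where "w = zip cs (map rho ts)"
      have lints: "lin (\<lambda>m. int (r (m i))) (zip cs ts) = lin (\<lambda>j. int (r j)) (zip cs (js i))"
        if "length (js i) = length cs" for i
      proof -
        have "js i = map (\<lambda>m. m i) ts"
          unfolding ts_def using that by (intro nth_equalityI) auto
        then have "zip cs (js i) = map (\<lambda>(c, m). (c, m i)) (zip cs ts)"
          by (simp add: zip_map2)
        then show ?thesis by (simp add: lin_map)
      qed
      have "lin id w = lin rho (zip cs ts)" unfolding w_def zip_map2 lin_map by simp
      also have "\<dots> = hyp (\<lambda>i. lin (\<lambda>m. int (r (m i))) (zip cs ts))" by (rule lin_rho)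
      finally have "b + lin id w = hyp (\<lambda>i. coord b i + lin (\<lambda>m. int (r (m i))) (zip cs ts))"
        using hyp_add[of "coord b"] by simp
      also have "\<dots> = hyp (\<lambda>i. n * coord y i)"
        unfolding hyp_eq_iff using js by eventually_elim (simp add: lints)
      also have "\<dots> = of_int n * y" using hyp_mult[of "\<lambda>_. n" "coord y"] by (simp add: hyp_of_int)
      finally have "of_int n * y = b + lin id w" by simp
      moreover have "snd ` set w \<subseteq> RN" by (auto simp: w_def dest!: set_zip_rightD)
      moreover have "length w < K" using K p p' by (simp add: w_def ts_def)
      ultimately show False using gen nb by blast
    qed
    ultimately have "\<forall>\<^sub>F i in uf. (\<forall>n\<in>F1. q1 n i (coord y i)) \<and> (\<forall>p\<in>F2. q2 p i (coord y i))"
      using F(1,3) by (simp add: eventually_conj_iff eventually_ball_finite)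
    then show "\<forall>\<^sub>F i in uf. \<exists>x. \<forall>q\<in>J. q i x"
      by (rule eventually_mono) (auto simp: F(5) intro: exI[of _ "coord y _"])
  qed
  then obtain X where X1: "\<And>n. n \<noteq> 0 \<Longrightarrow> \<forall>\<^sub>F i in uf. q1 n i (X i)"
    and X2: "\<And>n b cs. n \<noteq> 0 \<Longrightarrow> b \<in> B \<Longrightarrow> \<forall>\<^sub>F i in uf. q2 (n, b, cs) i (X i)"
    unfolding C1_def C2_def by blast
  show thesis
  proof (rule that[of "hyp X"])
    show "of_int n dvd x - hyp X" if "n \<noteq> 0" for n
    proof -
      have "of_int n dvd hyp (coord x) - hyp X"
        using X1[OF that] unfolding hyp_diff hyp_dvd_iff q1_def .
      then show ?thesis by simp
    qed
    show "generic B (hyp X)" unfolding generic_def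
    proof (intro allI impI notI)
      fix n b l assume n: "n \<noteq> 0" and b: "b \<in> B" and l: "snd ` set l \<subseteq> RN"
        and eq: "of_int n * hyp X = b + lin id l"
      let ?cs = "map fst l"
      have "lin id l = lin rho (map (\<lambda>(c, y). (c, idx y)) l)"
        unfolding lin_map by (rule lin_cong) (use l in auto)
      also have "\<dots> = hyp (\<lambda>i. lin (\<lambda>m. int (r (m i))) (map (\<lambda>(c, y). (c, idx y)) l))" by (rule lin_rho)
      finally have "hyp (\<lambda>i. n * X i) = hyp (\<lambda>i. coord b i + lin (\<lambda>m. int (r (m i))) (map (\<lambda>(c, y). (c, idx y)) l))"
        using eq hyp_mult[of "\<lambda>_. n" X] hyp_add[of "coord b"] by (simp add: hyp_of_int)
      then have "\<forall>\<^sub>F i in uf. n * X i = coord b i + lin (\<lambda>m. int (r (m i))) (map (\<lambda>(c, y). (c, idx y)) l)"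
        by (simp add: hyp_eq_iff)
      with X2[OF n b, of ?cs] have "\<forall>\<^sub>F i :: nat \<times> 'a set in uf. i \<noteq> i"
      proof eventually_elim
        case (elim i)
        have "zip ?cs (map (\<lambda>p. idx (snd p) i) l) = map (\<lambda>(c, y). (c, idx y i)) l"
          by (induction l) auto
        then have "lin (\<lambda>j. int (r j)) (zip ?cs (map (\<lambda>p. idx (snd p) i) l))
            = lin (\<lambda>m. int (r (m i))) (map (\<lambda>(c, y). (c, idx y)) l)"
          by (simp add: lin_map)
        moreover have "length js = length ?cs \<longrightarrow> n * X i \<noteq> coord b i + lin (\<lambda>j. int (r j)) (zip ?cs js)"
          for js using elim(1) unfolding q2_def prod.case by blast
        from this[of "map (\<lambda>p. idx (snd p) i) l"]
        have "n * X i \<noteq> coord b i + lin (\<lambda>j. int (r j)) (zip ?cs (map (\<lambda>p. idx (snd p) i) l))" by simp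
        ultimately show ?case using elim(2) by simp
      qed
      then show False by (simp add: eventually_False)
    qed
  qed
qed



lemma countable_ext:
  assumes "countable \<Gamma>" "countable P"
  shows "countable (ext \<Gamma> P)"
proof -
  define g where "g = (\<lambda>(n :: int, (a, b), l). (THE x. of_int n * x = a + lin fst l, THE y. of_int n * y = b + lin snd l)
    :: 'a hyp \<times> 'a hyp)"
  have "ext \<Gamma> P \<subseteq> g ` (UNIV \<times> \<Gamma> \<times> lists (UNIV \<times> P))"
  proof
    fix q assume "q \<in> ext \<Gamma> P"
    then obtain x y where q: "q = (x, y)" "(x, y) \<in> ext \<Gamma> P" by (cases q) auto
    from q(2) obtain n a b l where 1: "n \<noteq> 0" "(a, b) \<in> \<Gamma>" "snd ` set l \<subseteq> P" "of_int n * x = a + lin fst l"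
      "of_int n * y = b + lin snd l" by (rule extE)
    have the: "(THE z. of_int n * z = c) = z" if "of_int n * z = c" for z c :: "'a hyp"
      using that 1(1) by (intro the_equality) auto
    have "l \<in> lists (UNIV \<times> P)" using 1(3) by (force simp: in_lists_conv_set)
    moreover have "q = g (n, (a, b), l)" using the[OF 1(4)] the[OF 1(5)] by (simp add: g_def q)
    ultimately show "q \<in> g ` (UNIV \<times> \<Gamma> \<times> lists (UNIV \<times> P))" using 1(2) by blast
  qed
  then show ?thesis by (rule countable_subset) (use assms in auto)
qed

text \<open>If \<open>s\<close> is not in the domain, it is nonstandard, and its chain is mapped to a copy that
  avoids both the range and \<open>E\<close>.\<close>

lemma forth_RN:
  assumes G: "piso \<Gamma>" "countable \<Gamma>" and s: "s \<in> RN" and E: "countable E"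
  obtains \<Gamma>' where "\<Gamma> \<subseteq> \<Gamma>'" "piso \<Gamma>'" "countable \<Gamma>'" "s \<in> Domain \<Gamma>'"
    "\<And>y. y \<in> RN \<Longrightarrow> y \<in> Range \<Gamma>' \<Longrightarrow> y \<in> Range \<Gamma> \<or> nonstandard y \<and> (\<forall>k. shifted y k \<notin> E)"
proof (cases "s \<in> Domain \<Gamma>")
  case True then show ?thesis using that[of \<Gamma>] G by blast
next
  case False
  have nonstandard: "nonstandard s"
    using std_iff[OF s] piso_of_int[OF G(1), of "int (r _)"] False by fastforce
  have "countable (E \<union> Range \<Gamma>)" using E G(2) by (simp add: Range_snd)
  then obtain t where t: "t \<in> RN" "nonstandard t" "\<And>k. shifted t k \<notin> E \<union> Range \<Gamma>"
    "\<And>n k. n \<noteq> 0 \<Longrightarrow> of_int n dvd shifted s k - shifted t k" using chain_copy[OF s nonstandard] by metis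
  define P where "P = chain_pairs (Domain \<Gamma>) s t"
  have piso': "piso (ext \<Gamma> P)" unfolding P_def by (rule piso_chain) (use G s nonstandard t in auto)
  show ?thesis
  proof (rule that[OF ext_base piso'])
    show "countable (ext \<Gamma> P)" by (rule countable_ext) (simp_all add: G P_def chain_pairs_def)
    have "(s, t) \<in> P" unfolding P_def chain_pairs_def
      by (rule image_eqI[of _ _ 0]) (use False s t in auto)
    then show "s \<in> Domain (ext \<Gamma> P)" using ext_new[OF G(1)] by blast
    fix y assume y: "y \<in> RN" "y \<in> Range (ext \<Gamma> P)"
    then obtain x where "(x, y) \<in> ext \<Gamma> P" by blast
    then obtain n a b l where 1: "n \<noteq> 0" "(a, b) \<in> \<Gamma>" "snd ` set l \<subseteq> P" "of_int n * y = b + lin snd l"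
      by (rule extE)
    from pair_list[OF 1(3)[unfolded P_def chain_pairs_def]] obtain l' where
      l': "lin snd l = lin (shifted t) l'" by blast
    have "y \<in> Range \<Gamma> \<or> (\<exists>j. y = shifted t j)"
      using chain_element[OF piso_psub_Range[OF G(1)] piso_good(2)[OF G(1)] t(2,1) _ _ 1(1) 1(4)[unfolded l'] y(1)]
        1(2) t(3) by blast
    then show "y \<in> Range \<Gamma> \<or> nonstandard y \<and> (\<forall>k. shifted y k \<notin> E)"
      using t(2,3) nonstandard_shifted shifted_shifted[OF t(2)] by auto
  qed
qed

lemma forth_RN_list:
  assumes "piso \<Gamma>" "countable \<Gamma>" "set ss \<subseteq> RN" "countable E"
  shows "\<exists>\<Gamma>'. \<Gamma> \<subseteq> \<Gamma>' \<and> piso \<Gamma>' \<and> countable \<Gamma>' \<and> set ss \<subseteq> Domain \<Gamma>' \<and>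
    (\<forall>y\<in>RN \<inter> Range \<Gamma>'. y \<in> Range \<Gamma> \<or> nonstandard y \<and> (\<forall>k. shifted y k \<notin> E))"
  using assms(3)
proof (induction ss)
  case Nil
  then show ?case using assms(1,2) by (intro exI[of _ \<Gamma>]) auto
next
  case (Cons s ss)
  then obtain \<Gamma>1 where 1: "\<Gamma> \<subseteq> \<Gamma>1" "piso \<Gamma>1" "countable \<Gamma>1" "set ss \<subseteq> Domain \<Gamma>1"
    "\<forall>y\<in>RN \<inter> Range \<Gamma>1. y \<in> Range \<Gamma> \<or> nonstandard y \<and> (\<forall>k. shifted y k \<notin> E)" by auto
  obtain \<Gamma>2 where 2: "\<Gamma>1 \<subseteq> \<Gamma>2" "piso \<Gamma>2" "countable \<Gamma>2" "s \<in> Domain \<Gamma>2"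
    "\<And>y. y \<in> RN \<Longrightarrow> y \<in> Range \<Gamma>2 \<Longrightarrow> y \<in> Range \<Gamma>1 \<or> nonstandard y \<and> (\<forall>k. shifted y k \<notin> E)"
    using forth_RN[OF 1(2,3) _ assms(4), of s] Cons.prems by auto
  show ?case
  proof (intro exI conjI)
    show "set (s # ss) \<subseteq> Domain \<Gamma>2" using 1(4) 2(1,4) by auto
    show "\<forall>y\<in>RN \<inter> Range \<Gamma>2. y \<in> Range \<Gamma> \<or> nonstandard y \<and> (\<forall>k. shifted y k \<notin> E)"
      using 1(5) 2(5) by blast
  qed (use 1 2 in auto)
qed

text \<open>The larger subgroup \<open>B\<close> serves to make the image independent of countably many given
  elements.\<close>

lemma forth_generic:
  assumes G: "piso \<Gamma>" "countable \<Gamma>" and x: "generic (Domain \<Gamma>) x"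
    and B: "psub B" "good B" "1 \<in> B" "countable B" "Range \<Gamma> \<subseteq> B"
  obtains x' where "generic B x'" "piso (ext \<Gamma> {(x, x')})" "countable (ext \<Gamma> {(x, x')})"
    "(x, x') \<in> ext \<Gamma> {(x, x')}"
proof -
  obtain x' where x': "generic B x'" "\<And>n. n \<noteq> 0 \<Longrightarrow> of_int n dvd x - x'"
    using generic_copy[OF B(1-4)] by blast
  have "generic (Range \<Gamma>) x'" using x'(1) B(5) unfolding generic_def by blast
  then have "piso (ext \<Gamma> {(x, x')})" using piso_generic[OF G(1) x] x'(2) by blast
  moreover have "(x, x') \<in> ext \<Gamma> {(x, x')}" using ext_new[OF G(1)] by blast
  moreover have "countable (ext \<Gamma> {(x, x')})" by (rule countable_ext[OF G(2)]) simp
  ultimately show thesis using that[OF x'(1)] by blast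
qed

text \<open>Either \<open>x\<close> is generic over the domain, or it depends on the domain and finitely many
  members of \<open>R\<close>, which can be added first.\<close>

lemma forth:
  assumes G: "piso \<Gamma>" "countable \<Gamma>"
  shows "\<exists>\<Gamma>'. \<Gamma> \<subseteq> \<Gamma>' \<and> piso \<Gamma>' \<and> countable \<Gamma>' \<and> x \<in> Domain \<Gamma>'"
proof (cases "generic (Domain \<Gamma>) x")
  case True
  have "countable (Range \<Gamma>)" using G(2) by (simp add: Range_snd)
  then show ?thesis
    using forth_generic[OF G True piso_psub_Range[OF G(1)] piso_good(2)[OF G(1)] _ _ order_refl]
      piso_1[OF G(1)] ext_base[of \<Gamma>] by (metis Domain.DomainI Range.intros)
next
  case False
  then obtain n a l where 1: "n \<noteq> 0" "a \<in> Domain \<Gamma>" "snd ` set l \<subseteq> RN" "of_int n * x = a + lin id l"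
    by (auto simp: generic_def)
  obtain \<Gamma>' where 2: "\<Gamma> \<subseteq> \<Gamma>'" "piso \<Gamma>'" "countable \<Gamma>'" "set (map snd l) \<subseteq> Domain \<Gamma>'"
    using forth_RN_list[OF G, of "map snd l" "{}"] 1(3) by auto
  note A = piso_psub_Domain[OF 2(2)]
  have "of_int n * x \<in> Domain \<Gamma>'"
    unfolding 1(4) by (intro psub_add[OF A] psub_lin[OF A]) (use 1(2) 2(1,4) in auto)
  then show ?thesis using psub_pure[OF A 1(1)] 2 by blast
qed

lemma piso_eval:
  assumes "piso \<Gamma>" "\<And>n. n \<in> fv_tm t \<Longrightarrow> (v n, w n) \<in> \<Gamma>"
  shows "(eval N v t, eval N w t) \<in> \<Gamma>"
  using assms(2) by (induction t) (auto intro: piso_0[OF assms(1)] piso_add[OF assms(1)])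

text \<open>The step for a quantifier is \<open>forth\<close>, applied to \<open>\<Gamma>\<close> and to its converse.\<close>

theorem piso_sat:
  fixes \<Gamma> :: "('a hyp \<times> 'a hyp) set"
  assumes "piso \<Gamma>" "countable \<Gamma>" "\<And>n. n \<in> fv \<phi> \<Longrightarrow> (v n, w n) \<in> \<Gamma>"
  shows "sat N v \<phi> \<longleftrightarrow> sat N w \<phi>"
  using assms
proof (induction \<phi> arbitrary: \<Gamma> v w)
  case (Eq s t)
  have "(eval N v s, eval N w s) \<in> \<Gamma>" "(eval N v t, eval N w t) \<in> \<Gamma>"
    using Eq.prems by (auto intro!: piso_eval)
  from piso_zero[OF Eq.prems(1) piso_diff[OF Eq.prems(1) this]] show ?case by simp
next
  case (InR t)
  have "(eval N v t, eval N w t) \<in> \<Gamma>" using InR.prems by (auto intro!: piso_eval)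
  then show ?case using piso_RN[OF InR.prems(1)] by simp
next
  case (Neg \<phi>)
  have "sat N v \<phi> \<longleftrightarrow> sat N w \<phi>" by (rule Neg.IH[OF Neg.prems(1,2)]) (use Neg.prems(3) in simp)
  then show ?case by simp
next
  case (Conj \<phi> \<psi>)
  have "sat N v \<phi> \<longleftrightarrow> sat N w \<phi>" by (rule Conj.IH(1)[OF Conj.prems(1,2)]) (use Conj.prems(3) in simp)
  moreover have "sat N v \<psi> \<longleftrightarrow> sat N w \<psi>" by (rule Conj.IH(2)[OF Conj.prems(1,2)]) (use Conj.prems(3) in simp)
  ultimately show ?case by simp
next
  case (Ex i \<phi>)
  have half: "sat N w' (Ex i \<phi>)" if G: "piso \<Delta>" "countable \<Delta>" and vw: "\<And>n. n \<in> fv \<phi> - {i} \<Longrightarrow> (v' n, w' n) \<in> \<Delta>"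
    and s: "sat N v' (Ex i \<phi>)" for \<Delta> :: "('a hyp \<times> 'a hyp) set" and v' w'
  proof -
    from s obtain x where x: "sat N (v'(i := x)) \<phi>" by auto
    from forth[OF G, of x] obtain \<Delta>' y where D: "\<Delta> \<subseteq> \<Delta>'" "piso \<Delta>'" "countable \<Delta>'" "(x, y) \<in> \<Delta>'" by blast
    have "sat N (v'(i := x)) \<phi> \<longleftrightarrow> sat N (w'(i := y)) \<phi>"
      by (rule Ex.IH[OF D(2,3)]) (use vw D(1,4) in auto)
    then show ?thesis using x by auto
  qed
  have "sat N w (Ex i \<phi>)" if "sat N v (Ex i \<phi>)"
    by (rule half[OF Ex.prems(1,2) _ that]) (use Ex.prems(3) in auto)
  moreover have "\<Gamma>\<inverse> = prod.swap ` \<Gamma>" by auto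
  then have "countable (\<Gamma>\<inverse>)" using Ex.prems(2) by simp
  then have "sat N v (Ex i \<phi>)" if "sat N w (Ex i \<phi>)"
    by (rule half[OF piso_converse[OF Ex.prems(1)] _ _ that]) (use Ex.prems(3) in auto)
  ultimately show ?case by blast
qed

section \<open>Types of finite tuples\<close>

text \<open>The language has no name for the unit, but \<open>1\<close> is determined by its type. If
  \<open>r\<^sub>n e \<in> R\<close> for all \<open>n\<close>, then either \<open>r\<^sub>1 e\<close> is standard and \<open>e\<close> is a standard integer,
  or else \<open>r\<^sub>1 e\<close> and \<open>r\<^sub>2 e\<close> are linked by their linear relation. This relation then
  holds along the whole sequence, which is geometric. A prime divisor of the numerator of
  its quotient is contained in the nonstandard term \<open>r\<^sub>1 e\<close> with every standard exponent,
  hence divides \<open>e\<close>.\<close>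

lemma unit_unique:
  fixes e :: "'a hyp"
  assumes R: "\<And>n. of_nat (r n) * e \<in> RN" and prime: "\<And>q. q \<ge> 2 \<Longrightarrow> \<not> of_int q dvd e"
  shows "e = 1"
proof -
  define a where "a = r 1"
  define b where "b = r 2"
  define x where "x = of_nat a * e"
  have a0: "a > 0" by (simp add: a_def r_pos)
  have ab: "a < b" by (simp add: a_def b_def)
  have x: "x \<in> RN" using R[of 1] by (simp add: x_def a_def)
  show ?thesis
  proof (cases "nonstandard x")
    case False
    then obtain j where "x = of_nat (r j)" using std_iff[OF x] by blast
    then have "hyp (\<lambda>i. int a * coord e i) = hyp (\<lambda>_. int (r j))"
      using hyp_mult[of "\<lambda>_. int a" "coord e"] by (simp add: x_def hyp_of_nat)
    then have "\<forall>\<^sub>F i in uf. int a * coord e i = int (r j)" by (simp add: hyp_eq_iff)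
    then have "\<forall>\<^sub>F i in uf. coord e i = int (r j) div int a"
    proof eventually_elim
      case (elim i)
      have "int (r j) div int a = int a * coord e i div int a" by (simp only: elim)
      then show ?case using a0 by simp
    qed
    then have "hyp (coord e) = hyp (\<lambda>_. int (r j) div int a)" unfolding hyp_eq_iff .
    then obtain z where z: "e = of_int z" "z \<ge> 0"
      using a0 by (auto simp: hyp_of_int[symmetric] pos_imp_zdiv_nonneg_iff)
    have "z \<noteq> 0" using prime[of 2] z by auto
    moreover have "\<not> z \<ge> 2" using prime[of z] z by auto
    ultimately show ?thesis using z by (cases "z = 1") auto
  next
    case True
    define y where "y = of_nat b * e"
    have y: "y \<in> RN" using R[of 2] by (simp add: y_def b_def)
    have rel: "lin id [(int b, x), (- int a, y)] = 0" by (simp add: x_def y_def)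
    have "linked x y"
    proof (rule ccontr)
      assume "\<not> linked x y"
      then have "filter (\<lambda>p. linked x (snd p)) [(int b, x), (- int a, y)] = [(int b, x)]" by simp
      moreover have "lin id (filter (\<lambda>p. linked x (snd p)) [(int b, x), (- int a, y)]) = 0"
        by (rule lin_chain) (use x y rel in auto)
      ultimately show False using RN_nonstandard_nonzero[OF True x] ab by simp
    qed
    then obtain k where k: "y = shifted x k" using linkedE[OF True y] by blast
    have "lin (shifted x) [(int b, 0), (- int a, k)] = 0" using rel x k by simp
    then have rec: "b * r (nat j) = a * r (nat (j + k))" if "0 \<le> j" "0 \<le> j + k" for j
    proof -
      have "lin (\<lambda>k. int (r (nat (j + k)))) [(int b, 0), (- int a, k)] = 0"
        using \<open>lin (shifted x) _ = 0\<close> True that unfolding shifted_def nonstandard_def by (subst (asm) chain_relation_iff) auto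
      then have "int (b * r (nat j)) = int (a * r (nat (j + k)))" by simp
      then show ?thesis by (simp only: of_nat_eq_iff)
    qed
    have "k = 1"
    proof -
      have "k > 0"
      proof (rule ccontr)
        assume "\<not> k > 0"
        then have "b * r (nat (1 - k)) = a * r 1" using rec[of "1 - k"] by simp
        moreover have "r 1 \<le> r (nat (1 - k))"
          using \<open>\<not> k > 0\<close> r_strict_mono by (simp add: strict_mono_less_eq)
        ultimately have "b * r 1 \<le> a * r 1" by (metis mult_le_mono2)
        then show False using ab a0 by (simp add: a_def)
      qed
      then have "b * r 1 = a * r (nat (1 + k))" using rec[of 1] by simp
      then have "r 2 = r (nat (1 + k))" using a0 by (simp add: a_def b_def)
      then have "2 = nat (1 + k)" by (simp only: r_eq_iff)
      then show "k = 1" by simp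
    qed
    then have geo: "b * r j = a * r (Suc j)" for j
      using rec[of "int j"] by (simp add: nat_add_distrib)
    define u where "u = b div gcd a b"
    define v where "v = a div gcd a b"
    have uv: "coprime v u" "a = v * gcd a b" "b = u * gcd a b"
      using a0 by (auto simp: u_def v_def div_gcd_coprime)
    have g0: "gcd a b > 0" using a0 by simp
    have geo': "u * r j = v * r (Suc j)" for j
    proof -
      have aux: "u * x = v * y" if "b * x = a * y" "a = v * g" "b = u * g" "g > 0" for x y g
      proof -
        have "g * (u * x) = g * (v * y)" using that(1) unfolding that(2,3) by (simp only: ac_simps)
        then show ?thesis using that(4) by simp
      qed
      show ?thesis by (rule aux[OF geo uv(2,3) g0])
    qed
    have "u \<noteq> 1"
    proof
      assume "u = 1"
      then have "b \<le> a" using uv(2,3) a0 by (metis dvd_imp_le dvd_triv_right mult_1)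
      then show False using ab by simp
    qed
    then obtain q where q: "prime q" "q dvd u" using prime_factor_nat by blast
    have "coprime q v" using q uv(1) by (metis coprime_commute coprime_divisors dvd_refl)
    have pow: "q ^ n dvd r (j + n)" for j n
    proof (induction n)
      case (Suc n)
      have "q * q ^ n dvd u * r (j + n)" using q(2) Suc by (rule mult_dvd_mono)
      then have "q ^ Suc n dvd v * r (j + Suc n)" using geo'[of "j + n"] by simp
      moreover have "coprime (q ^ Suc n) v" using \<open>coprime q v\<close> by simp
      ultimately show ?case using coprime_dvd_mult_right_iff by blast
    qed simp
    have "\<forall>\<^sub>F i in uf. a \<le> idx x i" using True by (auto simp: nonstandard_def nonstd_def)
    then have "\<forall>\<^sub>F i in uf. int (q ^ a) dvd int (r (idx x i))"
    proof eventually_elim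
      case (elim i)
      have "q ^ a dvd r (idx x i)" using pow[of a "idx x i - a"] elim by simp
      then show ?case unfolding of_nat_dvd_iff .
    qed
    then have "of_int (int (q ^ a)) dvd rho (idx x)" unfolding rho_def hyp_dvd_iff .
    then have "of_int (int (q ^ a)) dvd hyp (\<lambda>i. int a * coord e i)"
      using x hyp_mult[of "\<lambda>_. int a" "coord e"] by (simp add: x_def hyp_of_nat)
    then have "\<forall>\<^sub>F i in uf. int (q ^ a) dvd int a * coord e i" unfolding hyp_dvd_iff .
    moreover have "\<not> of_int (int q) dvd hyp (coord e)"
      using prime[of "int q"] prime_ge_2_nat[OF q(1)] by simp
    then have "\<forall>\<^sub>F i in uf. \<not> int q dvd coord e i" unfolding hyp_dvd_iff ev_not .
    ultimately have "\<forall>\<^sub>F i :: nat \<times> 'a set in uf. i \<noteq> i"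
    proof eventually_elim
      case (elim i)
      have "coprime (int q) (coord e i)" using elim(2) q(1) by (simp add: prime_imp_coprime)
      then have "int (q ^ a) dvd int a" using elim(1) by (simp add: coprime_dvd_mult_left_iff)
      then have "q ^ a \<le> a" using a0 by (simp only: of_nat_dvd_iff) (rule dvd_imp_le)
      moreover have "a < q ^ a"
        using less_exp[of a] power_mono[OF prime_ge_2_nat[OF q(1)], of a] by linarith
      ultimately show ?case by simp
    qed
    then show ?thesis by (simp add: eventually_False)
  qed
qed

text \<open>Equality of the types over the empty set.\<close>

definition teq :: "'a hyp list \<Rightarrow> 'a hyp list \<Rightarrow> bool" where
  "teq us ws \<longleftrightarrow> length us = length ws \<and>
     (\<forall>\<phi>. fv \<phi> \<subseteq> {..<length us} \<longrightarrow> sat N ((!) us) \<phi> = sat N ((!) ws) \<phi>)"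

lemma piso_teq:
  assumes "piso \<Gamma>" "countable \<Gamma>" "length us = length ws" "\<And>i. i < length us \<Longrightarrow> (us ! i, ws ! i) \<in> \<Gamma>"
  shows "teq us ws"
  unfolding teq_def using assms(3)
  by (auto intro!: piso_sat[OF assms(1,2)] assms(4))

text \<open>Conversely, equality of types gives a partial isomorphism: the type of an enumeration
  of a good hull is realized over the second tuple, and goodness is inherited by the
  image.\<close>

theorem teq_piso:
  assumes "teq us ws"
  obtains \<Gamma> where "piso \<Gamma>" "countable \<Gamma>" "\<And>i. i < length us \<Longrightarrow> (us ! i, ws ! i) \<in> \<Gamma>"
proof -
  define L where "L = length us"
  have "countable (set us)" by (simp add: countable_finite)
  then obtain G where G: "set us \<subseteq> G" "psub G" "good G" "1 \<in> G" "countable G"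
    by (rule countable_good_hull[OF psub_UNIV good_UNIV UNIV_I subset_UNIV]) blast
  define \<gamma> where "\<gamma> = from_nat_into G"
  have \<gamma>: "range \<gamma> = G" unfolding \<gamma>_def by (rule range_from_nat_into) (use G in auto)
  \<comment> \<open>Even slots after the tuple enumerate the hull, odd ones are kept free for quantifiers.\<close>
  define v where "v n = (if n < L then us ! n else if even (n - L) then \<gamma> ((n - L) div 2) else 0)" for n
  define v0 where "v0 n = (if n < L then ws ! n else 0)" for n
  have "\<exists>w. (\<forall>i. i \<notin> {L..} \<longrightarrow> w i = v0 i) \<and> (\<forall>\<phi>\<in>{\<phi>. sat N v \<phi>}. sat N w \<phi>)"
  proof (rule fm_saturation)
    fix J assume "finite J" and J: "J \<subseteq> {\<phi>. sat N v \<phi>}"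
    then obtain js where js: "set js = J" using finite_list by blast
    define \<phi> where "\<phi> = Conjs js"
    obtain xs where xs: "set xs = fv \<phi> \<inter> {L..}" using finite_list[of "fv \<phi> \<inter> {L..}"] by auto
    have fvE: "fv (Exs xs \<phi>) \<subseteq> {..<L}" unfolding fv_Exs xs by (auto simp: not_le)
    have "sat N v \<phi>" unfolding \<phi>_def sat_Conjs js using J by blast
    then have "sat N v (Exs xs \<phi>)" unfolding sat_Exs by (intro exI[of _ v]) simp
    moreover have "sat N v (Exs xs \<phi>) = sat N ((!) us) (Exs xs \<phi>)"
      by (rule sat_cong) (use fvE in \<open>auto simp: v_def\<close>)
    moreover have "sat N ((!) us) (Exs xs \<phi>) = sat N ((!) ws) (Exs xs \<phi>)"
      using assms fvE by (simp add: teq_def L_def)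
    moreover have "sat N ((!) ws) (Exs xs \<phi>) = sat N v0 (Exs xs \<phi>)"
      by (rule sat_cong) (use fvE in \<open>auto simp: v0_def\<close>)
    ultimately obtain w where "\<forall>i. i \<notin> set xs \<longrightarrow> w i = v0 i" "sat N w \<phi>" unfolding sat_Exs by blast
    then show "\<exists>w. (\<forall>i. i \<notin> {L..} \<longrightarrow> w i = v0 i) \<and> (\<forall>\<phi>\<in>J. sat N w \<phi>)"
      using xs by (intro exI[of _ w]) (auto simp: \<phi>_def js)
  qed
  then obtain w where w0: "\<forall>i. i \<notin> {L..} \<longrightarrow> w i = v0 i" and w1: "\<forall>\<phi>\<in>{\<phi>. sat N v \<phi>}. sat N w \<phi>"
    by blast
  have wL: "w i = ws ! i" if "i < L" for i using w0 that by (auto simp: v0_def)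
  have w: "sat N w \<phi>" if "sat N v \<phi>" for \<phi> using w1 that by blast
  have tr: "sat N w \<phi> \<longleftrightarrow> sat N v \<phi>" for \<phi> using w[of \<phi>] w[of "Neg \<phi>"] by auto
  have trlin: "lin w l = 0 \<longleftrightarrow> lin v l = 0" for l
    using tr[of "Lin l"] by (simp add: sat_Lin)
  define e where "e k = L + 2 * k" for k
  have ve: "v (e k) = \<gamma> k" for k by (simp add: v_def e_def)
  define \<gamma>' where "\<gamma>' k = w (e k)" for k
  define \<Gamma> where "\<Gamma> = range (\<lambda>k. (\<gamma> k, \<gamma>' k))"
  have dom: "Domain \<Gamma> = G" using \<gamma> by (auto simp: \<Gamma>_def)
  have ran: "Range \<Gamma> = range \<gamma>'" by (auto simp: \<Gamma>_def)
  have dvd: "of_int n dvd \<gamma> k \<longleftrightarrow> of_int n dvd \<gamma>' k" for n k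
  proof -
    define \<phi> where "\<phi> = Ex (Suc (e k)) (Lin [(n, Suc (e k)), (- 1, e k)])"
    have "sat N x \<phi> \<longleftrightarrow> of_int n dvd x (e k)" for x
      unfolding \<phi>_def by (auto simp: sat_Lin dvd_def algebra_simps) (metis)+
    from this[of v] this[of w] tr[of \<phi>] show ?thesis by (simp add: ve \<gamma>'_def)
  qed
  have zero: "\<gamma> k = 0 \<longleftrightarrow> \<gamma>' k = 0" for k using dvd[of 0 k] by simp
  have "piso \<Gamma>" unfolding piso_def dom ran
  proof (intro conjI allI impI)
    show "good G" by (rule G)
    show "x \<in> RN \<longleftrightarrow> y \<in> RN" if "(x, y) \<in> \<Gamma>" for x y
      using that tr[of "InR (Var (e _))"] by (auto simp: \<Gamma>_def ve \<gamma>'_def)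
    show "of_int n dvd x \<longleftrightarrow> of_int n dvd y" if "(x, y) \<in> \<Gamma>" for x y n
      using that dvd by (auto simp: \<Gamma>_def)
    show "(x - x', y - y') \<in> \<Gamma>" if "(x, y) \<in> \<Gamma>" "(x', y') \<in> \<Gamma>" for x y x' y'
    proof -
      from that obtain j k where jk: "x = \<gamma> j" "y = \<gamma>' j" "x' = \<gamma> k" "y' = \<gamma>' k" by (auto simp: \<Gamma>_def)
      have "\<gamma> j - \<gamma> k \<in> range \<gamma>" unfolding \<gamma> by (rule psub_diff[OF G(2)]) (use \<gamma> in auto)
      then obtain l where l: "\<gamma> j - \<gamma> k = \<gamma> l" by blast
      then have "\<gamma>' j - \<gamma>' k = \<gamma>' l"
        using trlin[of "[(1, e j), (- 1, e k), (- 1, e l)]"] by (simp add: ve \<gamma>'_def algebra_simps)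
      then show ?thesis using l by (auto simp: \<Gamma>_def jk)
    qed
    show "(x, y) \<in> \<Gamma>" if n: "n \<noteq> 0" and xy: "(of_int n * x, of_int n * y) \<in> \<Gamma>" for n x y
    proof -
      from xy obtain j where j: "of_int n * x = \<gamma> j" "of_int n * y = \<gamma>' j" by (auto simp: \<Gamma>_def)
      then have "of_int n * x \<in> G" using \<gamma> by auto
      then have "x \<in> range \<gamma>" using psub_pure[OF G(2) n] \<gamma> by simp
      then obtain k where k: "x = \<gamma> k" by blast
      then have "of_int n * \<gamma>' k = of_int n * y"
        using trlin[of "[(n, e k), (- 1, e j)]"] j by (simp add: ve \<gamma>'_def)
      then show ?thesis using n k by (auto simp: \<Gamma>_def)
    qed
    show "(1, 1) \<in> \<Gamma>"
    proof -
      obtain k where k: "\<gamma> k = 1" using G(4) \<gamma> by (metis imageE)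
      have "\<gamma>' k = 1"
      proof (rule unit_unique)
        show "of_nat (r n) * \<gamma>' k \<in> RN" for n
        proof -
          have "sat N v (InR (Vs (r n) (Var (e k))))" using std_RN[of n] k by (simp add: eval_Vs ve)
          then show ?thesis using w by (fastforce simp: eval_Vs \<gamma>'_def)
        qed
        show "\<not> of_int q dvd \<gamma>' k" if "q \<ge> 2" for q
          using that unfolding dvd[symmetric] k hyp_one hyp_dvd_iff by (simp add: eventually_False)
      qed
      then show ?thesis using k by (auto simp: \<Gamma>_def intro!: image_eqI[of _ _ k])
    qed
    show "good (range \<gamma>')" unfolding good_def
    proof (intro allI impI)
      fix u assume u: "snd ` set u \<subseteq> RN - range \<gamma>'" and "lin id u \<in> range \<gamma>'"
      then obtain k where k: "lin id u = \<gamma>' k" by blast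
      define m where "m = length u"
      define o' where "o' i = L + 2 * i + 1" for i
      define ys where "ys = map o' [0..<m]"
      have oe: "o' i \<noteq> e j" "o' i = o' j \<longleftrightarrow> i = j" for i j unfolding o'_def e_def by presburger+
      define l where "l = zip (map fst u) ys @ [(- 1, e k)]"
      define C where "C = (\<lambda>i. InR (Var (o' i))) ` {..<m} \<union>
        (\<lambda>(i, j). Neg (Eq (Var (o' i)) (Var (e j)))) ` ({..<m} \<times> UNIV) \<union> {Lin l}"
      define w' where "w' n = (if n \<in> set ys then snd (u ! ((n - L) div 2)) else w n)" for n
      have w'o: "w' (o' i) = snd (u ! i)" if "i < m" for i
        using that by (auto simp: w'_def ys_def o'_def)
      have eys: "e j \<notin> set ys" for j
      proof -
        have "e j \<notin> o' ` {0..<m}" using oe(1) by (metis imageE)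
        then show ?thesis by (simp add: ys_def)
      qed
      then have w'e: "w' (e j) = \<gamma>' j" for j by (simp add: w'_def \<gamma>'_def)
      have linx: "lin x l = lin x (zip (map fst u) ys) - x (e k)" for x :: "nat \<Rightarrow> 'a hyp"
        by (simp add: l_def)
      have "zip (map fst u) (map w' ys) = u"
        by (rule nth_equalityI) (auto simp: ys_def m_def w'o prod_eq_iff)
      then have "lin w' (zip (map fst u) ys) = lin id u"
        using lin_map[of id w' "zip (map fst u) ys"] by (simp add: zip_map2)
      then have linw': "lin w' l = 0" using k by (simp add: linx w'e)
      have u_in: "snd (u ! i) \<in> RN - range \<gamma>'" if "i < m" for i
        using u that by (auto simp: m_def dest!: nth_mem)
      have Cw': "sat N w' \<phi>" if "\<phi> \<in> C" for \<phi>
        using that linw' u_in by (fastforce simp: C_def sat_Lin w'o w'e)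
      have "\<exists>x. (\<forall>i. i \<notin> set ys \<longrightarrow> x i = v i) \<and> (\<forall>\<phi>\<in>C. sat N x \<phi>)"
      proof (rule fm_saturation)
        fix J assume "finite J" and J: "J \<subseteq> C"
        then obtain js where js: "set js = J" using finite_list by blast
        have "sat N w (Exs ys (Conjs js))" unfolding sat_Exs
          using Cw' J by (intro exI[of _ w']) (auto simp: w'_def js)
        then have "sat N v (Exs ys (Conjs js))" by (simp add: tr)
        then show "\<exists>x. (\<forall>i. i \<notin> set ys \<longrightarrow> x i = v i) \<and> (\<forall>\<phi>\<in>J. sat N x \<phi>)"
          unfolding sat_Exs by (auto simp: js)
      qed
      then obtain x where x: "\<And>i. i \<notin> set ys \<Longrightarrow> x i = v i" "\<And>\<phi>. \<phi> \<in> C \<Longrightarrow> sat N x \<phi>" by blast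
      have xe: "x (e j) = \<gamma> j" for j using x(1)[OF eys] by (simp add: ve)
      define u' where "u' = zip (map fst u) (map x ys)"
      have "lin id u' = lin x (zip (map fst u) ys)"
        using lin_map[of id x "zip (map fst u) ys"] by (simp add: u'_def zip_map2)
      moreover have "lin x l = 0" using x(2)[of "Lin l"] by (simp add: C_def sat_Lin)
      ultimately have linu': "lin id u' = \<gamma> k" by (simp add: linx xe)
      moreover have "snd ` set u' \<subseteq> RN - G"
      proof
        fix z assume "z \<in> snd ` set u'"
        then have "z \<in> set (map x ys)" by (auto simp: u'_def dest: set_zip_rightD)
        then obtain i where i: "i < m" "z = x (o' i)" by (auto simp: ys_def)
        have "z \<in> RN" using x(2)[of "InR (Var (o' i))"] i by (simp add: C_def)
        moreover have "z \<noteq> \<gamma> j" for j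
          using x(2)[of "Neg (Eq (Var (o' i)) (Var (e j)))"] i by (force simp: C_def xe)
        ultimately show "z \<in> RN - G" using \<gamma> by auto
      qed
      ultimately have "\<gamma> k = 0" using goodD[OF G(3), of u'] \<gamma> by auto
      then show "lin id u = 0" using k zero by simp
    qed
  qed
  moreover have "(us ! i, ws ! i) \<in> \<Gamma>" if i: "i < length us" for i
  proof -
    have "us ! i \<in> range \<gamma>" unfolding \<gamma> using G(1) i by auto
    then obtain k where k: "us ! i = \<gamma> k" by blast
    then have "sat N v (Eq (Var i) (Var (e k)))" using i by (simp add: ve) (simp add: v_def L_def)
    then have "w i = \<gamma>' k" using w[of "Eq (Var i) (Var (e k))"] by (simp add: \<gamma>'_def)
    then show ?thesis using wL[of i] i k by (auto simp: \<Gamma>_def L_def)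
  qed
  ultimately show thesis using that[of \<Gamma>] by (simp add: \<Gamma>_def)
qed

end

section \<open>Models of the theory embed elementarily into the nonstandard model\<close>

text \<open>Renaming by an injective map also renames the bound variables, so that nothing can be
  captured.\<close>

primrec ren_tm :: "(nat \<Rightarrow> nat) \<Rightarrow> tm \<Rightarrow> tm" where
  "ren_tm f (Var i) = Var (f i)"
| "ren_tm f Zero = Zero"
| "ren_tm f (Plus s t) = Plus (ren_tm f s) (ren_tm f t)"

primrec ren :: "(nat \<Rightarrow> nat) \<Rightarrow> fm \<Rightarrow> fm" where
  "ren f (Eq s t) = Eq (ren_tm f s) (ren_tm f t)"
| "ren f (InR t) = InR (ren_tm f t)"
| "ren f (Neg \<phi>) = Neg (ren f \<phi>)"
| "ren f (Conj \<phi> \<psi>) = Conj (ren f \<phi>) (ren f \<psi>)"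
| "ren f (Ex i \<phi>) = Ex (f i) (ren f \<phi>)"

lemma eval_ren_tm: "eval M v (ren_tm f t) = eval M (v \<circ> f) t"
  by (induction t) auto

lemma sat_ren:
  assumes "inj f"
  shows "sat M v (ren f \<phi>) \<longleftrightarrow> sat M (v \<circ> f) \<phi>"
proof (induction \<phi> arbitrary: v)
  case (Ex i \<phi>)
  have "(v(f i := x)) \<circ> f = (v \<circ> f)(i := x)" for x
    using assms by (auto simp: fun_eq_iff inj_def)
  then show ?case by (simp only: ren.simps sat.simps Ex.IH)
qed (auto simp: eval_ren_tm)

lemma model_Th_iff:
  assumes "model M (Th S)" "fv \<phi> = {}"
  shows "sat M v \<phi> \<longleftrightarrow> sat S w \<phi>"
proof -
  have ind: "sat S w' \<phi> = sat S w \<phi>" for w' by (rule sat_cong) (simp add: assms(2))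
  show ?thesis
  proof (cases "sat S w \<phi>")
    case True
    then have "\<phi> \<in> Th S" using ind assms(2) by (auto simp: Th_def)
    then show ?thesis using True assms(1) by (auto simp: model_def)
  next
    case False
    then have "Neg \<phi> \<in> Th S" using ind assms(2) by (auto simp: Th_def)
    then show ?thesis using False assms(1) by (auto simp: model_def)
  qed
qed

text \<open>One variable is introduced for each occurrence of an element, and equations between
  these variables express which occurrences are of the same element. So finitely many
  facts about a model become one sentence, which holds in every elementarily equivalent
  structure.\<close>

lemma finite_reflection:
  fixes M :: "'m struc" and S :: "'s struc"
  assumes "model M (Th S)" "finite (F :: (fm \<times> (nat \<Rightarrow> 'm)) set)"
  shows "\<exists>g :: 'm \<Rightarrow> 's. \<forall>(\<phi>, v)\<in>F. sat M v \<phi> \<longleftrightarrow> sat S (g \<circ> v) \<phi>"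
proof -
  obtain fs where fs: "set fs = F" using finite_list[OF assms(2)] by blast
  define \<phi> where "\<phi> j = fst (fs ! j)" for j
  define v where "v j = snd (fs ! j)" for j
  define \<psi> where "\<psi> j = (if sat M (v j) (\<phi> j) then \<phi> j else Neg (\<phi> j))" for j
  define f where "f j i = prod_encode (j, i)" for j i
  have inj: "inj (f j)" for j by (auto simp: f_def inj_def)
  define D where "D = Sigma {..<length fs} (\<lambda>j. fv (\<phi> j))"
  have finD: "finite D" by (simp add: D_def)
  define E where "E = {(p, q). p \<in> D \<and> q \<in> D \<and> v (fst p) (snd p) = v (fst q) (snd q)}"
  have "E \<subseteq> D \<times> D" by (auto simp: E_def)
  then have "finite E" using finD finite_subset by blast
  then obtain es where es: "set es = E" using finite_list by blast
  define \<Psi> where "\<Psi> = Conjs (map (\<lambda>j. ren (f j) (\<psi> j)) [0..<length fs] @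
    map (\<lambda>(p, q). Eq (Var (prod_encode p)) (Var (prod_encode q))) es)"
  obtain xs where xs: "set xs = fv \<Psi>" using finite_list[of "fv \<Psi>"] by auto
  define W where "W n = v (fst (prod_decode n)) (snd (prod_decode n))" for n
  have Wf: "W \<circ> f j = v j" for j by (auto simp: W_def f_def)
  have "sat M (v j) (\<psi> j)" for j by (simp add: \<psi>_def)
  then have "sat M W \<Psi>"
    by (auto simp: \<Psi>_def sat_ren[OF inj] Wf es E_def W_def)
  then have "sat M W (Exs xs \<Psi>)" unfolding sat_Exs by (intro exI[of _ W]) simp
  moreover have "fv (Exs xs \<Psi>) = {}" unfolding fv_Exs xs by simp
  ultimately have "sat S (\<lambda>_. undefined) (Exs xs \<Psi>)" using model_Th_iff[OF assms(1)] by blast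
  then obtain w where w: "sat S w \<Psi>" unfolding sat_Exs by blast
  define g where "g x = w (prod_encode (SOME p. p \<in> D \<and> v (fst p) (snd p) = x))" for x
  have g: "g (v j i) = w (f j i)" if "(j, i) \<in> D" for j i
  proof -
    define p where "p = (SOME p. p \<in> D \<and> v (fst p) (snd p) = v j i)"
    have "p \<in> D \<and> v (fst p) (snd p) = v j i"
      unfolding p_def by (rule someI[of _ "(j, i)"]) (use that in simp)
    then have "(p, (j, i)) \<in> set es" using that by (auto simp: es E_def)
    then have "w (prod_encode p) = w (prod_encode (j, i))" using w by (force simp: \<Psi>_def)
    then show ?thesis by (simp add: g_def p_def f_def)
  qed
  have "sat M (v j) (\<phi> j) \<longleftrightarrow> sat S (g \<circ> v j) (\<phi> j)" if j: "j < length fs" for j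
  proof -
    have "sat S w (ren (f j) (\<psi> j))" using w j by (simp add: \<Psi>_def)
    then have "sat S (w \<circ> f j) (\<psi> j)" by (simp add: sat_ren[OF inj])
    moreover have "sat S (w \<circ> f j) (\<phi> j) = sat S (g \<circ> v j) (\<phi> j)"
      by (rule sat_cong) (use g[of j] j in \<open>auto simp: D_def\<close>)
    ultimately show ?thesis by (auto simp: \<psi>_def split: if_splits)
  qed
  moreover have "\<exists>j<length fs. p = fs ! j" if "p \<in> F" for p
    using that fs by (metis in_set_conv_nth)
  ultimately have "case p of (\<phi>, v) \<Rightarrow> sat M v \<phi> \<longleftrightarrow> sat S (g \<circ> v) \<phi>" if "p \<in> F" for p
    using that unfolding \<phi>_def v_def case_prod_unfold by metis
  then show ?thesis by blast
qed

context regular_sequence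
begin

text \<open>The index \<open>i = (k, \<Psi>)\<close> stands for a finite set \<open>\<Psi>\<close> of formulas with parameters. The
  map \<open>g i\<close> sends the elements of the model to integers in such a way that the formulas in
  \<open>\<Psi>\<close> are respected, with the object variables replaced by any chosen realization of a
  subset of \<open>\<Psi>\<close> in at most \<open>k\<close> variables. As almost every \<open>\<Psi>\<close> contains a given formula,
  the maps \<open>g i\<close> together form an elementary embedding into the ultrapower, and the chosen
  realizations of the finite subsets of a type together realize it.\<close>

theorem elementary_embedding:
  fixes M :: "'m struc"
  assumes "model M (Th Z)"
  obtains h :: "'m \<Rightarrow> 'm pfm hyp" where
    "\<And>v \<phi>. sat M v \<phi> \<longleftrightarrow> sat N (h \<circ> v) \<phi>"
    "\<And>n \<Phi>. finitely_sat M n \<Phi> \<Longrightarrow> \<Phi> \<subseteq> Forms n UNIV \<Longrightarrow>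
      \<exists>xs. length xs = n \<and> (\<forall>(\<phi>, bs)\<in>\<Phi>. sat N ((!) (xs @ map h bs)) \<phi>)"
proof -
  \<comment> \<open>Some realization of the finite set \<open>q\<close> in the model.\<close>
  define xsel where "xsel n q = (SOME xs. length xs = n \<and> (\<forall>f\<in>q. holds M xs f))" for n q
  define Fs where "Fs i = (\<lambda>(n, q, \<phi>, bs). (\<phi>, (!) (xsel n q @ bs))) ` ({..fst i} \<times> Pow (snd i) \<times> snd i)"
    for i :: "nat \<times> 'm pfm set"
  define g where "g i = (SOME g. \<forall>(\<phi>, v)\<in>Fs i. sat M v \<phi> \<longleftrightarrow> sat Z (g \<circ> v) \<phi>)" for i
  have g: "sat M ((!) (xsel n q @ bs)) \<phi> \<longleftrightarrow> sat Z (g i \<circ> (!) (xsel n q @ bs)) \<phi>"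
    if "finite (snd i)" "n \<le> fst i" "q \<subseteq> snd i" "(\<phi>, bs) \<in> snd i" for i n q \<phi> bs
  proof -
    have "finite (Fs i)" using that(1) by (simp add: Fs_def)
    from someI_ex[OF finite_reflection[OF assms this]]
    have "\<forall>(\<phi>, v)\<in>Fs i. sat M v \<phi> \<longleftrightarrow> sat Z (g i \<circ> v) \<phi>" unfolding g_def .
    moreover have "(\<phi>, (!) (xsel n q @ bs)) \<in> Fs i"
      unfolding Fs_def by (rule image_eqI[of _ _ "(n, q, \<phi>, bs)"]) (use that in auto)
    ultimately show ?thesis by blast
  qed
  define h where "h x = hyp (\<lambda>i. g i x)" for x
  show thesis
  proof (rule that[of h])
    show "sat M v \<phi> \<longleftrightarrow> sat N (h \<circ> v) \<phi>" for v \<phi>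
    proof -
      define K where "K = Suc (Max (insert 0 (fv \<phi>)))"
      have K: "n < K" if "n \<in> fv \<phi>" for n
        unfolding K_def less_Suc_eq_le by (rule Max_ge) (use that in auto)
      define bs where "bs = map v [0..<K]"
      have "xsel 0 {} = []" unfolding xsel_def by (rule some_equality) auto
      have bs: "((!) bs) n = v n" if "n \<in> fv \<phi>" for n using K[OF that] by (simp add: bs_def)
      have "sat N (h \<circ> v) \<phi> \<longleftrightarrow> (\<forall>\<^sub>F i in uf. sat Z (\<lambda>n. g i (v n)) \<phi>)"
        using Los[of "\<lambda>n i. g i (v n)" \<phi>] by (simp add: h_def o_def)
      also have "\<dots> \<longleftrightarrow> (\<forall>\<^sub>F i in (uf :: (nat \<times> 'm pfm set) filter). sat M v \<phi>)"
      proof (rule eventually_subst)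
        show "\<forall>\<^sub>F i in uf. sat Z (\<lambda>n. g i (v n)) \<phi> = sat M v \<phi>"
          using ev_contains[of "(\<phi>, bs)"] ev_finite
        proof eventually_elim
          case (elim i)
          have "sat M v \<phi> = sat M ((!) (xsel 0 {} @ bs)) \<phi>"
            by (rule sat_cong) (simp add: \<open>xsel 0 {} = []\<close> bs)
          also have "\<dots> = sat Z (g i \<circ> (!) (xsel 0 {} @ bs)) \<phi>"
            by (rule g) (use elim in auto)
          also have "\<dots> = sat Z (\<lambda>n. g i (v n)) \<phi>"
            by (rule sat_cong) (simp add: \<open>xsel 0 {} = []\<close> bs)
          finally show ?case ..
        qed
      qed
      also have "\<dots> \<longleftrightarrow> sat M v \<phi>" by simp
      finally show ?thesis ..
    qed
    fix n and \<Phi> :: "'m pfm set" assume fs: "finitely_sat M n \<Phi>" and \<Phi>: "\<Phi> \<subseteq> Forms n UNIV"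
    define Y where "Y e = (\<lambda>i. g i (xsel n (\<Phi> \<inter> snd i) ! e))" for e
    show "\<exists>xs. length xs = n \<and> (\<forall>(\<phi>, bs)\<in>\<Phi>. sat N ((!) (xs @ map h bs)) \<phi>)"
    proof (intro exI[of _ "map (\<lambda>e. hyp (Y e)) [0..<n]"] conjI, simp, clarify)
      fix \<phi> bs assume f: "(\<phi>, bs) \<in> \<Phi>"
      then have fv: "fv \<phi> \<subseteq> {..<n + length bs}" using \<Phi> by (auto simp: Forms_def)
      define x where "x e = (if e < n then Y e else (\<lambda>i. g i (bs ! (e - n))))" for e
      have "sat N ((!) (map (\<lambda>e. hyp (Y e)) [0..<n] @ map h bs)) \<phi> = sat N (\<lambda>e. hyp (x e)) \<phi>"
        by (rule sat_cong) (use fv in \<open>auto simp: nth_append x_def h_def\<close>)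
      also have "\<dots> \<longleftrightarrow> (\<forall>\<^sub>F i in uf. sat Z (\<lambda>e. x e i) \<phi>)" by (rule Los)
      also have "\<dots>" using ev_contains[of "(\<phi>, bs)"] ev_finite ev_ge[of n]
      proof eventually_elim
        case (elim i)
        define q where "q = \<Phi> \<inter> snd i"
        have "finite q" "q \<subseteq> \<Phi>" using elim by (auto simp: q_def)
        then have "\<exists>xs. length xs = n \<and> (\<forall>f\<in>q. holds M xs f)" using fs by (simp add: finitely_sat_def)
        from someI_ex[OF this] have q: "length (xsel n q) = n" "\<forall>f\<in>q. holds M (xsel n q) f"
          unfolding xsel_def by blast+
        have "(\<phi>, bs) \<in> q" using f elim(1) by (simp add: q_def)
        then have "sat M ((!) (xsel n q @ bs)) \<phi>" using q(2) by (auto simp: holds_def)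
        then have "sat Z (g i \<circ> (!) (xsel n q @ bs)) \<phi>"
          using g[of i n q \<phi> bs] elim by (auto simp: q_def)
        moreover have "sat Z (g i \<circ> (!) (xsel n q @ bs)) \<phi> = sat Z (\<lambda>e. x e i) \<phi>"
          by (rule sat_cong) (auto simp: x_def Y_def nth_append q(1) q_def[symmetric])
        ultimately show ?case by simp
      qed
      finally show "sat N ((!) (map (\<lambda>e. hyp (Y e)) [0..<n] @ map h bs)) \<phi>" by simp
    qed
  qed
qed



section \<open>Algebraic closure\<close>

lemma teq_trans: "teq us ws \<Longrightarrow> teq ws zs \<Longrightarrow> teq us zs" by (simp add: teq_def)

lemma teq_piso_zip:
  assumes "teq us ws"
  obtains \<Gamma> where "piso \<Gamma>" "countable \<Gamma>" "set (zip us ws) \<subseteq> \<Gamma>"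
proof -
  obtain \<Gamma> where G: "piso \<Gamma>" "countable \<Gamma>" "\<And>i. i < length us \<Longrightarrow> (us ! i, ws ! i) \<in> \<Gamma>"
    using teq_piso[OF assms] by blast
  then show thesis using that[of \<Gamma>] by (auto simp: set_zip)
qed

lemma piso_teq_zip:
  assumes "piso \<Gamma>" "countable \<Gamma>" "length us = length ws" "set (zip us ws) \<subseteq> \<Gamma>"
  shows "teq us ws"
proof (rule piso_teq[OF assms(1-3)])
  fix i assume "i < length us"
  then have "(us ! i, ws ! i) \<in> set (zip us ws)" using assms(3) by (auto simp: set_zip)
  then show "(us ! i, ws ! i) \<in> \<Gamma>" using assms(4) by blast
qed

text \<open>The realizations of the type of \<open>x\<close> over \<open>us\<close>, called the conjugates of \<open>x\<close>.\<close>

definition orbit :: "'a hyp list \<Rightarrow> 'a hyp \<Rightarrow> 'a hyp set" where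
  "orbit us x = {y. teq (x # us) (y # us)}"

lemma orbitI:
  assumes "piso \<Gamma>" "countable \<Gamma>" "(x, y) \<in> \<Gamma>" "\<And>u. u \<in> set us \<Longrightarrow> (u, u) \<in> \<Gamma>"
  shows "y \<in> orbit us x"
  unfolding orbit_def mem_Collect_eq
  by (rule piso_teq_zip[OF assms(1,2)]) (use assms(3,4) in \<open>auto simp: zip_same\<close>)

lemma orbitE:
  assumes "y \<in> orbit us x"
  obtains \<Gamma> where "piso \<Gamma>" "countable \<Gamma>" "(x, y) \<in> \<Gamma>" "\<And>u. u \<in> set us \<Longrightarrow> (u, u) \<in> \<Gamma>"
proof -
  from assms have "teq (x # us) (y # us)" by (simp add: orbit_def)
  then obtain \<Gamma> where "piso \<Gamma>" "countable \<Gamma>" "set (zip (x # us) (y # us)) \<subseteq> \<Gamma>" by (rule teq_piso_zip)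
  moreover from this have "(u, u) \<in> \<Gamma>" if "u \<in> set us" for u
    using that zip_same[of u u us] by auto
  ultimately show thesis using that[of \<Gamma>] by simp
qed

text \<open>Finitely many elements can be avoided within an infinite orbit, so by saturation
  countably many can be avoided.\<close>

lemma orbit_avoid:
  assumes inf: "infinite (orbit us x)" and E: "countable E"
  obtains y where "y \<in> orbit us x" "y \<notin> E"
proof (cases "E = {}")
  case True
  then show ?thesis using that infinite_imp_nonempty[OF inf] by blast
next
  case False
  define L where "L = Suc (length us)"
  define e where "e = from_nat_into E"
  have e: "range e = E" unfolding e_def by (rule range_from_nat_into[OF False E])
  define v where "v n = (if n < L then (x # us) ! n else e (n - L))" for n
  define C where "C = {\<phi>. fv \<phi> \<subseteq> {..<L} \<and> sat N ((!) (x # us)) \<phi>} \<union>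
    (\<lambda>k. Neg (Eq (Var 0) (Var (L + k)))) ` UNIV"
  have vy: "sat N (v(0 := y)) \<phi> = sat N ((!) (y # us)) \<phi>" if "fv \<phi> \<subseteq> {..<L}" for y \<phi>
    by (rule sat_cong) (use that in \<open>auto simp: v_def L_def nth_Cons split: nat.split\<close>)
  have ve: "(v(0 := y)) (L + k) = e k" for y k by (simp add: v_def L_def)
  have "\<exists>w. (\<forall>i. i \<notin> {0} \<longrightarrow> w i = v i) \<and> (\<forall>\<phi>\<in>C. sat N w \<phi>)"
  proof (rule fm_saturation)
    fix J assume J: "finite J" "J \<subseteq> C"
    define K where "K = {k. Neg (Eq (Var 0) (Var (L + k))) \<in> J}"
    have "finite K"
    proof (rule finite_imageD)
      show "finite ((\<lambda>k. Neg (Eq (Var 0) (Var (L + k)))) ` K)"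
        using J(1) by (rule rev_finite_subset) (auto simp: K_def)
      show "inj_on (\<lambda>k. Neg (Eq (Var 0) (Var (L + k)))) K" by (auto simp: inj_on_def)
    qed
    then have "infinite (orbit us x - e ` K)" using inf by (simp add: Diff_infinite_finite)
    then obtain y where y: "y \<in> orbit us x" "y \<notin> e ` K" using infinite_imp_nonempty by blast
    have "sat N (v(0 := y)) \<phi>" if \<phi>: "\<phi> \<in> J" for \<phi>
    proof -
      consider "fv \<phi> \<subseteq> {..<L}" "sat N ((!) (x # us)) \<phi>" | k where "\<phi> = Neg (Eq (Var 0) (Var (L + k)))"
        using \<phi> J(2) by (auto simp: C_def)
      then show ?thesis
      proof cases
        case 1
        then show ?thesis using y(1) unfolding vy[OF 1(1)] orbit_def teq_def by (auto simp: L_def)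
      next
        case (2 k)
        then have "k \<in> K" using \<phi> by (simp add: K_def)
        then show ?thesis using y(2) ve[of y k] 2 by auto
      qed
    qed
    then show "\<exists>w. (\<forall>i. i \<notin> {0} \<longrightarrow> w i = v i) \<and> (\<forall>\<phi>\<in>J. sat N w \<phi>)"
      by (intro exI[of _ "v(0 := y)"]) auto
  qed
  then obtain w where w: "\<forall>i. i \<notin> {0} \<longrightarrow> w i = v i" "\<forall>\<phi>\<in>C. sat N w \<phi>" by blast
  define y where "y = w 0"
  have wy: "w = v(0 := y)" using w(1) by (auto simp: y_def)
  have pos: "sat N ((!) (y # us)) \<phi>" if "fv \<phi> \<subseteq> {..<L}" "sat N ((!) (x # us)) \<phi>" for \<phi>
  proof -
    have "sat N w \<phi>" using w(2) that by (simp add: C_def)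
    then show ?thesis unfolding wy vy[OF that(1)] .
  qed
  have "sat N ((!) (x # us)) \<phi> = sat N ((!) (y # us)) \<phi>" if "fv \<phi> \<subseteq> {..<L}" for \<phi>
    using pos[of \<phi>] pos[of "Neg \<phi>"] that by auto
  then have "y \<in> orbit us x" by (simp add: orbit_def teq_def L_def)
  moreover have "y \<noteq> e k" for k
  proof -
    have "Neg (Eq (Var 0) (Var (L + k))) \<in> C" unfolding C_def by blast
    then have "sat N w (Neg (Eq (Var 0) (Var (L + k))))" using w(2) by blast
    then show ?thesis using ve[of y k] unfolding wy by auto
  qed
  ultimately show ?thesis using that e by (metis imageE)
qed

text \<open>As \<open>N\<close> is \<open>\<aleph>\<^sub>1\<close>-saturated, an element is algebraic over a finite tuple if and only if
  its type over the tuple has only finitely many realizations.\<close>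

definition Acl :: "'a hyp set \<Rightarrow> 'a hyp set" where
  "Acl X = {x. \<exists>us. set us \<subseteq> X \<and> finite (orbit us x)}"

lemma AclI: "set us \<subseteq> X \<Longrightarrow> finite (orbit us x) \<Longrightarrow> x \<in> Acl X"
  by (auto simp: Acl_def)

lemma AclE:
  assumes "x \<in> Acl X"
  obtains us where "set us \<subseteq> X" "finite (orbit us x)"
  using assms by (auto simp: Acl_def)

lemma Acl_mono: "X \<subseteq> Y \<Longrightarrow> Acl X \<subseteq> Acl Y"
  by (auto simp: Acl_def)

lemma Acl_base: "X \<subseteq> Acl X"
proof
  fix x assume "x \<in> X"
  have "orbit [x] x \<subseteq> {x}" by (auto elim!: orbitE dest: piso_fun)
  then show "x \<in> Acl X" using \<open>x \<in> X\<close> by (intro AclI[of "[x]"]) (auto intro: finite_subset)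
qed

lemma Acl_1: "1 \<in> Acl X"
proof (rule AclI)
  have "orbit [] 1 \<subseteq> {1}" by (auto elim!: orbitE dest: piso_fun piso_1)
  then show "finite (orbit [] 1)" by (rule finite_subset) simp
qed simp

text \<open>A conjugate of \<open>x - y\<close> is a difference of conjugates of \<open>x\<close> and \<open>y\<close>, and
  multiplication by \<open>n\<close> maps conjugates to conjugates injectively.\<close>

lemma psub_Acl: "psub (Acl X)"
  unfolding psub_def
proof (intro conjI ballI allI impI)
  have "orbit [] 0 \<subseteq> {0}" by (auto elim!: orbitE dest: piso_fun piso_0)
  then show "0 \<in> Acl X" by (intro AclI[of "[]"]) (auto intro: finite_subset)
  show "x - y \<in> Acl X" if "x \<in> Acl X" "y \<in> Acl X" for x y
  proof -
    obtain us where us: "set us \<subseteq> X" "finite (orbit us x)" using \<open>x \<in> Acl X\<close> by (rule AclE)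
    obtain ws where ws: "set ws \<subseteq> X" "finite (orbit ws y)" using \<open>y \<in> Acl X\<close> by (rule AclE)
    have "orbit (us @ ws) (x - y) \<subseteq> (\<lambda>(x, y). x - y) ` (orbit us x \<times> orbit ws y)"
    proof
      fix z assume "z \<in> orbit (us @ ws) (x - y)"
      then obtain \<Gamma> where G: "piso \<Gamma>" "countable \<Gamma>" "(x - y, z) \<in> \<Gamma>" "\<And>u. u \<in> set (us @ ws) \<Longrightarrow> (u, u) \<in> \<Gamma>"
        by (rule orbitE) blast
      from forth[OF G(1,2), of x] obtain \<Delta> x' where D: "\<Gamma> \<subseteq> \<Delta>" "piso \<Delta>" "countable \<Delta>" "(x, x') \<in> \<Delta>" by blast
      have y: "(y, x' - z) \<in> \<Delta>" using piso_diff[OF D(2,4), of "x - y" z] D(1) G(3) by auto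
      have "x' \<in> orbit us x" by (rule orbitI[OF D(2,3,4)]) (use G(4) D(1) in auto)
      moreover have "x' - z \<in> orbit ws y" by (rule orbitI[OF D(2,3) y]) (use G(4) D(1) in auto)
      ultimately show "z \<in> (\<lambda>(x, y). x - y) ` (orbit us x \<times> orbit ws y)"
        by (intro image_eqI[of _ _ "(x', x' - z)"]) auto
    qed
    then have "finite (orbit (us @ ws) (x - y))" by (rule finite_subset) (use us ws in auto)
    then show ?thesis using us ws by (intro AclI[of "us @ ws"]) auto
  qed
  show "x \<in> Acl X" if n: "n \<noteq> 0" and x: "of_int n * x \<in> Acl X" for n x
  proof -
    obtain us where us: "set us \<subseteq> X" "finite (orbit us (of_int n * x))" using x by (rule AclE)
    have "(\<lambda>y. of_int n * y) ` orbit us x \<subseteq> orbit us (of_int n * x)"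
      by (auto elim!: orbitE intro: orbitI piso_mult)
    then have "finite ((\<lambda>y. of_int n * y) ` orbit us x)" using us(2) finite_subset by blast
    then have "finite (orbit us x)" by (rule finite_imageD) (use n in \<open>auto simp: inj_on_def\<close>)
    then show ?thesis using us by (intro AclI[of us])
  qed
qed

text \<open>Let \<open>x\<close> be algebraic and \<open>x = \<Sum> c\<^sub>j u\<^sub>j\<close>, with \<open>u\<^sub>j \<in> R\<close> and as few terms as possible,
  so that no subsum vanishes. If \<open>u\<close> is one of the \<open>u\<^sub>j\<close> and is not algebraic, it has a
  conjugate \<open>z\<close> whose chain is new to the countably many chains in fixed representations
  of the finitely many conjugates of \<open>x\<close>. Transporting the sum along with \<open>u\<close> gives
  another representation of a conjugate of \<open>x\<close>, and in the difference of the two the chain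
  of \<open>z\<close> contributes a nonempty subsum of the transported one. It vanishes, hence so does
  the corresponding subsum of the original sum, a contradiction.\<close>

lemma good_Acl: "good (Acl X)"
  unfolding good_def
proof (intro allI impI, rule ccontr)
  fix l0 assume l0: "snd ` set l0 \<subseteq> RN - Acl X" "lin id l0 \<in> Acl X" "lin id l0 \<noteq> 0"
  define x where "x = lin id l0"
  define P where "P l \<longleftrightarrow> snd ` set l \<subseteq> RN - Acl X \<and> lin id l = x" for l
  have "P l0" using l0 by (simp add: P_def x_def)
  then obtain l where l: "P l" "\<And>l'. P l' \<Longrightarrow> length l \<le> length l'"
    using ex_has_least_nat[of P l0 length] by blast
  have lR: "snd ` set l \<subseteq> RN - Acl X" and lx: "lin id l = x" using l(1) by (auto simp: P_def)
  have nosub: "filter Q l = []" if "lin id (filter Q l) = 0" for Q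
  proof (rule ccontr)
    assume ne: "filter Q l \<noteq> []"
    have "P (filter (\<lambda>p. \<not> Q p) l)"
      using lin_filter[of id l Q] that lR lx by (auto simp: P_def)
    then have "length l \<le> length (filter (\<lambda>p. \<not> Q p) l)" by (rule l(2))
    moreover have "0 < length (filter Q l)" using ne by simp
    ultimately show False using sum_length_filter_compl[of Q l] by linarith
  qed
  have "l \<noteq> []" using lx l0(3) x_def by auto
  then obtain u where u: "u \<in> snd ` set l" by (metis hd_in_set imageI)
  obtain us where us: "set us \<subseteq> X" "finite (orbit us x)"
    using l0(2) unfolding x_def[symmetric] by (rule AclE)
  have conj: "\<exists>\<Delta> g. \<Gamma> \<subseteq> \<Delta> \<and> piso \<Delta> \<and> countable \<Delta> \<and> (\<forall>z\<in>snd ` set l. (z, g z) \<in> \<Delta>)"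
    if "piso \<Gamma>" "countable \<Gamma>" for \<Gamma>
  proof -
    have "set (map snd l) \<subseteq> RN" using lR by auto
    from forth_RN_list[OF that this, of "{}"] obtain \<Delta> where
      D: "\<Gamma> \<subseteq> \<Delta>" "piso \<Delta>" "countable \<Delta>" "set (map snd l) \<subseteq> Domain \<Delta>" by auto
    have "\<forall>z\<in>snd ` set l. \<exists>w. (z, w) \<in> \<Delta>" using D(4) by auto
    then obtain g where "\<forall>z\<in>snd ` set l. (z, g z) \<in> \<Delta>" by metis
    then show ?thesis using D by blast
  qed
  have lin_g: "(lin id l', lin g l') \<in> \<Delta>" if "piso \<Delta>" "\<forall>z\<in>snd ` set l. (z, g z) \<in> \<Delta>" "set l' \<subseteq> set l" for \<Delta> g l'
    by (rule piso_lin[OF that(1)]) (use that in auto)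
  \<comment> \<open>Every conjugate of \<open>x\<close> has a representation of its own by members of \<open>R\<close>.\<close>
  have "\<exists>w. snd ` set w \<subseteq> RN \<and> lin id w = y" if y: "y \<in> orbit us x" for y
  proof -
    from y obtain \<Gamma> where G: "piso \<Gamma>" "countable \<Gamma>" "(x, y) \<in> \<Gamma>" by (rule orbitE)
    from conj[OF G(1,2)] obtain \<Delta> g where D: "\<Gamma> \<subseteq> \<Delta>" "piso \<Delta>" "\<forall>z\<in>snd ` set l. (z, g z) \<in> \<Delta>" by blast
    have "(x, lin g l) \<in> \<Delta>" using lin_g[OF D(2,3)] lx by auto
    then have "lin g l = y" using piso_fun[OF D(2)] D(1) G(3) by blast
    moreover have "snd ` set (map (\<lambda>(c, z). (c, g z)) l) \<subseteq> RN"
      using piso_RN[OF D(2)] D(3) lR by force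
    ultimately show ?thesis by (intro exI[of _ "map (\<lambda>(c, z). (c, g z)) l"]) (simp add: lin_id_map)
  qed
  then obtain w where w: "\<And>y. y \<in> orbit us x \<Longrightarrow> snd ` set (w y) \<subseteq> RN \<and> lin id (w y) = y" by metis
  define E where "E = (\<Union>y\<in>orbit us x. \<Union>t\<in>snd ` set (w y). {t' \<in> RN. linked t t'})"
  have "countable E" unfolding E_def
    by (intro countable_UN[OF countable_finite[OF us(2)]] countable_UN[OF countable_finite] countable_chain)
      (use w in auto)
  have "u \<notin> Acl X" "u \<in> RN" using u lR by auto
  then have "infinite (orbit us u)" using us(1) AclI by blast
  then obtain z where z: "z \<in> orbit us u" "z \<notin> E" using \<open>countable E\<close> by (rule orbit_avoid)
  from z(1) obtain \<Gamma> where G: "piso \<Gamma>" "countable \<Gamma>" "(u, z) \<in> \<Gamma>" "\<And>u. u \<in> set us \<Longrightarrow> (u, u) \<in> \<Gamma>"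
    by (rule orbitE) blast
  from conj[OF G(1,2)] obtain \<Delta> g where D: "\<Gamma> \<subseteq> \<Delta>" "piso \<Delta>" "countable \<Delta>" "\<forall>z\<in>snd ` set l. (z, g z) \<in> \<Delta>"
    by blast
  have gu: "g u = z" using piso_fun[OF D(2)] D(1,4) G(3) u by blast
  have zR: "z \<in> RN" using piso_RN[OF G(1,3)] \<open>u \<in> RN\<close> by simp
  define y where "y = lin g l"
  have xy: "(x, y) \<in> \<Delta>" using lin_g[OF D(2,4)] lx by (auto simp: y_def)
  have y: "y \<in> orbit us x" by (rule orbitI[OF D(2,3) xy]) (use G(4) D(1) in auto)
  define L where "L = map (\<lambda>(c, z). (c, g z)) l @ scale (- 1) (w y)"
  have gR: "g t \<in> RN" if "t \<in> snd ` set l" for t using piso_RN[OF D(2)] D(4) lR that by blast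
  have "snd ` set L \<subseteq> RN" unfolding L_def snd_append snd_scale using w[OF y] gR by force
  moreover have "lin id L = 0" using w[OF y] by (simp add: L_def lin_id_map y_def)
  ultimately have "lin id (filter (\<lambda>p. linked z (snd p)) L) = 0" by (rule lin_chain)
  moreover have "filter (\<lambda>p. linked z (snd p)) (scale (- 1) (w y)) = []"
  proof -
    have "\<not> linked z t" if "t \<in> snd ` set (w y)" for t
      using that y zR z(2) linked_sym by (auto simp: E_def)
    then show ?thesis unfolding filter_empty_conv using snd_scale[of "- 1" "w y"] by (metis image_eqI)
  qed
  moreover have "filter (\<lambda>p. linked z (snd p)) (map (\<lambda>(c, z). (c, g z)) l)
      = map (\<lambda>(c, z). (c, g z)) (filter (\<lambda>p. linked z (g (snd p))) l)"
    by (simp add: filter_map o_def case_prod_unfold)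
  ultimately have "lin g (filter (\<lambda>p. linked z (g (snd p))) l) = 0" by (simp add: L_def lin_id_map)
  then have "lin id (filter (\<lambda>p. linked z (g (snd p))) l) = 0"
    using piso_zero[OF D(2) lin_g[OF D(2,4)]] by simp
  then have "filter (\<lambda>p. linked z (g (snd p))) l = []" by (rule nosub)
  then show False using u gu by (force simp: filter_empty_conv)
qed

lemma generic_mono: "A \<subseteq> B \<Longrightarrow> generic B x \<Longrightarrow> generic A x"
  by (auto simp: generic_def)

lemma piso_Id: "psub A \<Longrightarrow> good A \<Longrightarrow> 1 \<in> A \<Longrightarrow> piso (Id_on A)"
  by (auto simp: piso_def psub_def Id_on_iff)

end

section \<open>Types over a model\<close>

text \<open>The situation provided by \<open>elementary_embedding\<close>.\<close>

locale embedded_model = regular_sequence r for r +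
  fixes M :: "'m struc" and h :: "'m \<Rightarrow> 'm pfm hyp"
  assumes elementary: "\<And>v \<phi>. sat M v \<phi> \<longleftrightarrow> sat N (h \<circ> v) \<phi>"
    and realize: "\<And>n \<Phi>. finitely_sat M n \<Phi> \<Longrightarrow> \<Phi> \<subseteq> Forms n UNIV \<Longrightarrow>
      \<exists>xs. length xs = n \<and> (\<forall>(\<phi>, bs)\<in>\<Phi>. sat N ((!) (xs @ map h bs)) \<phi>)"
begin

text \<open>Formulas with parameters in \<open>M\<close> are evaluated at tuples of nonstandard elements. The
  type of such a tuple over \<open>A\<close> is a type of \<open>M\<close>, and all types of \<open>M\<close> are of this form.\<close>

definition Nholds :: "'m pfm hyp list \<Rightarrow> 'm pfm \<Rightarrow> bool" where
  "Nholds xs f \<longleftrightarrow> sat N ((!) (xs @ map h (snd f))) (fst f)"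

definition tpN :: "'m set \<Rightarrow> 'm pfm hyp list \<Rightarrow> 'm pfm set" where
  "tpN A xs = {f \<in> Forms (length xs) A. Nholds xs f}"

lemma Forms_D: "f \<in> Forms n A \<Longrightarrow> fv (fst f) \<subseteq> {..<n + length (snd f)}"
  and Forms_set: "f \<in> Forms n A \<Longrightarrow> set (snd f) \<subseteq> A"
  by (auto simp: Forms_def)

lemma Forms_mono: "A \<subseteq> B \<Longrightarrow> Forms n A \<subseteq> Forms n B"
  by (auto simp: Forms_def)

lemma holds_Nholds:
  assumes "f \<in> Forms (length xs) A"
  shows "holds M xs f \<longleftrightarrow> Nholds (map h xs) f"
proof -
  have "holds M xs f \<longleftrightarrow> sat N (h \<circ> (!) (xs @ snd f)) (fst f)" by (simp add: holds_def elementary)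
  also have "\<dots> \<longleftrightarrow> sat N ((!) (map h (xs @ snd f))) (fst f)"
    by (rule sat_cong) (use Forms_D[OF assms] in \<open>auto simp: nth_append\<close>)
  finally show ?thesis by (simp add: Nholds_def)
qed

lemma tp_tpN: "tp M A xs = tpN A (map h xs)"
  using holds_Nholds by (auto simp: tp_def tpN_def)

lemma Nholds_Neg: "Nholds xs (Neg \<phi>, bs) \<longleftrightarrow> \<not> Nholds xs (\<phi>, bs)"
  by (simp add: Nholds_def)

lemma Nholds_teq:
  "teq (xs @ map h bs) (ys @ map h bs) \<Longrightarrow> length xs = length ys \<Longrightarrow> (\<phi>, bs) \<in> Forms (length xs) A \<Longrightarrow>
    Nholds xs (\<phi>, bs) \<longleftrightarrow> Nholds ys (\<phi>, bs)"
  by (auto simp: Nholds_def teq_def Forms_def)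

text \<open>A formula contains only finitely many parameters.\<close>

lemma tpN_eq_iff:
  "tpN A xs = tpN A ys \<and> length xs = length ys \<longleftrightarrow>
    length xs = length ys \<and> (\<forall>bs\<in>lists A. teq (xs @ map h bs) (ys @ map h bs))"
proof (intro iffI conjI ballI)
  assume e: "tpN A xs = tpN A ys \<and> length xs = length ys"
  show "length xs = length ys" using e by simp
  fix bs assume bs: "bs \<in> lists A"
  show "teq (xs @ map h bs) (ys @ map h bs)" unfolding teq_def
  proof (intro conjI allI impI)
    fix \<phi> assume "fv \<phi> \<subseteq> {..<length (xs @ map h bs)}"
    then have "(\<phi>, bs) \<in> Forms (length xs) A" using bs by (simp add: Forms_def)
    moreover have "(\<phi>, bs) \<in> tpN A xs \<longleftrightarrow> (\<phi>, bs) \<in> tpN A ys" using e by (simp only:)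
    ultimately have "Nholds xs (\<phi>, bs) = Nholds ys (\<phi>, bs)"
      using e unfolding tpN_def mem_Collect_eq by simp
    then show "sat N ((!) (xs @ map h bs)) \<phi> = sat N ((!) (ys @ map h bs)) \<phi>" by (simp add: Nholds_def)
  qed (use e in simp)
next
  assume e: "length xs = length ys \<and> (\<forall>bs\<in>lists A. teq (xs @ map h bs) (ys @ map h bs))"
  then show "length xs = length ys" by simp
  have "Nholds xs f = Nholds ys f" if "f \<in> Forms (length xs) A" for f
    using that e Nholds_teq[of xs "snd f" ys "fst f" A] by (cases f) (auto simp: Forms_def)
  then show "tpN A xs = tpN A ys" using e by (auto simp: tpN_def)
qed

text \<open>The parameter lists of the conditions are renamed apart, so that the conditions become
  a single existential formula with parameters in \<open>M\<close>.\<close>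

lemma reflect:
  assumes fin: "finite \<Psi>" and \<Psi>: "\<Psi> \<subseteq> Forms n UNIV" and xs: "length xs = n" "\<And>f. f \<in> \<Psi> \<Longrightarrow> Nholds xs f"
  shows "\<exists>ys. length ys = n \<and> (\<forall>f\<in>\<Psi>. holds M ys f)"
proof -
  obtain fs where fs: "set fs = \<Psi>" using finite_list[OF fin] by blast
  define f where "f j i = (if i < n then i else n + prod_encode (j, i - n))" for j i
  have inj: "inj (f j)" for j by (auto simp: f_def inj_def split: if_splits)
  define \<Phi> where "\<Phi> = Conjs (map (\<lambda>j. ren (f j) (fst (fs ! j))) [0..<length fs])"
  define v where "v i = (let (j, e) = prod_decode (i - n) in snd (fs ! j) ! e)" for i
  have v: "v (f j i) = snd (fs ! j) ! (i - n)" if "\<not> i < n" for i j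
    using that by (simp add: v_def f_def)
  have agree: "(w \<circ> f j) i = (zs @ map g (snd (fs ! j))) ! i"
    if "\<And>i. i < n \<Longrightarrow> w i = zs ! i" "\<And>i. \<not> i < n \<Longrightarrow> w i = g (v i)" "length zs = n" "j < length fs"
      "i \<in> fv (fst (fs ! j))" for w :: "nat \<Rightarrow> 'x" and zs g i j
  proof -
    have "fs ! j \<in> \<Psi>" using that(4) fs by auto
    then have i: "i < n + length (snd (fs ! j))" using \<Psi> Forms_D that(5) by fastforce
    show ?thesis
    proof (cases "i < n")
      case True then show ?thesis using that(1,3) by (simp add: f_def nth_append)
    next
      case False
      then have "\<not> f j i < n" by (simp add: f_def)
      then show ?thesis using that(2)[of "f j i"] that(3) v[OF False] False i
        by (simp add: nth_append)
    qed
  qed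
  define w where "w i = (if i < n then xs ! i else h (v i))" for i
  have "sat N w (ren (f j) (fst (fs ! j)))" if "j < length fs" for j
  proof -
    have "sat N (w \<circ> f j) (fst (fs ! j)) = sat N ((!) (xs @ map h (snd (fs ! j)))) (fst (fs ! j))"
      by (rule sat_cong, rule agree) (use xs(1) that in \<open>auto simp: w_def\<close>)
    moreover have "fs ! j \<in> \<Psi>" using fs that nth_mem by blast
    then have "Nholds xs (fs ! j)" by (rule xs(2))
    ultimately show ?thesis by (simp add: sat_ren[OF inj] Nholds_def)
  qed
  then have "sat N w \<Phi>" by (simp add: \<Phi>_def)
  then have "sat N (h \<circ> v) (Exs [0..<n] \<Phi>)"
    unfolding sat_Exs by (intro exI[of _ w]) (auto simp: w_def)
  then have "sat M v (Exs [0..<n] \<Phi>)" by (simp add: elementary)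
  then obtain u where u: "\<And>i. \<not> i < n \<Longrightarrow> u i = v i" "sat M u \<Phi>" unfolding sat_Exs by auto
  show ?thesis
  proof (intro exI[of _ "map u [0..<n]"] conjI ballI)
    fix p assume "p \<in> \<Psi>"
    then obtain j where j: "j < length fs" "p = fs ! j" using fs by (metis in_set_conv_nth)
    have "sat M (u \<circ> f j) (fst (fs ! j)) = sat M ((!) (map u [0..<n] @ map id (snd (fs ! j)))) (fst (fs ! j))"
      by (rule sat_cong, rule agree) (use u(1) j in auto)
    moreover have "sat M u (ren (f j) (fst (fs ! j)))" using u(2) j(1) by (simp add: \<Phi>_def)
    ultimately show "holds M (map u [0..<n]) p" by (simp add: sat_ren[OF inj] holds_def j(2))
  qed simp
qed

lemma tpN_types: "tpN A xs \<in> types M (length xs) A"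
  unfolding types_def mem_Collect_eq
proof (intro conjI)
  show "tpN A xs \<subseteq> Forms (length xs) A" by (auto simp: tpN_def)
  show "finitely_sat M (length xs) (tpN A xs)" unfolding finitely_sat_def
  proof (intro allI impI)
    fix \<Psi> assume "finite \<Psi> \<and> \<Psi> \<subseteq> tpN A xs"
    then have "finite \<Psi>" "\<Psi> \<subseteq> Forms (length xs) UNIV" "\<And>f. f \<in> \<Psi> \<Longrightarrow> Nholds xs f"
      using Forms_mono[of A UNIV "length xs"] by (auto simp: tpN_def)
    then show "\<exists>ys. length ys = length xs \<and> (\<forall>f\<in>\<Psi>. holds M ys f)" by (rule reflect[OF _ _ refl])
  qed
  show "\<forall>(\<phi>, bs)\<in>Forms (length xs) A. (\<phi>, bs) \<in> tpN A xs \<or> (Neg \<phi>, bs) \<in> tpN A xs"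
    by (auto simp: tpN_def Forms_def Nholds_Neg)
qed

text \<open>A complete type is not properly contained in any other consistent set of formulas.\<close>

lemma types_eq_tpN:
  assumes p: "p \<in> types M n A" and xs: "length xs = n" "\<forall>f\<in>p. Nholds xs f"
  shows "p = tpN A xs"
proof
  show "p \<subseteq> tpN A xs" using p xs by (auto simp: types_def tpN_def)
  show "tpN A xs \<subseteq> p"
  proof
    fix f assume f: "f \<in> tpN A xs"
    obtain \<phi> bs where fe: "f = (\<phi>, bs)" by (cases f)
    have "f \<in> p \<or> (Neg \<phi>, bs) \<in> p" using f p xs(1) fe by (auto simp: types_def tpN_def)
    moreover have "(Neg \<phi>, bs) \<notin> p"
      using xs(2)[THEN bspec, of "(Neg \<phi>, bs)"] f fe by (auto simp: Nholds_Neg tpN_def)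
    ultimately show "f \<in> p" by blast
  qed
qed

lemma types_eq_tp:
  assumes p: "p \<in> types M n A" and xs: "length xs = n" "\<And>f. f \<in> p \<Longrightarrow> holds M xs f"
  shows "p = tp M A xs"
proof -
  have "Nholds (map h xs) f" if "f \<in> p" for f
    using holds_Nholds[of f xs A] xs that p by (auto simp: types_def)
  then show ?thesis unfolding tp_tpN by (intro types_eq_tpN[OF p]) (use xs(1) in auto)
qed

section \<open>Nonforking\<close>

text \<open>A single element, even one outside \<open>M\<close>, satisfies only finitely many formulas of a
  dividing sequence, because finitely many conditions are reflected in \<open>M\<close>.\<close>

lemma dividing_sequence_bounded:
  assumes f: "f \<in> Forms 1 UNIV" and len: "\<And>i. length (c i) = length (snd f)"
    and k: "\<And>I. finite I \<Longrightarrow> card I = k \<Longrightarrow> \<not> (\<exists>xs. length xs = 1 \<and> (\<forall>i\<in>I. holds M xs (fst f, c i)))"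
    and inf: "infinite {i :: nat. Nholds [a] (fst f, c i)}"
  shows False
proof -
  obtain I where I: "finite I" "card I = k" "I \<subseteq> {i. Nholds [a] (fst f, c i)}"
    using infinite_arbitrarily_large[OF inf] by blast
  have "(\<lambda>i. (fst f, c i)) ` I \<subseteq> Forms 1 UNIV" using f len by (auto simp: Forms_def)
  then have "\<exists>ys. length ys = 1 \<and> (\<forall>g\<in>(\<lambda>i. (fst f, c i)) ` I. holds M ys g)"
    by (intro reflect[of _ 1 "[a]"]) (use I in auto)
  then show False using k[OF I(1,2)] by blast
qed

text \<open>A chain outside domain and range can be matched with itself, since its residues agree
  trivially.\<close>

lemma piso_fix_chains:
  assumes G: "piso \<Gamma>" "countable \<Gamma>" and E: "Domain \<Gamma> \<union> Range \<Gamma> \<subseteq> E"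
    and ss: "\<forall>s\<in>set ss. s \<in> RN \<and> nonstandard s \<and> (\<forall>k. shifted s k \<notin> E)"
  shows "\<exists>\<Gamma>'. \<Gamma> \<subseteq> \<Gamma>' \<and> piso \<Gamma>' \<and> countable \<Gamma>' \<and> (\<forall>s\<in>set ss. \<forall>k. (shifted s k, shifted s k) \<in> \<Gamma>') \<and>
    (\<forall>y\<in>RN \<inter> (Domain \<Gamma>' \<union> Range \<Gamma>'). y \<in> E \<or> (\<exists>s\<in>set ss. linked s y))"
  using ss
proof (induction ss)
  case Nil
  then show ?case using G E by (intro exI[of _ \<Gamma>]) auto
next
  case (Cons s ss)
  then obtain \<Gamma>1 where 1: "\<Gamma> \<subseteq> \<Gamma>1" "piso \<Gamma>1" "countable \<Gamma>1" "\<forall>s\<in>set ss. \<forall>k. (shifted s k, shifted s k) \<in> \<Gamma>1"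
    "\<forall>y\<in>RN \<inter> (Domain \<Gamma>1 \<union> Range \<Gamma>1). y \<in> E \<or> (\<exists>s\<in>set ss. linked s y)" by auto
  have s: "s \<in> RN" "nonstandard s" "\<And>k. shifted s k \<notin> E" using Cons.prems by auto
  show ?case
  proof (cases "\<exists>s'\<in>set ss. linked s' s")
    case True
    then obtain s' where s': "s' \<in> set ss" "linked s' s" by blast
    have n': "nonstandard s'" using Cons.prems s'(1) by simp
    obtain k where k: "s = shifted s' k" using linkedE[OF n' s(1) s'(2)] by blast
    have "(shifted s j, shifted s j) \<in> \<Gamma>1" for j using 1(4) s'(1) shifted_shifted[OF n'] k by simp
    then show ?thesis using 1 by (intro exI[of _ \<Gamma>1]) auto
  next
    case False
    have out: "shifted s k \<notin> Domain \<Gamma>1 \<union> Range \<Gamma>1" for k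
    proof
      assume "shifted s k \<in> Domain \<Gamma>1 \<union> Range \<Gamma>1"
      then obtain s' where "s' \<in> set ss" "linked s' (shifted s k)" using 1(5) s(3) shifted_RN by blast
      then show False using False linked_trans linked_sym[OF linked_shifted[OF s(2)]] by blast
    qed
    define P where "P = chain_pairs (Domain \<Gamma>1) s s"
    have piso': "piso (ext \<Gamma>1 P)" unfolding P_def by (rule piso_chain) (use 1(2) s out in auto)
    have pairs: "(shifted s k, shifted s k) \<in> ext \<Gamma>1 P" for k
    proof -
      have "(shifted s k, shifted s k) \<in> P" unfolding P_def chain_pairs_def using out by auto
      then show ?thesis using ext_new[OF 1(2)] by blast
    qed
    have new: "y \<in> C \<or> linked s y"
      if C: "psub C" "good C" "C \<subseteq> Domain \<Gamma>1 \<union> Range \<Gamma>1" and y: "y \<in> RN" and n: "n \<noteq> 0" "a \<in> C"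
        "of_int n * y = a + lin (shifted s) l" for n a l y C
      using chain_element[OF C(1,2) s(2,1) _ n(2,1,3) y] out C(3) linked_shifted[OF s(2)] by blast
    have "y \<in> E \<or> (\<exists>s\<in>set (s # ss). linked s y)" if y: "y \<in> RN" "y \<in> Domain (ext \<Gamma>1 P) \<union> Range (ext \<Gamma>1 P)" for y
    proof -
      have "y \<in> Domain \<Gamma>1 \<union> Range \<Gamma>1 \<or> linked s y" using y(2)
      proof
        assume "y \<in> Domain (ext \<Gamma>1 P)"
        then obtain x where "(y, x) \<in> ext \<Gamma>1 P" by blast
        then obtain n a b l where 2: "n \<noteq> 0" "(a, b) \<in> \<Gamma>1" "snd ` set l \<subseteq> P" "of_int n * y = a + lin fst l"
          by (rule extE)
        from pair_list[OF 2(3)[unfolded P_def chain_pairs_def]] obtain l' where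
          l': "lin fst l = lin (shifted s) l'" by blast
        show ?thesis
          using new[OF piso_psub_Domain[OF 1(2)] piso_good(1)[OF 1(2)] _ y(1) 2(1) _ 2(4)[unfolded l']] 2(2) by blast
      next
        assume "y \<in> Range (ext \<Gamma>1 P)"
        then obtain x where "(x, y) \<in> ext \<Gamma>1 P" by blast
        then obtain n a b l where 2: "n \<noteq> 0" "(a, b) \<in> \<Gamma>1" "snd ` set l \<subseteq> P" "of_int n * y = b + lin snd l"
          by (rule extE)
        from pair_list[OF 2(3)[unfolded P_def chain_pairs_def]] obtain l' where
          l': "lin snd l = lin (shifted s) l'" by blast
        show ?thesis
          using new[OF piso_psub_Range[OF 1(2)] piso_good(2)[OF 1(2)] _ y(1) 2(1) _ 2(4)[unfolded l']] 2(2) by blast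
      qed
      then show ?thesis using 1(5) y(1) by auto
    qed
    moreover have "countable (ext \<Gamma>1 P)" by (rule countable_ext) (simp_all add: 1 P_def chain_pairs_def)
    ultimately show ?thesis
      using 1(1,4) ext_base[of \<Gamma>1 P] piso' pairs by (intro exI[of _ "ext \<Gamma>1 P"]) auto
  qed
qed

lemma teq_params:
  assumes "tp M B xs = tp M B ys" "length xs = length ys" "set us \<subseteq> h ` B"
  shows "teq (map h xs @ us) (map h ys @ us)"
proof -
  have "us \<in> map h ` lists B" unfolding lists_image[symmetric] using assms(3) by auto
  then obtain bs where "us = map h bs" "bs \<in> lists B" by (rule imageE)
  then show ?thesis
    using tpN_eq_iff[of B "map h xs" "map h ys"] assms(1,2) by (simp add: tp_tpN)
qed

text \<open>A condition under which the type of \<open>a\<close> over \<open>C\<close> does not fork over \<open>B\<close>. The second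
  alternative includes the case that \<open>a\<close> is algebraic over \<open>B\<close>, with an empty list.\<close>

definition free_over :: "'m set \<Rightarrow> 'm set \<Rightarrow> 'm \<Rightarrow> bool" where
  "free_over B C a \<longleftrightarrow> generic (Acl (h ` C)) (h a) \<or>
    (\<exists>n b l. n \<noteq> 0 \<and> b \<in> Acl (h ` B) \<and> snd ` set l \<subseteq> RN - Acl (h ` C) \<and> of_int n * h a = b + lin id l)"

text \<open>The tuples \<open>c f i\<close> of a sequence witnessing that \<open>f\<close> divides have the type over \<open>B\<close> of
  the parameters of \<open>f\<close>, so there are partial isomorphisms \<open>\<Gamma> f i\<close> taking the latter to
  the former. Choose a conjugate \<open>a'\<close> of \<open>a\<close> that is independent of all of these. If \<open>a'\<close>
  is generic, then each \<open>\<Gamma> f i\<close> extends by \<open>(a', a')\<close>, and if \<open>f\<close> held at \<open>a'\<close>, so would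
  the whole dividing sequence. In the other case the members of \<open>R\<close> in the representation
  of \<open>a'\<close> are moved to new chains, which the extensions of \<open>\<Gamma> f i\<close> fix. Then \<open>a'\<close> is
  mapped to an element determined by the image of \<open>b\<close>. As \<open>b\<close> is algebraic over \<open>B\<close>, there
  are only finitely many images, and one of these satisfies infinitely many formulas of
  the sequence.\<close>

lemma avoid_dividing:
  assumes BC: "B \<subseteq> C" and free: "free_over B C a" and cs: "set cs \<subseteq> C"
    and \<Delta>: "finite \<Delta>" "\<And>f. f \<in> \<Delta> \<Longrightarrow> divides M 1 B f"
  obtains a' where "a' \<in> orbit (map h cs) (h a)" "\<And>f. f \<in> \<Delta> \<Longrightarrow> \<not> Nholds [a'] f"
proof -
  note result = that
  have "\<forall>f\<in>\<Delta>. \<exists>c k. f \<in> Forms 1 UNIV \<and> (\<forall>i. length (c i) = length (snd f) \<and> tp M B (c i) = tp M B (snd f)) \<and>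
    (\<forall>I :: nat set. finite I \<and> card I = k \<longrightarrow> \<not> (\<exists>xs. length xs = 1 \<and> (\<forall>i\<in>I. holds M xs (fst f, c i))))"
    using \<Delta>(2) unfolding divides_def by blast
  then obtain c k where "\<forall>f\<in>\<Delta>. f \<in> Forms 1 UNIV \<and> (\<forall>i. length (c f i) = length (snd f) \<and> tp M B (c f i) = tp M B (snd f)) \<and>
    (\<forall>I :: nat set. finite I \<and> card I = k f \<longrightarrow> \<not> (\<exists>xs. length xs = 1 \<and> (\<forall>i\<in>I. holds M xs (fst f, c f i))))"
    by metis
  then have c: "f \<in> Forms 1 UNIV" "\<And>i. length (c f i) = length (snd f)" "\<And>i. tp M B (c f i) = tp M B (snd f)"
    "\<And>I. finite I \<Longrightarrow> card I = k f \<Longrightarrow> \<not> (\<exists>xs. length xs = 1 \<and> (\<forall>i\<in>I. holds M xs (fst f, c f i)))"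
    if "f \<in> \<Delta>" for f using that by blast+
  \<comment> \<open>It suffices that if \<open>f\<close> holds at \<open>a'\<close>, then some element satisfies infinitely many formulas of the
    dividing sequence of \<open>f\<close>.\<close>
  have main: thesis if a': "a' \<in> orbit (map h cs) (h a)"
    and inf: "\<And>f. f \<in> \<Delta> \<Longrightarrow> Nholds [a'] f \<Longrightarrow> \<exists>a. infinite {i. Nholds [a] (fst f, c f i)}" for a'
  proof (rule result[OF a'])
    fix f assume f: "f \<in> \<Delta>"
    show "\<not> Nholds [a'] f"
    proof
      assume "Nholds [a'] f"
      from inf[OF f this] obtain a where "infinite {i. Nholds [a] (fst f, c f i)}" by blast
      with c(1,2,4)[OF f] show False by (rule dividing_sequence_bounded)
    qed
  qed
  have transfer: "Nholds [y] (fst f, c f i)"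
    if "piso \<Gamma>" "countable \<Gamma>" "(x, y) \<in> \<Gamma>" "set (zip (map h (snd f)) (map h (c f i))) \<subseteq> \<Gamma>" "f \<in> \<Delta>" "Nholds [x] f"
    for \<Gamma> x y f i
  proof -
    have "teq (x # map h (snd f)) (y # map h (c f i))"
      by (rule piso_teq_zip[OF that(1,2)]) (use that(3,4) c(2)[OF that(5)] in auto)
    then show ?thesis using that(6) Forms_D[OF c(1)[OF that(5)]] by (auto simp: teq_def Nholds_def)
  qed
  note Acl = psub_Acl[of "h ` C"] good_Acl[of "h ` C"] Acl_1[of "h ` C"]
  have csA: "set (map h cs) \<subseteq> Acl (h ` C)" using cs Acl_base[of "h ` C"] by auto
  have "countable \<Delta>" using \<Delta>(1) by (rule countable_finite)
  from free consider (gen) "generic (Acl (h ` C)) (h a)"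
    | (fin) n b l where "n \<noteq> 0" "b \<in> Acl (h ` B)" "snd ` set l \<subseteq> RN - Acl (h ` C)" "of_int n * h a = b + lin id l"
    unfolding free_over_def by blast
  then show thesis
  proof cases
    case gen
    have "\<exists>\<Gamma>. piso \<Gamma> \<and> countable \<Gamma> \<and> set (zip (map h (snd f)) (map h (c f i))) \<subseteq> \<Gamma>" if "f \<in> \<Delta>" for f i
    proof -
      have "teq (map h (snd f) @ []) (map h (c f i) @ [])"
        using c(2,3)[OF that, of i] by (intro teq_params[of B]) auto
      then show ?thesis using teq_piso_zip by (metis append_Nil2)
    qed
    then obtain \<Gamma> where \<Gamma>: "\<And>f i. f \<in> \<Delta> \<Longrightarrow> piso (\<Gamma> f i)" "\<And>f i. f \<in> \<Delta> \<Longrightarrow> countable (\<Gamma> f i)"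
      "\<And>f i. f \<in> \<Delta> \<Longrightarrow> set (zip (map h (snd f)) (map h (c f i))) \<subseteq> \<Gamma> f i" by metis
    have "countable (set (map h cs))" by (rule countable_finite) simp
    with csA obtain A where A: "set (map h cs) \<subseteq> A" "A \<subseteq> Acl (h ` C)" "psub A" "good A" "1 \<in> A" "countable A"
      by (rule countable_good_hull[OF Acl]) blast
    have "countable (A \<union> (\<Union>f\<in>\<Delta>. \<Union>i. Domain (\<Gamma> f i) \<union> Range (\<Gamma> f i)))"
      using A(6) \<Gamma>(2) \<open>countable \<Delta>\<close> by (auto simp: Domain_fst Range_snd)
    then obtain D where D: "A \<union> (\<Union>f\<in>\<Delta>. \<Union>i. Domain (\<Gamma> f i) \<union> Range (\<Gamma> f i)) \<subseteq> D" "psub D" "good D" "1 \<in> D" "countable D"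
      by (rule countable_good_hull[OF psub_UNIV good_UNIV UNIV_I subset_UNIV]) blast
    have Id: "piso (Id_on A)" "countable (Id_on A)" using piso_Id[OF A(3-5)] A(6) by (auto simp: Id_on_def)
    have "generic (Domain (Id_on A)) (h a)" using gen generic_mono[OF A(2)] by (simp add: Domain_Id_on)
    moreover have "Range (Id_on A) \<subseteq> D" using D(1) by auto
    ultimately obtain a' where a': "generic D a'" "piso (ext (Id_on A) {(h a, a')})"
      "countable (ext (Id_on A) {(h a, a')})" "(h a, a') \<in> ext (Id_on A) {(h a, a')}"
      using forth_generic[OF Id _ D(2-5)] by blast
    show thesis
    proof (rule main)
      show "a' \<in> orbit (map h cs) (h a)"
        by (rule orbitI[OF a'(2-4)]) (use A(1) ext_base in blast)
      fix f assume f: "f \<in> \<Delta>" and holds: "Nholds [a'] f"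
      have "Nholds [a'] (fst f, c f i)" for i
      proof -
        have "Domain (\<Gamma> f i) \<subseteq> D" "Range (\<Gamma> f i) \<subseteq> D" using D(1) f by fast+
        then have "generic (Domain (\<Gamma> f i)) a'" "generic (Range (\<Gamma> f i)) a'"
          using a'(1) generic_mono by blast+
        then have "piso (ext (\<Gamma> f i) {(a', a')})" by (intro piso_generic \<Gamma> f) auto
        then show ?thesis
          by (rule transfer[OF _ countable_ext[OF \<Gamma>(2)[OF f]] _ _ f holds])
            (use ext_new[OF \<Gamma>(1)[OF f]] ext_base \<Gamma>(3)[OF f] in blast)+
      qed
      then show "\<exists>a. infinite {i. Nholds [a] (fst f, c f i)}" by (intro exI[of _ a']) simp
    qed
  next
    case fin
    obtain us where us: "set us \<subseteq> h ` B" "finite (orbit us b)" using fin(2) by (rule AclE)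
    have "\<exists>\<Gamma> b'. piso \<Gamma> \<and> countable \<Gamma> \<and> set (zip (map h (snd f)) (map h (c f i))) \<subseteq> \<Gamma> \<and> (b, b') \<in> \<Gamma> \<and> b' \<in> orbit us b"
      if f: "f \<in> \<Delta>" for f i
    proof -
      obtain \<Gamma>0 where G0: "piso \<Gamma>0" "countable \<Gamma>0" "set (zip (map h (snd f) @ us) (map h (c f i) @ us)) \<subseteq> \<Gamma>0"
      proof -
        have "teq (map h (snd f) @ us) (map h (c f i) @ us)"
          using c(2,3)[OF f, of i] us(1) by (intro teq_params[of B]) auto
        then show thesis using teq_piso_zip that by metis
      qed
      obtain \<Gamma> b' where G: "\<Gamma>0 \<subseteq> \<Gamma>" "piso \<Gamma>" "countable \<Gamma>" "(b, b') \<in> \<Gamma>"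
        using forth[OF G0(1,2), of b] by blast
      have zip: "set (zip (map h (snd f)) (map h (c f i))) \<subseteq> \<Gamma>" "set (zip us us) \<subseteq> \<Gamma>"
        using G0(3) G(1) c(2)[OF f, of i] by (auto simp: zip_append)
      have "(u, u) \<in> \<Gamma>" if "u \<in> set us" for u using zip(2) that zip_same[of u u us] by auto
      then have "b' \<in> orbit us b" by (intro orbitI[OF G(2-4)])
      then show ?thesis using G zip(1) by blast
    qed
    then obtain \<Gamma> b' where \<Gamma>: "\<And>f i. f \<in> \<Delta> \<Longrightarrow> piso (\<Gamma> f i)" "\<And>f i. f \<in> \<Delta> \<Longrightarrow> countable (\<Gamma> f i)"
      "\<And>f i. f \<in> \<Delta> \<Longrightarrow> set (zip (map h (snd f)) (map h (c f i))) \<subseteq> \<Gamma> f i"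
      "\<And>f i. f \<in> \<Delta> \<Longrightarrow> (b, b' f i) \<in> \<Gamma> f i" "\<And>f i. f \<in> \<Delta> \<Longrightarrow> b' f i \<in> orbit us b" by metis
    have "insert b (set (map h cs)) \<subseteq> Acl (h ` C)"
      using csA fin(2) Acl_mono[of "h ` B" "h ` C"] BC by auto
    moreover have "countable (insert b (set (map h cs)))" by (rule countable_finite) simp
    ultimately obtain A where A: "insert b (set (map h cs)) \<subseteq> A" "A \<subseteq> Acl (h ` C)" "psub A" "good A" "1 \<in> A" "countable A"
      by (rule countable_good_hull[OF Acl]) blast
    define E where "E = A \<union> (\<Union>f\<in>\<Delta>. \<Union>i. Domain (\<Gamma> f i) \<union> Range (\<Gamma> f i))"
    have E: "countable E"
      using A(6) \<Gamma>(2) \<open>countable \<Delta>\<close> by (auto simp: E_def Domain_fst Range_snd)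
    have Id: "piso (Id_on A)" "countable (Id_on A)" using piso_Id[OF A(3-5)] A(6) by (auto simp: Id_on_def)
    have "set (map snd l) \<subseteq> RN" using fin(3) by auto
    from forth_RN_list[OF Id this E] obtain \<Theta> where T: "Id_on A \<subseteq> \<Theta>" "piso \<Theta>" "countable \<Theta>"
      "set (map snd l) \<subseteq> Domain \<Theta>" "\<forall>y\<in>RN \<inter> Range \<Theta>. y \<in> A \<or> nonstandard y \<and> (\<forall>k. shifted y k \<notin> E)" by auto
    have "\<forall>t\<in>snd ` set l. \<exists>y. (t, y) \<in> \<Theta>" using T(4) by auto
    then obtain g where g: "\<And>t. t \<in> snd ` set l \<Longrightarrow> (t, g t) \<in> \<Theta>" by metis
    have gR: "g t \<in> RN \<and> nonstandard (g t) \<and> (\<forall>k. shifted (g t) k \<notin> E)" if t: "t \<in> snd ` set l" for t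
    proof -
      have "g t \<in> RN" using piso_RN[OF T(2) g[OF t]] fin(3) t by blast
      moreover have "g t \<notin> A"
      proof
        assume "g t \<in> A"
        then have "(g t, g t) \<in> \<Theta>" using T(1) by auto
        then have "t = g t" using piso_inj[OF T(2) g[OF t]] by simp
        then show False using \<open>g t \<in> A\<close> A(2) fin(3) t by auto
      qed
      ultimately show ?thesis using T(5) g[OF t] by blast
    qed
    have bb: "(b, b) \<in> \<Theta>" using T(1) A(1) by auto
    have "(lin id l, lin g l) \<in> \<Theta>" by (rule piso_lin[OF T(2)]) (simp add: g)
    then have na: "(of_int n * h a, b + lin g l) \<in> \<Theta>" unfolding fin(4) by (rule piso_add[OF T(2) bb])
    then have "h a \<in> Domain \<Theta>" using psub_pure[OF piso_psub_Domain[OF T(2)] fin(1)] by blast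
    then obtain a' where a': "(h a, a') \<in> \<Theta>" by blast
    have na': "of_int n * a' = b + lin g l"
      using piso_fun[OF T(2) piso_mult[OF T(2) a'] na] .
    show thesis
    proof (rule main)
      show "a' \<in> orbit (map h cs) (h a)"
        by (rule orbitI[OF T(2,3) a']) (use T(1) A(1) in auto)
      fix f assume f: "f \<in> \<Delta>" and holds: "Nholds [a'] f"
      have "\<exists>y. of_int n * y = b' f i + lin g l \<and> Nholds [y] (fst f, c f i)" for i
      proof -
        have "Domain (\<Gamma> f i) \<union> Range (\<Gamma> f i) \<subseteq> E" using f by (auto simp: E_def)
        note fixed = piso_fix_chains[OF \<Gamma>(1,2)[OF f] this, of "map (g \<circ> snd) l"]
        have gs: "\<forall>s\<in>set (map (g \<circ> snd) l). s \<in> RN \<and> nonstandard s \<and> (\<forall>k. shifted s k \<notin> E)"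
          using gR by fastforce
        from fixed[OF gs] obtain \<Gamma>' where G: "\<Gamma> f i \<subseteq> \<Gamma>'" "piso \<Gamma>'" "countable \<Gamma>'"
          "\<forall>s\<in>set (map (g \<circ> snd) l). \<forall>k. (shifted s k, shifted s k) \<in> \<Gamma>'"
          by (elim exE conjE)
        have "(g t, g t) \<in> \<Gamma>'" if t: "t \<in> snd ` set l" for t
        proof -
          have "g t \<in> set (map (g \<circ> snd) l)" using t by auto
          then have "(shifted (g t) 0, shifted (g t) 0) \<in> \<Gamma>'" using G(4) by blast
          then show ?thesis using gR[OF t] by simp
        qed
        then have "(lin g l, lin g l) \<in> \<Gamma>'" by (intro piso_lin[OF G(2)])
        moreover have "(b, b' f i) \<in> \<Gamma>'" using \<Gamma>(4)[OF f] G(1) by blast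
        ultimately have na: "(of_int n * a', b' f i + lin g l) \<in> \<Gamma>'"
          unfolding na' by (intro piso_add[OF G(2)])
        then have "a' \<in> Domain \<Gamma>'" using psub_pure[OF piso_psub_Domain[OF G(2)] fin(1)] by blast
        then obtain y where y: "(a', y) \<in> \<Gamma>'" by blast
        have "of_int n * y = b' f i + lin g l" using piso_fun[OF G(2) piso_mult[OF G(2) y] na] .
        moreover have "Nholds [y] (fst f, c f i)"
          by (rule transfer[OF G(2,3) y _ f holds]) (use \<Gamma>(3)[OF f] G(1) in blast)
        ultimately show ?thesis by blast
      qed
      then obtain y where y: "\<And>i. of_int n * y i = b' f i + lin g l" "\<And>i. Nholds [y i] (fst f, c f i)" by metis
      have "finite (range (b' f))" using us(2) by (rule rev_finite_subset) (use \<Gamma>(5)[OF f] in auto)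
      then obtain i0 where i0: "infinite {i. b' f i = b' f i0}"
        using pigeonhole_infinite[of UNIV "b' f"] by auto
      have "Nholds [y i0] (fst f, c f i)" if "b' f i = b' f i0" for i
      proof -
        have "of_int n * y i = of_int n * y i0" using y(1) that by simp
        then have "y i = y i0" using fin(1) by simp
        then show ?thesis using y(2)[of i] by simp
      qed
      then have "infinite {i. Nholds [y i0] (fst f, c f i)}"
        using i0 by (rule_tac infinite_super[of "{i. b' f i = b' f i0}"]) auto
      then show "\<exists>a. infinite {i. Nholds [a] (fst f, c f i)}" by blast
    qed
  qed
qed

lemma monster_infinite:
  assumes "monster \<kappa> M" shows "\<not> finite (Field \<kappa>)"
proof -
  have \<kappa>: "Card_order \<kappa>" "natLeq <o \<kappa>" using assms by (auto simp: monster_def)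
  have "natLeq \<le>o \<kappa>" using \<kappa>(2) by (rule ordLess_imp_ordLeq)
  also have "\<kappa> =o |Field \<kappa>|" using card_of_Field_ordIso[OF \<kappa>(1)] by (rule ordIso_symmetric)
  finally show ?thesis using infinite_iff_natLeq_ordLeq[of "Field \<kappa>"] by blast
qed

text \<open>If the type of \<open>a\<close> over \<open>C\<close> implied a finite disjunction of formulas that divide over
  \<open>B\<close>, then by \<open>avoid_dividing\<close> the type together with the negations of these formulas
  would be finitely satisfiable, and realized in the saturated model.\<close>

theorem free_not_forks:
  assumes mon: "monster \<kappa> M" and BC: "B \<subseteq> C" "|C| <o \<kappa>" and free: "free_over B C a"
  shows "\<not> forks M 1 B (tp M C [a])"
proof
  assume "forks M 1 B (tp M C [a])"
  then obtain \<Delta> where \<Delta>: "finite \<Delta>" "\<And>f. f \<in> \<Delta> \<Longrightarrow> divides M 1 B f"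
    "\<And>xs. length xs = 1 \<Longrightarrow> (\<forall>f\<in>tp M C [a]. holds M xs f) \<Longrightarrow> \<exists>d\<in>\<Delta>. holds M xs d"
    unfolding forks_def by blast
  have \<Delta>F: "f \<in> Forms 1 UNIV" if "f \<in> \<Delta>" for f using \<Delta>(2)[OF that] by (simp add: divides_def)
  define neg where "neg = (\<lambda>(\<phi>, bs :: 'm list). (Neg \<phi>, bs))"
  define \<Phi> where "\<Phi> = tp M C [a] \<union> neg ` \<Delta>"
  have negF: "f \<in> Forms 1 UNIV" if "f \<in> neg ` \<Delta>" for f
    using that \<Delta>F by (fastforce simp: neg_def Forms_def)
  have \<Phi>F: "\<Phi> \<subseteq> Forms 1 UNIV" using negF Forms_mono[of C UNIV 1] by (auto simp: \<Phi>_def tp_def)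
  have "finitely_sat M 1 \<Phi>" unfolding finitely_sat_def
  proof (intro allI impI)
    fix \<Psi> assume \<Psi>: "finite \<Psi> \<and> \<Psi> \<subseteq> \<Phi>"
    have "finite (\<Union>f\<in>\<Psi> \<inter> tp M C [a]. set (snd f))" using \<Psi> by auto
    from finite_list[OF this] obtain cs where cs: "set cs = (\<Union>f\<in>\<Psi> \<inter> tp M C [a]. set (snd f))"
      by (elim exE)
    have "set cs \<subseteq> C" unfolding cs using Forms_set by (fastforce simp: tp_def)
    from avoid_dividing[OF BC(1) free this \<Delta>(1,2)] obtain a' where
      a': "a' \<in> orbit (map h cs) (h a)" "\<And>f. f \<in> \<Delta> \<Longrightarrow> \<not> Nholds [a'] f" by blast
    from a'(1) obtain \<Gamma> where G: "piso \<Gamma>" "countable \<Gamma>" "(h a, a') \<in> \<Gamma>" "\<And>u. u \<in> set (map h cs) \<Longrightarrow> (u, u) \<in> \<Gamma>"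
      by (rule orbitE) blast
    have "Nholds [a'] f" if f: "f \<in> \<Psi>" for f
    proof (cases "f \<in> tp M C [a]")
      case True
      have "teq (h a # map h (snd f)) (a' # map h (snd f))"
      proof (rule piso_teq_zip[OF G(1,2)])
        have "(u, u) \<in> \<Gamma>" if "u \<in> set (map h (snd f))" for u
          by (rule G(4)) (use that True f cs in auto)
        then show "set (zip (h a # map h (snd f)) (a' # map h (snd f))) \<subseteq> \<Gamma>"
          using G(3) by (auto simp: zip_same)
      qed simp
      moreover have "f \<in> Forms 1 C" "Nholds [h a] f" using True by (auto simp: tp_tpN tpN_def)
      ultimately show ?thesis using Nholds_teq[of "[h a]" "snd f" "[a']" "fst f" C] by simp
    next
      case False
      then obtain d where "d \<in> \<Delta>" "f = neg d" using f \<Psi> by (auto simp: \<Phi>_def)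
      then show ?thesis using a'(2)[of d] by (cases d) (simp add: neg_def Nholds_Neg)
    qed
    then show "\<exists>xs. length xs = 1 \<and> (\<forall>f\<in>\<Psi>. holds M xs f)"
      by (intro reflect[of \<Psi> 1 "[a']"]) (use \<Psi> \<Phi>F in auto)
  qed
  from realize[OF this \<Phi>F] obtain xs where xs: "length xs = 1" "\<forall>f\<in>\<Phi>. Nholds xs f"
    unfolding Nholds_def case_prod_unfold by blast
  \<comment> \<open>The realization in \<open>N\<close> is replaced by one in \<open>M\<close>, by saturation of \<open>M\<close> over the small set \<open>D\<close> of
    parameters.\<close>
  define D where "D = C \<union> (\<Union>f\<in>\<Delta>. set (snd f))"
  have \<kappa>: "Card_order \<kappa>" "natLeq <o \<kappa>" "saturated \<kappa> M" using mon by (auto simp: monster_def)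
  note inf = monster_infinite[OF mon]
  have "|\<Union>f\<in>\<Delta>. set (snd f)| <o natLeq" using \<Delta>(1) by (intro finite_iff_ordLess_natLeq[THEN iffD1]) auto
  then have "|\<Union>f\<in>\<Delta>. set (snd f)| <o \<kappa>" using \<kappa>(2) ordLess_transitive by blast
  then have "|D| <o \<kappa>" unfolding D_def using card_of_Un_ordLess_infinite_Field[OF inf \<kappa>(1) BC(2)] by blast
  moreover have "tpN D xs \<in> types M 1 D" using tpN_types[of D xs] xs(1) by simp
  ultimately obtain ys where ys: "length ys = 1" "\<And>f. f \<in> tpN D xs \<Longrightarrow> holds M ys f"
    using \<kappa>(3) unfolding saturated_def by blast
  have inD: "f \<in> Forms 1 D" if "f \<in> \<Phi>" for f
  proof -
    have "set (snd f) \<subseteq> D" using that Forms_set[of f 1 C] by (auto simp: \<Phi>_def tp_def D_def neg_def)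
    then show ?thesis using that \<Phi>F by (auto simp: Forms_def)
  qed
  have "holds M ys f" if "f \<in> \<Phi>" for f
    using ys(2)[of f] inD[OF that] xs that by (simp add: tpN_def)
  then have "\<forall>f\<in>tp M C [a]. holds M ys f" and neg: "\<And>d. d \<in> \<Delta> \<Longrightarrow> holds M ys (neg d)"
    unfolding \<Phi>_def by blast+
  then obtain d where d: "d \<in> \<Delta>" "holds M ys d" using \<Delta>(3)[OF ys(1)] by blast
  then show False using neg[OF d(1)] by (cases d) (simp add: neg_def holds_def)
qed

end

section \<open>Finite ranks and chains of forking extensions\<close>

lemma natLeq_on_ordLess_Suc: "natLeq_on m <o natLeq_on (Suc m)"
proof -
  have "Restr (natLeq_on (Suc m)) (underS (natLeq_on (Suc m)) m) = natLeq_on m"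
    by (auto simp: underS_def)
  moreover have "Field (natLeq_on (Suc m)) \<noteq> {}" by (auto simp: Field_natLeq_on)
  ultimately show ?thesis using underS_Restr_ordLess[OF natLeq_on_Well_order, of "Suc m" m] by simp
qed

lemma natLeq_on_ordLess_natLeq: "natLeq_on m <o natLeq"
  using underS_Restr_ordLess[OF natLeq_Well_order, of m]
  by (simp add: Restr_natLeq2 Field_natLeq)

text \<open>For a finite ordinal the recursive definition of the rank unfolds into a chain of
  forking extensions.\<close>

lemma U_ge_chain:
  assumes "U_ge \<kappa> M (natLeq_on m) A p"
  shows "\<exists>As ps. As 0 = A \<and> ps 0 = p \<and> (\<forall>j<m. forking_ext \<kappa> M (As j) (ps j) (As (Suc j)) (ps (Suc j)))"
  using assms
proof (induction m arbitrary: A p)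
  case 0
  then show ?case by (intro exI[of _ "\<lambda>_. A"] exI[of _ "\<lambda>_. p"]) simp
next
  case (Suc m)
  have "\<exists>B q. forking_ext \<kappa> M A p B q \<and> U_ge \<kappa> M (natLeq_on m) B q"
    using Suc.prems by (rule U_ge.cases) (use natLeq_on_ordLess_Suc[of m] in blast)
  then obtain B q where B: "forking_ext \<kappa> M A p B q" "U_ge \<kappa> M (natLeq_on m) B q" by blast
  from Suc.IH[OF B(2)] obtain As ps where "As 0 = B" "ps 0 = q"
    "\<forall>j<m. forking_ext \<kappa> M (As j) (ps j) (As (Suc j)) (ps (Suc j))" by blast
  then show ?case using B(1)
    by (intro exI[of _ "case_nat A As"] exI[of _ "case_nat p ps"]) (auto simp: less_Suc_eq_0_disj)
qed

lemma ordLess_natLeq_onE: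
  assumes "\<beta> <o natLeq_on m"
  obtains a where "a < m" "\<beta> =o natLeq_on a"
proof -
  have "Well_order \<beta>" using assms by (auto simp: ordLess_def)
  then obtain a where a: "a \<in> Field (natLeq_on m)" "\<beta> =o Restr (natLeq_on m) (underS (natLeq_on m) a)"
    using assms ordLess_iff_ordIso_Restr[OF natLeq_on_Well_order] by blast
  then have am: "a < m" by (simp add: Field_natLeq_on)
  then have "Restr (natLeq_on m) (underS (natLeq_on m) a) = natLeq_on a" by (auto simp: underS_def)
  then show thesis using that[OF am] a(2) by simp
qed

lemma ordLess_natLeqE:
  assumes "\<beta> <o natLeq"
  obtains a where "\<beta> =o natLeq_on a"
proof -
  have "Well_order \<beta>" using assms by (auto simp: ordLess_def)
  then obtain a where "\<beta> =o Restr natLeq (underS natLeq a)"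
    using assms ordLess_iff_ordIso_Restr[OF natLeq_Well_order] by blast
  then show thesis using that by (simp add: Restr_natLeq2)
qed

text \<open>Only the order type matters: a well-order below \<open>natLeq_on a\<close> is isomorphic to some
  \<open>natLeq_on a'\<close>.\<close>

lemma chain_U_ge:
  fixes \<beta> :: "nat rel"
  assumes chain: "\<And>j. j < m \<Longrightarrow> forking_ext \<kappa> M (As j) (ps j) (As (Suc j)) (ps (Suc j))"
    and "j + a \<le> m" "\<beta> =o natLeq_on a"
  shows "U_ge \<kappa> M \<beta> (As j) (ps j)"
  using assms(2,3)
proof (induction a arbitrary: j \<beta> rule: less_induct)
  case (less a)
  show ?case
  proof (rule U_ge.intros)
    fix \<gamma> :: "nat rel" assume "\<gamma> <o \<beta>"
    then have "\<gamma> <o natLeq_on a" using less.prems(2) ordLess_ordIso_trans by blast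
    then obtain a' where a': "a' < a" "\<gamma> =o natLeq_on a'" by (rule ordLess_natLeq_onE)
    have "U_ge \<kappa> M \<gamma> (As (Suc j)) (ps (Suc j))"
      using less.IH[OF a'(1) _ a'(2), of "Suc j"] less.prems(1) a'(1) by simp
    then show "\<exists>B q. forking_ext \<kappa> M (As j) (ps j) B q \<and> U_ge \<kappa> M \<gamma> B q"
      using chain[of j] less.prems(1) a'(1) by (intro exI conjI) auto
  qed
qed


section \<open>The upper bound for the rank\<close>

context embedded_model
begin

lemma monster_realize:
  assumes "monster \<kappa> M" "|B| <o \<kappa>" "p \<in> types M 1 B"
  obtains a where "p = tp M B [a]"
proof -
  obtain xs where xs: "length xs = 1" "\<forall>f\<in>p. holds M xs f"
    using assms unfolding monster_def saturated_def by blast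
  then have "p = tp M B xs" using types_eq_tp[OF assms(3)] by blast
  moreover obtain a where "xs = [a]" using xs(1) by (auto simp: length_Suc_conv)
  ultimately show thesis using that by blast
qed

lemma Acl_orbit:
  assumes "set us \<subseteq> X" "finite (orbit us b)" "b' \<in> orbit us b"
  shows "b' \<in> Acl X"
proof (rule AclI[OF assms(1)])
  have "orbit us b' \<subseteq> orbit us b" using assms(3) by (auto simp: orbit_def intro: teq_trans)
  then show "finite (orbit us b')" using assms(2) finite_subset by blast
qed

text \<open>As long as the same members of \<open>R\<close> in the representation are algebraic over \<open>Bs j\<close> and
  over \<open>Bs (Suc j)\<close>, the type does not fork by \<open>free_not_forks\<close>. So the number of these
  members that are algebraic increases in each step.\<close>

lemma forking_chain_bounded:
  assumes mon: "monster \<kappa> M"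
    and rep: "n \<noteq> 0" "b \<in> Acl (h ` Bs 0)" "snd ` set l \<subseteq> RN" "of_int n * h a = b + lin id l"
    and chain: "\<And>j. j < m \<Longrightarrow> Bs j \<subseteq> Bs (Suc j) \<and> |Bs (Suc j)| <o \<kappa> \<and> forks M 1 (Bs j) (tp M (Bs (Suc j)) [a])"
  shows "m \<le> length l"
proof -
  define J where "J j = {e. e < length l \<and> snd (l ! e) \<in> Acl (h ` Bs j)}" for j
  have mono: "Acl (h ` Bs j) \<subseteq> Acl (h ` Bs (Suc j))" if "j < m" for j
    using chain[OF that] by (intro Acl_mono) auto
  have b: "b \<in> Acl (h ` Bs j)" if "j \<le> m" for j
    using that by (induction j) (use rep(2) mono in \<open>auto simp: Suc_le_eq\<close>)
  have strict: "J j \<subset> J (Suc j)" if j: "j < m" for j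
  proof -
    have "J j \<subseteq> J (Suc j)" using mono[OF j] by (auto simp: J_def)
    moreover have "J j \<noteq> J (Suc j)"
    proof
      assume eq: "J j = J (Suc j)"
      let ?A = "Acl (h ` Bs j)" and ?A' = "Acl (h ` Bs (Suc j))"
      have eq': "z \<in> ?A' \<Longrightarrow> z \<in> ?A" if "z \<in> snd ` set l" for z
      proof -
        assume z: "z \<in> ?A'"
        obtain p where "p \<in> set l" "z = snd p" using \<open>z \<in> snd ` set l\<close> by auto
        then obtain e where "e < length l" "z = snd (l ! e)" by (auto simp: in_set_conv_nth)
        then have "e \<in> J (Suc j)" using z by (simp add: J_def)
        then show "z \<in> ?A" unfolding eq[symmetric] using \<open>z = snd (l ! e)\<close> by (simp add: J_def)
      qed
      have "of_int n * h a = (b + lin id (filter (\<lambda>p. snd p \<in> ?A) l)) + lin id (filter (\<lambda>p. snd p \<notin> ?A) l)"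
        using rep(4) lin_filter[of id l "\<lambda>p. snd p \<in> ?A"] by simp
      moreover have "b + lin id (filter (\<lambda>p. snd p \<in> ?A) l) \<in> ?A"
        by (intro psub_add[OF psub_Acl] b psub_lin[OF psub_Acl]) (use j in auto)
      moreover have "snd ` set (filter (\<lambda>p. snd p \<notin> ?A) l) \<subseteq> RN - ?A'"
        using rep(3) eq' by auto
      ultimately have "free_over (Bs j) (Bs (Suc j)) a" unfolding free_over_def using rep(1) by blast
      then show False using free_not_forks[OF mon, of "Bs j" "Bs (Suc j)" a] chain[OF j] by blast
    qed
    ultimately show ?thesis by blast
  qed
  have fin: "finite (J j)" for j by (simp add: J_def)
  have "j \<le> card (J j)" if "j \<le> m" for j
    using that
  proof (induction j)
    case (Suc j)
    then have "card (J j) < card (J (Suc j))" by (intro psubset_card_mono fin strict) simp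
    then show ?case using Suc by simp
  qed simp
  then have "m \<le> card (J m)" by simp
  also have "\<dots> \<le> card {..<length l}" by (intro card_mono) (auto simp: J_def)
  finally show ?thesis by simp
qed

text \<open>After the first forking extension \<open>a\<close> is not generic over the algebraic closure of the
  parameters, hence has a representation with \<open>length l\<close> members of \<open>R\<close>. A chain of
  \<open>length l + 1\<close> further forking extensions contradicts \<open>forking_chain_bounded\<close>. The
  realizations of the types in the chain vary with the chain, so the representation is
  transported from \<open>a0\<close>, chosen before the chain, to a realization \<open>a\<close> of the whole chain;
  the transport preserves the length.\<close>

theorem not_U_gt_omega:
  assumes mon: "monster \<kappa> M"
  shows "\<not> U_gt \<kappa> M natLeq {} p"
proof
  assume "U_gt \<kappa> M natLeq {} p"
  then obtain B q where B: "forking_ext \<kappa> M {} p B q" "U_ge \<kappa> M natLeq B q"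
    by (auto simp: U_gt_def)
  then have Bq: "|B| <o \<kappa>" "q \<in> types M 1 B" "forks M 1 {} q" by (auto simp: forking_ext_def)
  obtain a0 where a0: "q = tp M B [a0]" using monster_realize[OF mon Bq(1,2)] by blast
  have "\<not> free_over {} B a0" using free_not_forks[OF mon _ Bq(1), of "{}" a0] Bq(3) a0 by auto
  then have "\<not> generic (Acl (h ` B)) (h a0)" by (simp add: free_over_def)
  then obtain n b l where rep: "n \<noteq> 0" "b \<in> Acl (h ` B)" "snd ` set l \<subseteq> RN" "of_int n * h a0 = b + lin id l"
    by (auto simp: generic_def)
  obtain us where us: "set us \<subseteq> h ` B" "finite (orbit us b)" using rep(2) by (rule AclE)
  define m where "m = Suc (length l)"
  have "\<exists>B' q'. forking_ext \<kappa> M B q B' q' \<and> U_ge \<kappa> M (natLeq_on m) B' q'"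
    using B(2) by (rule U_ge.cases) (use natLeq_on_ordLess_natLeq[of m] in blast)
  then obtain B' q' where "forking_ext \<kappa> M B q B' q'" "U_ge \<kappa> M (natLeq_on m) B' q'" by blast
  from this(1) U_ge_chain[OF this(2)] obtain Bs ps where
    first: "forking_ext \<kappa> M B q (Bs 0) (ps 0)" and
    rest: "\<And>j. j < m \<Longrightarrow> forking_ext \<kappa> M (Bs j) (ps j) (Bs (Suc j)) (ps (Suc j))" by blast
  have sub: "B \<subseteq> Bs 0" "q \<subseteq> ps 0" using first by (auto simp: forking_ext_def)
  have types: "|Bs j| <o \<kappa> \<and> ps j \<in> types M 1 (Bs j)" if "j \<le> m" for j
    using that first rest[of "j - 1"] by (cases j) (auto simp: forking_ext_def)
  obtain a where a: "ps m = tp M (Bs m) [a]" using monster_realize[OF mon] types[of m] by blast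
  have up: "ps j \<subseteq> ps m" if "j \<le> m" for j
    using that
  proof (induction rule: inc_induct)
    case (step j)
    then show ?case using rest[of j] by (auto simp: forking_ext_def)
  qed simp
  have psa: "ps j = tp M (Bs j) [a]" if "j \<le> m" for j
    by (rule types_eq_tp) (use types[OF that] up[OF that] a in \<open>auto simp: tp_def\<close>)
  have "q = tp M B [a]"
    by (rule types_eq_tp[OF Bq(2)]) (use sub(2) up[of 0] a in \<open>auto simp: tp_def\<close>)
  then have "tp M B [a0] = tp M B [a]" using a0 by simp
  then have "teq (map h [a0] @ us) (map h [a] @ us)" by (rule teq_params) (use us in auto)
  then have "h a \<in> orbit us (h a0)" by (simp add: orbit_def)
  then obtain \<Gamma> where G: "piso \<Gamma>" "countable \<Gamma>" "(h a0, h a) \<in> \<Gamma>" "\<And>u. u \<in> set us \<Longrightarrow> (u, u) \<in> \<Gamma>"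
    by (rule orbitE) blast
  obtain \<Gamma>1 where G1: "\<Gamma> \<subseteq> \<Gamma>1" "piso \<Gamma>1" "countable \<Gamma>1" "b \<in> Domain \<Gamma>1" using forth[OF G(1,2), of b] by blast
  obtain b' where b': "(b, b') \<in> \<Gamma>1" using G1(4) by blast
  have "set (map snd l) \<subseteq> RN" using rep(3) by auto
  from forth_RN_list[OF G1(2,3) this, of "{}"] obtain \<Gamma>2 where
    G2: "\<Gamma>1 \<subseteq> \<Gamma>2" "piso \<Gamma>2" "set (map snd l) \<subseteq> Domain \<Gamma>2" by auto
  have "\<forall>t\<in>snd ` set l. \<exists>y. (t, y) \<in> \<Gamma>2" using G2(3) by auto
  then obtain g where g: "\<And>t. t \<in> snd ` set l \<Longrightarrow> (t, g t) \<in> \<Gamma>2" by metis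
  define l' where "l' = map (\<lambda>(c, t). (c, g t)) l"
  have "(lin id l, lin g l) \<in> \<Gamma>2" by (rule piso_lin[OF G2(2)]) (simp add: g)
  moreover have "(b, b') \<in> \<Gamma>2" using b' G2(1) by blast
  ultimately have "(of_int n * h a0, b' + lin g l) \<in> \<Gamma>2" unfolding rep(4) by (intro piso_add[OF G2(2)])
  moreover have "(of_int n * h a0, of_int n * h a) \<in> \<Gamma>2"
    by (rule piso_mult[OF G2(2)]) (use G(3) G1(1) G2(1) in blast)
  ultimately have rep': "of_int n * h a = b' + lin id l'"
    using piso_fun[OF G2(2)] by (simp add: l'_def lin_id_map)
  have l'R: "snd ` set l' \<subseteq> RN" using piso_RN[OF G2(2) g] rep(3) by (force simp: l'_def)
  have "b' \<in> orbit us b" by (rule orbitI[OF G1(2,3) b']) (use G(4) G1(1) in blast)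
  then have "b' \<in> Acl (h ` B)" by (rule Acl_orbit[OF us])
  then have "b' \<in> Acl (h ` Bs 0)" using Acl_mono[of "h ` B" "h ` Bs 0"] sub(1) by blast
  then have "m \<le> length l'"
  proof (rule forking_chain_bounded[OF mon rep(1) _ l'R rep'])
    fix j assume "j < m"
    then show "Bs j \<subseteq> Bs (Suc j) \<and> |Bs (Suc j)| <o \<kappa> \<and> forks M 1 (Bs j) (tp M (Bs (Suc j)) [a])"
      using rest[of j] psa[of "Suc j"] by (auto simp: forking_ext_def)
  qed
  then show False by (simp add: m_def l'_def)
qed

end

section \<open>The lower bound for the rank\<close>

context regular_sequence
begin

text \<open>By independence of the chains, any set of chains generates a good subgroup, with no
  members of \<open>R\<close> besides these chains.\<close>

lemma good_chains:
  fixes Q :: "'a hyp \<Rightarrow> bool"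
  assumes Q: "\<forall>x y. linked x y \<longrightarrow> Q x \<longrightarrow> Q y" and std: "\<forall>t. \<not> nonstandard t \<longrightarrow> Q t"
  defines "A \<equiv> qspan {t \<in> RN. Q t}"
  shows "psub A" "good A" "1 \<in> A" "\<And>t. t \<in> RN \<Longrightarrow> t \<in> A \<longleftrightarrow> Q t"
proof -
  let ?S = "{t \<in> RN. Q t}"
  have key: "lin id u = 0" if u: "snd ` set u \<subseteq> RN" "\<And>t. t \<in> snd ` set u \<Longrightarrow> \<not> Q t" "lin id u \<in> A" for u
  proof -
    from u(3) obtain m v where v: "m \<noteq> 0" "snd ` set v \<subseteq> ?S" "of_int m * lin id u = lin id v"
      unfolding A_def by (rule qspanE)
    define L where "L = scale m u @ scale (- 1) v"
    have "lin id (filter (\<lambda>p. Q (snd p)) L) = 0"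
    proof (rule lin_chains)
      show "snd ` set L \<subseteq> RN" unfolding L_def snd_append snd_scale using u v by blast
      show "lin id L = 0" using v by (simp add: L_def)
    qed (use Q in blast)
    moreover have "filter (\<lambda>p. Q (snd p)) (scale m u) = []"
      unfolding filter_empty_conv using u(2) snd_scale[of m u] by (metis image_eqI)
    moreover have "filter (\<lambda>p. Q (snd p)) (scale (- 1) v) = scale (- 1) v"
    proof (rule filter_True, rule ballI)
      fix p assume "p \<in> set (scale (- 1) v)"
      then have "snd p \<in> snd ` set v" unfolding snd_scale[of "- 1" v, symmetric] by (rule imageI)
      then show "Q (snd p)" using v(2) by blast
    qed
    ultimately have "lin id v = 0" by (simp add: L_def)
    then show ?thesis using v by simp
  qed
  have SA: "?S \<subseteq> A" unfolding A_def by (rule qspan_base)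
  show "psub A" unfolding A_def by (rule psub_qspan)
  show "good A" unfolding good_def
    using key SA by blast
  have "of_nat (r 1) \<in> ?S" using std_RN[of 1] std_iff[OF std_RN[of 1]] std by auto
  then show "1 \<in> A"
    unfolding A_def using r_pos[of 1] by (intro qspanI[of "int (r 1)" "[(1, of_nat (r 1))]"]) auto
  show "t \<in> A \<longleftrightarrow> Q t" if t: "t \<in> RN" for t
  proof
    assume "t \<in> A"
    show "Q t"
    proof (rule ccontr)
      assume nQ: "\<not> Q t"
      then have "lin id [(1, t)] = 0" using t \<open>t \<in> A\<close> by (intro key) auto
      moreover have "nonstandard t" using std nQ by blast
      ultimately show False using RN_nonstandard_nonzero[of t] t by simp
    qed
  qed (use t SA in blast)
qed

text \<open>The elements \<open>as\<close> are contained in a good subgroup that does not meet the chain of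
  \<open>x\<close>. Over it, this chain can be moved to new places.\<close>

lemma infinite_orbit:
  fixes x :: "'a hyp"
  assumes as: "set as \<subseteq> RN" and x: "x \<in> RN" "nonstandard x" "\<And>a. a \<in> set as \<Longrightarrow> \<not> linked a x"
  shows "infinite (orbit as x)"
proof
  assume fin: "finite (orbit as x)"
  define Q where "Q t \<longleftrightarrow> (\<exists>a\<in>set as. linked a t) \<or> \<not> nonstandard t" for t
  define C where "C = qspan {t \<in> RN. Q t}"
  have Q: "\<forall>y z. linked y z \<longrightarrow> Q y \<longrightarrow> Q z"
    using linked_trans nonstandard_linked[OF _ linked_sym] unfolding Q_def by blast
  have std: "\<forall>t. \<not> nonstandard t \<longrightarrow> Q t" by (simp add: Q_def)
  note C = good_chains[of Q, OF Q std, folded C_def]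
  have asC: "set as \<subseteq> C" using C(4) as linked_refl unfolding Q_def by blast
  have xC: "x \<notin> C" using C(4)[OF x(1)] x(2,3) by (simp add: Q_def)
  have "countable (set as)" by (simp add: countable_finite)
  then obtain A where A: "set as \<subseteq> A" "A \<subseteq> C" "psub A" "good A" "1 \<in> A" "countable A"
    by (rule countable_good_hull[OF C(1-3) asC]) blast
  have Id: "piso (Id_on A)" "countable (Id_on A)" using piso_Id[OF A(3-5)] A(6) by (auto simp: Id_on_def)
  have "countable (orbit as x)" using fin by (rule countable_finite)
  from forth_RN[OF Id x(1) this] obtain \<Gamma> where G: "Id_on A \<subseteq> \<Gamma>" "piso \<Gamma>" "countable \<Gamma>" "x \<in> Domain \<Gamma>"
    "\<And>y. y \<in> RN \<Longrightarrow> y \<in> Range \<Gamma> \<Longrightarrow> y \<in> Range (Id_on A) \<or> nonstandard y \<and> (\<forall>k. shifted y k \<notin> orbit as x)"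
    by metis
  obtain y where y: "(x, y) \<in> \<Gamma>" using G(4) by blast
  have yR: "y \<in> RN" using piso_RN[OF G(2) y] x(1) by simp
  have "y \<notin> A"
  proof
    assume "y \<in> A"
    then have "(y, y) \<in> \<Gamma>" using G(1) by auto
    then have "x = y" using piso_inj[OF G(2) y] by simp
    then show False using \<open>y \<in> A\<close> A(2) xC by auto
  qed
  then have "shifted y 0 \<notin> orbit as x" using G(5)[OF yR] y by auto
  moreover have "y \<in> orbit as x" by (rule orbitI[OF G(2,3) y]) (use G(1) A(1) in auto)
  ultimately show False using yR by simp
qed

text \<open>All members of \<open>R\<close> are nonnegative at almost every coordinate, and \<open>s\<close> is positive.\<close>

lemma RN_sum_nonzero:
  assumes "snd ` set l \<subseteq> RN" "fst ` set l \<subseteq> {1}" "s \<in> snd ` set l" "nonstandard s"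
  shows "lin id l \<noteq> (0 :: 'a hyp)"
proof
  assume "lin id l = 0"
  moreover have "lin id l = lin (\<lambda>z. hyp (\<lambda>i. int (r (idx z i)))) l"
  proof (rule lin_cong)
    fix z assume "z \<in> snd ` set l"
    then have "rho (idx z) = z" using assms(1) by auto
    then show "id z = hyp (\<lambda>i. int (r (idx z i)))" by (simp add: rho_def)
  qed
  ultimately have "\<forall>\<^sub>F i in uf. lin (\<lambda>z. int (r (idx z i))) l = 0"
    by (simp add: lin_hyp hyp_zero hyp_eq_iff)
  moreover have "\<forall>\<^sub>F i in uf. 1 \<le> idx s i" using assms(4) by (auto simp: nonstandard_def nonstd_def)
  ultimately have "\<forall>\<^sub>F i :: nat \<times> 'a set in uf. i \<noteq> i"
  proof eventually_elim
    case (elim i)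
    have "int (r (idx s i)) \<le> lin (\<lambda>z. int (r (idx z i))) l" using assms(2,3)
    proof (induction l)
      case (Cons p l)
      obtain z where p: "p = (1, z)" using Cons.prems(1) by (cases p) auto
      have "0 \<le> lin (\<lambda>z. int (r (idx z i))) l" using Cons.prems(1) by (induction l) auto
      then show ?case using Cons p by (cases "s \<in> snd ` set l") auto
    qed simp
    moreover have "0 < r (idx s i)" using elim(2) by (intro r_pos) simp
    ultimately show ?case using elim(1) by simp
  qed
  then show False by (simp add: eventually_False)
qed

end

context embedded_model
begin

lemma h_pls: "h (pls M u v) = h u + h v"
proof -
  define w where "w = (\<lambda>_ :: nat. zer M)(0 := u, 1 := v, 2 := pls M u v)"
  have "sat M w (Eq (Var 2) (Plus (Var 0) (Var 1)))" by (simp add: w_def)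
  then have "sat N (h \<circ> w) (Eq (Var 2) (Plus (Var 0) (Var 1)))" by (simp only: elementary)
  then show ?thesis by (simp add: w_def)
qed

lemma h_zer: "h (zer M) = 0"
proof -
  define w where "w = (\<lambda>_ :: nat. zer M)"
  have "sat M w (Eq (Var 0) Zero)" by (simp add: w_def)
  then have "sat N (h \<circ> w) (Eq (Var 0) Zero)" by (simp only: elementary)
  then show ?thesis by (simp add: w_def)
qed

lemma h_inj: "h u = h v \<Longrightarrow> u = v"
proof -
  assume "h u = h v"
  define w where "w = (\<lambda>_ :: nat. u)(1 := v)"
  have "sat N (h \<circ> w) (Eq (Var 0) (Var 1))" using \<open>h u = h v\<close> by (simp add: w_def)
  then have "sat M w (Eq (Var 0) (Var 1))" by (simp only: elementary)
  then show ?thesis by (simp add: w_def)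
qed

lemma countable_small: "monster \<kappa> M \<Longrightarrow> countable A \<Longrightarrow> |A| <o \<kappa>"
  unfolding monster_def countable_card_le_natLeq using ordLeq_ordLess_trans by blast

lemma realize_avoid:
  assumes mon: "monster \<kappa> M" and A: "countable A" and D: "countable D" "x \<notin> D"
  obtains a where "tp M A [a] = tpN A [x]" "h a \<notin> D"
proof -
  \<comment> \<open>The elements of \<open>M\<close> to be avoided are added to the parameters; only countably many are.\<close>
  define E where "E = A \<union> {z. h z \<in> D}"
  have "inj_on h {z. h z \<in> D}" by (auto simp: inj_on_def h_inj)
  moreover have "countable (h ` {z. h z \<in> D})" by (rule countable_subset[OF _ D(1)]) auto
  ultimately have "countable {z. h z \<in> D}" by (rule countable_image_inj_on[rotated])
  then have "|E| <o \<kappa>" using A by (intro countable_small[OF mon]) (simp add: E_def)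
  moreover have "tpN E [x] \<in> types M 1 E" using tpN_types[of E "[x]"] by simp
  ultimately obtain a where a: "tpN E [x] = tp M E [a]" using monster_realize[OF mon] by blast
  show thesis
  proof (rule that)
    have restrict: "tpN A ys = tpN E ys \<inter> Forms (length ys) A" for ys
      using Forms_mono[of A E] by (auto simp: tpN_def E_def)
    show "tp M A [a] = tpN A [x]"
      using a restrict[of "[x]"] restrict[of "[h a]"] by (simp add: tp_tpN)
    show "h a \<notin> D"
    proof
      assume "h a \<in> D"
      then have "(Eq (Var 0) (Var 1), [a]) \<in> Forms 1 E" by (simp add: Forms_def E_def)
      then have "(Eq (Var 0) (Var 1), [a]) \<in> tp M E [a]" by (simp add: tp_tpN tpN_def Nholds_def)
      then have "(Eq (Var 0) (Var 1), [a]) \<in> tpN E [x]" by (simp only: a)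
      then have "x = h a" by (simp add: tpN_def Nholds_def)
      then show False using D(2) \<open>h a \<in> D\<close> by simp
    qed
  qed
qed

lemma tp_RN:
  assumes "tp M A [a] = tpN A [x]" "x \<in> RN"
  shows "h a \<in> RN"
proof -
  have "(InR (Var 0), []) \<in> tpN A [x]" using assms(2) by (simp add: tpN_def Forms_def Nholds_def)
  then have "(InR (Var 0), []) \<in> tpN A [h a]" using assms(1) by (simp add: tp_tpN)
  then show ?thesis by (simp add: tpN_def Nholds_def)
qed

lemma countable_chains: "countable {t \<in> RN. \<not> nonstandard t \<or> (\<exists>s\<in>set ss. linked s t)}" if "set ss \<subseteq> RN" for ss
proof -
  have "{t \<in> RN. \<not> nonstandard t \<or> (\<exists>s\<in>set ss. linked s t)}
      \<subseteq> range (\<lambda>j. of_nat (r j)) \<union> (\<Union>s\<in>set ss. {t \<in> RN. linked s t})"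
    using std_iff by auto
  moreover have "countable (range (\<lambda>j. of_nat (r j)) \<union> (\<Union>s\<in>set ss. {t \<in> RN. linked s t}))"
    using that by (intro countable_Un countable_UN[OF countable_finite] countable_chain) auto
  ultimately show ?thesis by (rule countable_subset)
qed

text \<open>In \<open>M\<close>, as in \<open>N\<close>, new chains can be found one after the other, by saturation.\<close>

lemma independent_elements:
  assumes mon: "monster \<kappa> M"
  shows "\<exists>as. length as = L \<and> (\<forall>a\<in>set as. h a \<in> RN \<and> nonstandard (h a)) \<and>
    (\<forall>i<L. \<forall>j<i. \<not> linked (h (as ! j)) (h (as ! i)))"
proof (induction L)
  case 0 then show ?case by simp
next
  case (Suc L)
  then obtain as where as: "length as = L" "\<forall>a\<in>set as. h a \<in> RN \<and> nonstandard (h a)"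
    "\<forall>i<L. \<forall>j<i. \<not> linked (h (as ! j)) (h (as ! i))" by blast
  let ?D = "{t \<in> RN. \<not> nonstandard t \<or> (\<exists>s\<in>set (map h as). linked s t)}"
  have D: "countable ?D" by (rule countable_chains) (use as in auto)
  obtain s0 :: "'m pfm hyp" where s0: "s0 \<in> RN" "nonstandard s0" using nonstandard_exists by blast
  obtain s where s: "s \<in> RN" "\<And>k. shifted s k \<notin> ?D" by (rule chain_copy[OF s0 D]) (rule that)
  have "s \<notin> ?D" using s(2)[of 0] unfolding shifted_0[OF s(1)] .
  from realize_avoid[OF mon _ D this, of "{}"] obtain a where
    a: "tp M {} [a] = tpN {} [s]" "h a \<notin> ?D" by auto
  have "h a \<in> RN" by (rule tp_RN[OF a(1) s(1)])
  then have a': "h a \<in> RN" "nonstandard (h a)" "\<And>b. b \<in> set as \<Longrightarrow> \<not> linked (h b) (h a)" using a(2) by auto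
  show ?case
  proof (intro exI[of _ "as @ [a]"] conjI)
    show "\<forall>i<Suc L. \<forall>j<i. \<not> linked (h ((as @ [a]) ! j)) (h ((as @ [a]) ! i))"
      using as a'(3) by (auto simp: less_Suc_eq nth_append)
  qed (use as a' in auto)
qed

text \<open>The orbit of \<open>a\<close> over \<open>as\<close> is infinite, hence not contained in the countably many
  chains of the previously chosen elements.\<close>

lemma independent_conjugates:
  assumes mon: "monster \<kappa> M" and as: "\<And>b. b \<in> set as \<Longrightarrow> h b \<in> RN" and a: "h a \<in> RN" "nonstandard (h a)"
    and unl: "\<And>b. b \<in> set as \<Longrightarrow> \<not> linked (h b) (h a)"
  shows "\<exists>e :: nat \<Rightarrow> 'm. \<forall>l. (tp M (set as) [e l] = tp M (set as) [a] \<and> h (e l) \<in> RN \<and> nonstandard (h (e l))) \<and>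
    (\<forall>l'<l. \<not> linked (h (e l')) (h (e l)))"
proof -
  \<comment> \<open>The premise makes \<open>P\<close> satisfiable for every \<open>e\<close>, as dependent choice demands.\<close>
  define P where "P e l x \<longleftrightarrow> (\<forall>l'<l. h (e l') \<in> RN) \<longrightarrow>
    (tp M (set as) [x] = tp M (set as) [a] \<and> h x \<in> RN \<and> nonstandard (h x)) \<and> (\<forall>l'<l. \<not> linked (h (e l')) (h x))"
    for e :: "nat \<Rightarrow> 'm" and l x
  have "\<exists>e. \<forall>l. P e l (e l)"
  proof (rule dependent_wellorder_choice)
    show "P f l x = P g l x" if "\<And>y. y < l \<Longrightarrow> f y = g y" for x f g l
      using that by (simp add: P_def)
    fix l e
    show "\<exists>x. P e l x"
    proof (cases "\<forall>l'<l. h (e l') \<in> RN")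
      case True
      let ?D = "{t \<in> RN. \<not> nonstandard t \<or> (\<exists>s\<in>set (map (h \<circ> e) [0..<l]). linked s t)}"
      have D: "countable ?D" by (rule countable_chains) (use True in auto)
      have inf: "infinite (orbit (map h as) (h a))" by (rule infinite_orbit) (use as a unl in auto)
      obtain y where y: "y \<in> orbit (map h as) (h a)" "y \<notin> ?D" using orbit_avoid[OF inf D] by blast
      from y(1) obtain \<Gamma> where G: "piso \<Gamma>" "countable \<Gamma>" "(h a, y) \<in> \<Gamma>" "\<And>u. u \<in> set (map h as) \<Longrightarrow> (u, u) \<in> \<Gamma>"
        by (rule orbitE) blast
      have "teq ([h a] @ map h bs) ([y] @ map h bs)" if "bs \<in> lists (set as)" for bs
      proof (rule piso_teq_zip[OF G(1,2)])
        have "(u, u) \<in> \<Gamma>" if "u \<in> set (map h bs)" for u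
          by (rule G(4)) (use that \<open>bs \<in> lists (set as)\<close> in auto)
        then show "set (zip ([h a] @ map h bs) ([y] @ map h bs)) \<subseteq> \<Gamma>" using G(3) by (auto simp: zip_same)
      qed simp
      then have tpy: "tpN (set as) [h a] = tpN (set as) [y]" using tpN_eq_iff[of "set as" "[h a]" "[y]"] by simp
      have "countable (set as)" by (simp add: countable_finite)
      from realize_avoid[OF mon this D y(2)] obtain x where
        x: "tp M (set as) [x] = tpN (set as) [y]" "h x \<notin> ?D" by blast
      have "y \<in> RN" using piso_RN[OF G(1,3)] a(1) by simp
      then have "h x \<in> RN" by (rule tp_RN[OF x(1)])
      then show ?thesis using x tpy by (intro exI[of _ x]) (auto simp: P_def tp_tpN)
    qed (auto simp: P_def)
  qed
  then obtain e where e: "\<And>l. P e l (e l)" by blast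
  have "h (e l) \<in> RN" for l
    by (induction l rule: less_induct) (use e in \<open>auto simp: P_def\<close>)
  then show ?thesis using e by (intro exI[of _ e]) (simp add: P_def)
qed

text \<open>The formula \<open>\<exists>y\<^sub>i, \<dots>, y\<^sub>L\<^sub>-\<^sub>1 \<in> R. x = b\<^sub>0 + \<dots> + b\<^sub>i\<^sub>-\<^sub>1 + y\<^sub>i + \<dots> + y\<^sub>L\<^sub>-\<^sub>1\<close> with
  parameters \<open>b\<close>.\<close>

definition sum_fm :: "nat \<Rightarrow> nat \<Rightarrow> fm" where
  "sum_fm L i = Exs (map Suc [i..<L])
    (Conjs (Lin ((- 1, 0) # map (\<lambda>e. (1, Suc e)) [0..<L]) # map (\<lambda>e. InR (Var (Suc e))) [i..<L]))"

lemma fv_sum_fm: "i \<le> L \<Longrightarrow> fv (sum_fm L i) \<subseteq> {..<Suc i}"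
  using fv_Lin[of "(- 1, 0) # map (\<lambda>e. (1, Suc e)) [0..<L]"]
  unfolding sum_fm_def fv_Exs fv_Conjs by (auto simp: image_iff)

lemma sum_fm_iff:
  assumes "length bs = i" "i \<le> L"
  shows "Nholds [z] (sum_fm L i, bs) \<longleftrightarrow>
    (\<exists>ys. length ys = L - i \<and> set ys \<subseteq> RN \<and> z = sum_list (map h bs) + sum_list ys)"
proof -
  let ?\<phi> = "Conjs (Lin ((- 1, 0) # map (\<lambda>e. (1, Suc e)) [0..<L]) # map (\<lambda>e. InR (Var (Suc e))) [i..<L])"
  have sat: "sat N w ?\<phi> \<longleftrightarrow> w 0 = (\<Sum>e\<leftarrow>[0..<i]. w (Suc e)) + (\<Sum>e\<leftarrow>[i..<L]. w (Suc e)) \<and> (\<forall>e\<in>{i..<L}. w (Suc e) \<in> RN)"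
    for w :: "nat \<Rightarrow> 'm pfm hyp"
  proof -
    have "[0..<L] = [0..<i] @ [i..<L]" using assms(2) upt_add_eq_append[of 0 i "L - i"] by simp
    then have "lin w ((- 1, 0) # map (\<lambda>e. (1, Suc e)) [0..<L])
        = - w 0 + ((\<Sum>e\<leftarrow>[0..<i]. w (Suc e)) + (\<Sum>e\<leftarrow>[i..<L]. w (Suc e)))"
      by (simp add: lin_ones)
    then show ?thesis by (auto simp: sat_Lin algebra_simps eq_neg_iff_add_eq_0)
  qed
  have par: "(\<Sum>e\<leftarrow>[0..<i]. w (Suc e)) = sum_list (map h bs)"
    if "\<And>e. e < i \<Longrightarrow> w (Suc e) = h (bs ! e)" for w
  proof -
    have "map (\<lambda>e. w (Suc e)) [0..<i] = map h bs"
      by (rule nth_equalityI) (use that assms(1) in auto)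
    then show ?thesis by simp
  qed
  show ?thesis
  proof
    assume "Nholds [z] (sum_fm L i, bs)"
    then obtain w where w: "\<forall>n. n \<notin> set (map Suc [i..<L]) \<longrightarrow> w n = ([z] @ map h bs) ! n" "sat N w ?\<phi>"
      unfolding Nholds_def sum_fm_def fst_conv snd_conv sat_Exs by blast
    have "w 0 = z" using w(1) by auto
    moreover have "w (Suc e) = h (bs ! e)" if "e < i" for e using w(1) that assms(1) by auto
    ultimately show "\<exists>ys. length ys = L - i \<and> set ys \<subseteq> RN \<and> z = sum_list (map h bs) + sum_list ys"
      using w(2) par[of w] unfolding sat by (intro exI[of _ "map (\<lambda>e. w (Suc e)) [i..<L]"]) auto
  next
    assume "\<exists>ys. length ys = L - i \<and> set ys \<subseteq> RN \<and> z = sum_list (map h bs) + sum_list ys"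
    then obtain ys where ys: "length ys = L - i" "set ys \<subseteq> RN" "z = sum_list (map h bs) + sum_list ys" by blast
    define w where "w n = (if n \<in> set (map Suc [i..<L]) then ys ! (n - Suc i) else ([z] @ map h bs) ! n)" for n
    have "map (\<lambda>e. w (Suc e)) [i..<L] = ys"
      by (rule nth_equalityI) (use ys(1) in \<open>auto simp: w_def\<close>)
    moreover have "w (Suc e) = h (bs ! e)" if "e < i" for e using that assms(1) by (auto simp: w_def)
    moreover have "w (Suc e) \<in> RN" if "e \<in> {i..<L}" for e
      using that ys(1,2) by (auto simp: w_def intro!: subsetD[OF ys(2)] nth_mem)
    moreover have "w 0 = z" by (simp add: w_def)
    ultimately have "sat N w ?\<phi>" unfolding sat using par[of w] ys(3) by simp
    then show "Nholds [z] (sum_fm L i, bs)"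
      unfolding Nholds_def sum_fm_def fst_conv snd_conv sat_Exs by (intro exI[of _ w]) (auto simp: w_def)
  qed
qed

text \<open>If \<open>z\<close> satisfies the formulas for all \<open>l \<in> I\<close>, compare the resulting representations
  of \<open>z\<close> with a fixed one. Since members of \<open>R\<close> with positive coefficients do not cancel,
  every other \<open>e l\<close> is linked to a summand of the fixed one, of which there are fewer than
  \<open>L\<close>.\<close>

lemma sum_fm_inconsistent:
  assumes bs: "length bs = i" "i < L"
    and e: "\<And>l. h (e l) \<in> RN \<and> nonstandard (h (e l))" "\<And>l l'. l' < l \<Longrightarrow> \<not> linked (h (e l')) (h (e l))"
    and I: "finite (I :: nat set)" "card I = Suc L"
    and holds: "\<And>l. l \<in> I \<Longrightarrow> Nholds [z] (sum_fm L (Suc i), bs @ [e l])"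
  shows False
proof -
  have unl: "\<not> linked (h (e l)) (h (e l'))" if "l \<noteq> l'" for l l'
    using e(2)[of l l'] e(2)[of l' l] that linked_sym by (metis nat_neq_iff)
  have "\<exists>ys. length ys = L - Suc i \<and> set ys \<subseteq> RN \<and> z = sum_list (map h bs) + h (e l) + sum_list ys" if "l \<in> I" for l
    using holds[OF that] sum_fm_iff[of "bs @ [e l]" "Suc i" L z] bs by (simp add: add.assoc)
  then obtain ys where ys: "\<And>l. l \<in> I \<Longrightarrow> length (ys l) = L - Suc i" "\<And>l. l \<in> I \<Longrightarrow> set (ys l) \<subseteq> RN"
    "\<And>l. l \<in> I \<Longrightarrow> z = sum_list (map h bs) + h (e l) + sum_list (ys l)" by metis
  have "I \<noteq> {}" using I(2) by auto
  then obtain l0 where l0: "l0 \<in> I" by blast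
  have "\<exists>y\<in>set (ys l0). linked (h (e l)) y" if l: "l \<in> I - {l0}" for l
  proof (rule ccontr)
    assume no: "\<not> (\<exists>y\<in>set (ys l0). linked (h (e l)) y)"
    define K where "K l = map (Pair (1 :: int)) (h (e l) # ys l)" for l
    have linK: "lin id (K l) = h (e l) + sum_list (ys l)" for l
      using lin_ones[of id "\<lambda>x. x" "h (e l) # ys l"] by (simp add: K_def)
    define W where "W = K l @ scale (- 1) (K l0)"
    have KR: "snd ` set (K l) \<subseteq> RN" if "l \<in> I" for l using ys(2)[OF that] e(1) by (auto simp: K_def)
    have "lin id (K l) = lin id (K l0)" unfolding linK using ys(3)[of l] ys(3)[of l0] l l0 by simp
    then have "lin id W = 0" by (simp add: W_def)
    moreover have "snd ` set W \<subseteq> RN" unfolding W_def snd_append snd_scale using KR l l0 by blast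
    ultimately have "lin id (filter (\<lambda>p. linked (h (e l)) (snd p)) W) = 0" by (intro lin_chain)
    moreover have "filter (\<lambda>p. linked (h (e l)) (snd p)) (scale (- 1) (K l0)) = []"
      using no unl[of l l0] l by (auto simp: filter_empty_conv scale_def K_def)
    ultimately have "lin id (filter (\<lambda>p. linked (h (e l)) (snd p)) (K l)) = 0" by (simp add: W_def)
    moreover have "lin id (filter (\<lambda>p. linked (h (e l)) (snd p)) (K l)) \<noteq> 0"
      by (rule RN_sum_nonzero[where s = "h (e l)"]) (use KR[of l] l e(1) in \<open>auto simp: K_def\<close>)
    ultimately show False by simp
  qed
  then obtain g where g: "\<And>l. l \<in> I - {l0} \<Longrightarrow> g l \<in> set (ys l0) \<and> linked (h (e l)) (g l)" by metis
  have "inj_on g (I - {l0})"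
  proof (rule inj_onI, rule ccontr)
    fix l l' assume "l \<in> I - {l0}" "l' \<in> I - {l0}" "g l = g l'" "l \<noteq> l'"
    then have "linked (h (e l)) (h (e l'))" using g linked_trans linked_sym by metis
    then show False using unl \<open>l \<noteq> l'\<close> by blast
  qed
  then have "card (I - {l0}) \<le> card (set (ys l0))" using g by (intro card_inj_on_le[of g]) auto
  also have "\<dots> \<le> L - Suc i" using card_length[of "ys l0"] ys(1)[OF l0] by simp
  finally show False using I l0 bs(2) by simp
qed

text \<open>The conjugates of the last parameter in infinitely many different chains witness
  dividing.\<close>

lemma sum_fm_divides:
  assumes mon: "monster \<kappa> M" and as: "length as = L" "\<forall>a\<in>set as. h a \<in> RN \<and> nonstandard (h a)"
    "\<forall>i<L. \<forall>j<i. \<not> linked (h (as ! j)) (h (as ! i))" and i: "i < L"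
  shows "divides M 1 (set (take i as)) (sum_fm L (Suc i), take (Suc i) as)"
proof -
  let ?B = "set (take i as)"
  have BR: "h b \<in> RN" if "b \<in> ?B" for b using that as(2) by (auto dest: in_set_takeD)
  have ai: "h (as ! i) \<in> RN" "nonstandard (h (as ! i))" using as(1,2) i by auto
  have unl: "\<not> linked (h b) (h (as ! i))" if "b \<in> ?B" for b
    using that as(1,3) i by (auto simp: in_set_conv_nth)
  obtain e :: "nat \<Rightarrow> 'm" where e: "\<And>l. tp M ?B [e l] = tp M ?B [as ! i]" "\<And>l. h (e l) \<in> RN \<and> nonstandard (h (e l))"
    "\<And>l l'. l' < l \<Longrightarrow> \<not> linked (h (e l')) (h (e l))"
    using independent_conjugates[OF mon, of "take i as" "as ! i", OF BR ai unl] by blast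
  have take: "take (Suc i) as = take i as @ [as ! i]" using as(1) i by (simp add: take_Suc_conv_app_nth)
  have F: "(sum_fm L (Suc i), bs) \<in> Forms 1 UNIV" if "length bs = Suc i" for bs
    using fv_sum_fm[of "Suc i" L] i that by (auto simp: Forms_def)
  show ?thesis unfolding divides_def fst_conv snd_conv
  proof (intro conjI exI allI impI)
    show "(sum_fm L (Suc i), take (Suc i) as) \<in> Forms 1 UNIV" by (rule F) (use as i in simp)
    show "length (take i as @ [e l]) = length (take (Suc i) as)" for l using as i by simp
    show "tp M ?B (take i as @ [e l]) = tp M ?B (take (Suc i) as)" for l
    proof -
      have "teq (map h (take i as @ [as ! i]) @ map h bs) (map h (take i as @ [e l]) @ map h bs)"
        if bs: "bs \<in> lists ?B" for bs
      proof -
        have "teq (map h [as ! i] @ map h (take i as @ bs)) (map h [e l] @ map h (take i as @ bs))"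
          by (rule teq_params[OF e(1)[symmetric]]) (use bs in auto)
        then obtain \<Gamma> where G: "piso \<Gamma>" "countable \<Gamma>"
          "set (zip (map h [as ! i] @ map h (take i as @ bs)) (map h [e l] @ map h (take i as @ bs))) \<subseteq> \<Gamma>"
          by (rule teq_piso_zip)
        then show ?thesis by (intro piso_teq_zip[OF G(1,2)]) (auto simp: zip_append)
      qed
      then show ?thesis
        using tpN_eq_iff[of ?B "map h (take i as @ [as ! i])" "map h (take i as @ [e l])"]
        unfolding take tp_tpN by simp
    qed
    fix I :: "nat set" assume I: "finite I \<and> card I = Suc L"
    show "\<not> (\<exists>xs. length xs = 1 \<and> (\<forall>l\<in>I. holds M xs (sum_fm L (Suc i), take i as @ [e l])))"
    proof
      assume "\<exists>xs. length xs = 1 \<and> (\<forall>l\<in>I. holds M xs (sum_fm L (Suc i), take i as @ [e l]))"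
      then obtain xs where "length xs = 1" and xs: "\<forall>l\<in>I. holds M xs (sum_fm L (Suc i), take i as @ [e l])"
        by blast
      then obtain x where x: "xs = [x]" by (auto simp: length_Suc_conv)
      have "Nholds [h x] (sum_fm L (Suc i), take i as @ [e l])" if "l \<in> I" for l
        using xs that holds_Nholds[of "(sum_fm L (Suc i), take i as @ [e l])" "[x]" UNIV]
          F[of "take i as @ [e l]"] as i by (simp add: x)
      then show False
        using sum_fm_inconsistent[of "take i as" i L e I "h x"] as i e(2,3) I by simp
    qed
  qed
qed

text \<open>The element is the sum of \<open>L\<close> members of different chains, and the extensions add
  these one by one.\<close>

theorem U_gt_finite:
  fixes \<beta> :: "nat rel"
  assumes mon: "monster \<kappa> M" and \<beta>: "\<beta> <o natLeq"
  shows "\<exists>p\<in>types M 1 {}. U_gt \<kappa> M \<beta> {} p"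
proof -
  obtain m where m: "\<beta> =o natLeq_on m" using \<beta> by (rule ordLess_natLeqE)
  define L where "L = Suc m"
  obtain as where as: "length as = L" "\<forall>a\<in>set as. h a \<in> RN \<and> nonstandard (h a)"
    "\<forall>i<L. \<forall>j<i. \<not> linked (h (as ! j)) (h (as ! i))" using independent_elements[OF mon] by blast
  define x where "x = foldr (pls M) as (zer M)"
  have hx: "h x = sum_list (map h as)"
    unfolding x_def by (induction as) (auto simp: h_pls h_zer)
  define B where "B i = set (take i as)" for i
  have ext: "forking_ext \<kappa> M (B i) (tp M (B i) [x]) (B (Suc i)) (tp M (B (Suc i)) [x])" if i: "i < L" for i
    unfolding forking_ext_def
  proof (intro conjI)
    show BB: "B i \<subseteq> B (Suc i)" unfolding B_def by (rule set_take_subset_set_take) simp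
    show "|B (Suc i)| <o \<kappa>" by (rule countable_small[OF mon]) (simp add: B_def countable_finite)
    show "tp M (B (Suc i)) [x] \<in> types M 1 (B (Suc i))"
      using tpN_types[of "B (Suc i)" "[h x]"] by (simp add: tp_tpN)
    show "tp M (B i) [x] \<subseteq> tp M (B (Suc i)) [x]"
      using Forms_mono[OF BB] by (auto simp: tp_def)
    let ?f = "(sum_fm L (Suc i), take (Suc i) as)"
    have f: "?f \<in> Forms 1 (B (Suc i))"
      using fv_sum_fm[of "Suc i" L] i as(1) by (auto simp: Forms_def B_def)
    have "Nholds [h x] ?f"
    proof -
      have "h x = sum_list (map h (take (Suc i) as)) + sum_list (map h (drop (Suc i) as))"
        unfolding hx by (metis append_take_drop_id map_append sum_list.append)
      moreover have "set (map h (drop (Suc i) as)) \<subseteq> RN" using as(2) by (auto dest: in_set_dropD)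
      ultimately show ?thesis
        using sum_fm_iff[of "take (Suc i) as" "Suc i" L "h x"] as(1) i
        by (auto intro!: exI[of _ "map h (drop (Suc i) as)"])
    qed
    then have "?f \<in> tp M (B (Suc i)) [x]" using f by (simp add: tp_tpN tpN_def)
    moreover have "divides M 1 (B i) ?f" unfolding B_def by (rule sum_fm_divides[OF mon as i])
    ultimately show "forks M 1 (B i) (tp M (B (Suc i)) [x])"
      unfolding forks_def by (intro exI[of _ "{?f}"]) auto
  qed
  have "U_ge \<kappa> M \<beta> (B (Suc 0)) (tp M (B (Suc 0)) [x])"
    using chain_U_ge[of L \<kappa> M B "\<lambda>i. tp M (B i) [x]", OF ext _ m, of "Suc 0"] by (simp add: L_def)
  moreover have "forking_ext \<kappa> M {} (tp M {} [x]) (B (Suc 0)) (tp M (B (Suc 0)) [x])"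
    using ext[of 0] by (simp add: L_def B_def)
  ultimately have "U_gt \<kappa> M \<beta> {} (tp M {} [x])" unfolding U_gt_def by blast
  moreover have "tp M {} [x] \<in> types M 1 {}" using tpN_types[of "{}" "[h x]"] by (simp add: tp_tpN)
  ultimately show ?thesis by blast
qed

end

section \<open>Counting types\<close>

type_synonym step_code = "int \<times> (int \<times> int) list"

context regular_sequence
begin

text \<open>A generator is either a member of \<open>R\<close>, which contributes its chain, or a generic
  element; the Boolean tells which. A generic element is treated as a constant chain, so that
  both kinds of generators are adjoined in the same way.\<close>

definition members :: "bool \<Rightarrow> 'a hyp \<Rightarrow> int \<Rightarrow> 'a hyp" where
  "members b g k = (if b then shifted g k else g)"

definition residues :: "bool \<Rightarrow> 'a hyp \<Rightarrow> (int \<times> int \<times> int) set" where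
  "residues b g = {(n, k, j). n \<noteq> 0 \<and> of_int n dvd members b g k - of_int j}"

definition base_names :: "'a hyp set \<Rightarrow> (('a hyp \<times> step_code list) \<times> 'a hyp) set" where
  "base_names A = (\<lambda>a. ((a, []), a)) ` A"

text \<open>The set \<open>E\<close> contains pairs of a name and an element. An element of the extended
  subgroup arises from an old one by adding a combination of the new generator and
  dividing by \<open>n\<close>; this combination and \<open>n\<close> are added to the name.\<close>

definition adjoin :: "(('a hyp \<times> step_code list) \<times> 'a hyp) set \<Rightarrow> bool \<Rightarrow> 'a hyp
    \<Rightarrow> (('a hyp \<times> step_code list) \<times> 'a hyp) set" where
  "adjoin E b g = {((a, (n, l) # st), x) | a n l st x.
     n \<noteq> 0 \<and> (\<exists>z. ((a, st), z) \<in> E \<and> of_int n * x = z + lin (members b g) l)}"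

text \<open>The subgroups generated over \<open>A\<close> by finitely many generators, added one by one, with
  names for their elements. The names contain an element of \<open>A\<close> and integers but no
  generators. So if the same residues occur in two towers over \<open>A\<close>, the elements with
  equal names correspond to each other.\<close>

inductive tower :: "'a hyp set \<Rightarrow> (bool \<times> (int \<times> int \<times> int) set) list
    \<Rightarrow> (('a hyp \<times> step_code list) \<times> 'a hyp) set \<Rightarrow> bool" for A where
  base: "tower A [] (base_names A)"
| chain: "tower A ds E \<Longrightarrow> g \<in> RN \<Longrightarrow> nonstandard g \<Longrightarrow> (\<And>k. shifted g k \<notin> Range E) \<Longrightarrow>
    tower A ((True, residues True g) # ds) (adjoin E True g)"
| generic: "tower A ds E \<Longrightarrow> generic (Range E) g \<Longrightarrow>
    tower A ((False, residues False g) # ds) (adjoin E False g)"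

lemma residues_eqD:
  assumes "residues b g = residues b g'" "n \<noteq> 0"
  shows "of_int n dvd members b g k - members b g' k"
proof -
  obtain j where j: "of_int n dvd members b g k - of_int j" using residue_ex[OF assms(2)] by blast
  then have "(n, k, j) \<in> residues b g" using assms(2) by (simp add: residues_def)
  then have "(n, k, j) \<in> residues b g'" by (simp only: assms(1))
  then have "of_int n dvd members b g' k - of_int j" by (simp add: residues_def)
  from dvd_diff[OF j this] show ?thesis by simp
qed

text \<open>Matching equal names is compatible with adjoining generators.\<close>

lemma adjoin_ext:
  assumes "P = range (\<lambda>k. (members b g k, members b g' k))"
  shows "(adjoin E b g)\<inverse> O adjoin E' b g' = ext (E\<inverse> O E') P"
proof (intro set_eqI iffI)
  fix p assume "p \<in> (adjoin E b g)\<inverse> O adjoin E' b g'"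
  then obtain a n l st x y z z' where 1: "p = (x, y)" "n \<noteq> 0" "((a, st), z) \<in> E" "((a, st), z') \<in> E'"
    "of_int n * x = z + lin (members b g) l" "of_int n * y = z' + lin (members b g') l"
    unfolding adjoin_def by blast
  let ?l = "map (\<lambda>(c, k). (c, (members b g k, members b g' k))) l"
  have "(x, y) \<in> ext (E\<inverse> O E') P"
  proof (rule extI)
    show "n \<noteq> 0" "(z, z') \<in> E\<inverse> O E'" using 1 by blast+
    show "snd ` set ?l \<subseteq> P" unfolding assms by auto
    show "of_int n * x = z + lin fst ?l" "of_int n * y = z' + lin snd ?l"
      unfolding lin_map 1 by simp_all
  qed
  then show "p \<in> ext (E\<inverse> O E') P" by (simp add: 1)
next
  fix p assume p: "p \<in> ext (E\<inverse> O E') P"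
  obtain x y where xy: "p = (x, y)" by (cases p)
  obtain n z z' l where 1: "n \<noteq> 0" "(z, z') \<in> E\<inverse> O E'" "snd ` set l \<subseteq> P" "of_int n * x = z + lin fst l"
    "of_int n * y = z' + lin snd l" using p unfolding xy by (rule extE)
  obtain l' where l': "lin fst l = lin (members b g) l'" "lin snd l = lin (members b g') l'"
    using pair_list[OF 1(3)[unfolded assms]] by blast
  obtain a st where c: "((a, st), z) \<in> E" "((a, st), z') \<in> E'" using 1(2) by auto
  have "((a, (n, l') # st), x) \<in> adjoin E b g" "((a, (n, l') # st), y) \<in> adjoin E' b g'"
    unfolding adjoin_def using 1 l' c by auto
  then show "p \<in> (adjoin E b g)\<inverse> O adjoin E' b g'" unfolding xy by blast
qed

lemma tower_piso:
  assumes A: "psub A" "good A" "1 \<in> A"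
    and "tower A ds E" "tower A ds E'"
  shows "piso (E\<inverse> O E')"
  using assms(4,5)
proof (induction arbitrary: E')
  case base
  from base have E': "E' = base_names A" by (auto elim: tower.cases)
  have "(base_names A)\<inverse> O base_names A = Id_on A" by (auto simp: base_names_def)
  then show ?case unfolding E' using piso_Id[OF A] by simp
next
  case (chain ds E g)
  from chain.prems obtain F g' where F: "tower A ds F" "g' \<in> RN" "nonstandard g'" "\<And>k. shifted g' k \<notin> Range F"
    "residues True g = residues True g'" "E' = adjoin F True g'"
    by (cases rule: tower.cases) auto
  let ?\<Gamma> = "E\<inverse> O F"
  have G: "piso ?\<Gamma>" by (rule chain.IH[OF F(1)])
  have dom: "shifted g k \<notin> Domain ?\<Gamma>" for k using chain.hyps(4)[of k] by auto
  have "chain_pairs (Domain ?\<Gamma>) g g' = range (\<lambda>k. (members True g k, members True g' k))"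
    unfolding chain_pairs_def members_def using dom by auto
  then have "(adjoin E True g)\<inverse> O E' = ext ?\<Gamma> (chain_pairs (Domain ?\<Gamma>) g g')"
    unfolding F(6) by (rule adjoin_ext)
  moreover have "piso (ext ?\<Gamma> (chain_pairs (Domain ?\<Gamma>) g g'))"
  proof (rule piso_chain[OF G chain.hyps(2,3) F(2,3)])
    show "shifted g' k \<notin> Range ?\<Gamma>" for k using F(4)[of k] by auto
    show "of_int n dvd shifted g k - shifted g' k" if "n \<noteq> 0" for n k
      using residues_eqD[OF F(5) that, of k] by (simp add: members_def)
  qed
  ultimately show ?case by simp
next
  case (generic ds E g)
  from generic.prems obtain F g' where F: "tower A ds F" "generic (Range F) g'"
    "residues False g = residues False g'" "E' = adjoin F False g'"
    by (cases rule: tower.cases) auto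
  let ?\<Gamma> = "E\<inverse> O F"
  have G: "piso ?\<Gamma>" by (rule generic.IH[OF F(1)])
  have "{(g, g')} = range (\<lambda>k. (members False g k, members False g' k))" by (auto simp: members_def)
  then have "(adjoin E False g)\<inverse> O E' = ext ?\<Gamma> {(g, g')}"
    unfolding F(4) by (rule adjoin_ext)
  moreover have "piso (ext ?\<Gamma> {(g, g')})"
  proof (rule piso_generic[OF G])
    show "generic (Domain ?\<Gamma>) g" by (rule generic_mono[OF _ generic.hyps(2)]) auto
    show "generic (Range ?\<Gamma>) g'" by (rule generic_mono[OF _ F(2)]) auto
    show "of_int n dvd g - g'" if "n \<noteq> 0" for n
      using residues_eqD[OF F(3) that] by (simp add: members_def)
  qed
  ultimately show ?case by simp
qed

text \<open>A name refers to a single element of \<open>A\<close>, so subsets of \<open>A\<close> may replace \<open>A\<close>. This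
  serves to obtain countable subgroups, as back and forth requires.\<close>

lemma tower_restrict:
  assumes "tower A ds E" "B \<subseteq> A"
  shows "tower B ds {p \<in> E. fst (fst p) \<in> B}"
  using assms(1)
proof induction
  case base
  have "{p \<in> base_names A. fst (fst p) \<in> B} = base_names B" using assms(2) by (auto simp: base_names_def)
  then show ?case by (simp add: tower.base)
next
  case (chain ds E g)
  have "{p \<in> adjoin E True g. fst (fst p) \<in> B} = adjoin {p \<in> E. fst (fst p) \<in> B} True g"
    by (auto simp: adjoin_def)
  then show ?case using tower.chain[OF chain.IH chain.hyps(2,3)] chain.hyps(4) by auto
next
  case (generic ds E g)
  have "{p \<in> adjoin E False g. fst (fst p) \<in> B} = adjoin {p \<in> E. fst (fst p) \<in> B} False g"
    by (auto simp: adjoin_def)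
  moreover have "generic (Range {p \<in> E. fst (fst p) \<in> B}) g" by (rule generic_mono[OF _ generic.hyps(2)]) auto
  ultimately show ?case using tower.generic[OF generic.IH] by simp
qed

lemma single_valued_adjoin:
  assumes "single_valued E"
  shows "single_valued (adjoin E b g)"
proof (rule single_valuedI)
  fix c x y assume "(c, x) \<in> adjoin E b g" "(c, y) \<in> adjoin E b g"
  then obtain a n l st z z' where 1: "n \<noteq> 0" "((a, st), z) \<in> E" "((a, st), z') \<in> E"
    "of_int n * x = z + lin (members b g) l" "of_int n * y = z' + lin (members b g) l"
    unfolding adjoin_def by blast
  have "z = z'" using assms 1(2,3) by (rule single_valuedD)
  then have "of_int n * x = of_int n * y" using 1 by simp
  then show "x = y" using 1(1) by simp
qed

lemma tower_single_valued: "tower A ds E \<Longrightarrow> single_valued E"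
  by (induction rule: tower.induct) (auto simp: base_names_def single_valued_adjoin, auto simp: single_valued_def)

lemma tower_Domain: "tower A ds E \<Longrightarrow> Domain E \<subseteq> A \<times> UNIV"
  by (induction rule: tower.induct) (auto simp: adjoin_def base_names_def)

lemma tower_countable:
  assumes "tower A ds E" "countable A"
  shows "countable E"
proof -
  have "countable (Domain E)"
    by (rule countable_subset[OF tower_Domain[OF assms(1)]]) (use assms(2) in auto)
  moreover have "inj_on fst E" using tower_single_valued[OF assms(1)] by (fastforce simp: inj_on_def single_valued_def)
  ultimately show ?thesis unfolding Domain_fst by (rule countable_image_inj_on)
qed

lemma tower_base_name: "tower A ds E \<Longrightarrow> a \<in> A \<Longrightarrow> ((a, replicate (length ds) (1, [])), a) \<in> E"
  by (induction rule: tower.induct) (auto simp: adjoin_def base_names_def)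

lemma adjoin_Range:
  "x \<in> Range (adjoin E b g) \<longleftrightarrow> (\<exists>n z l. n \<noteq> 0 \<and> z \<in> Range E \<and> of_int n * x = z + lin (members b g) l)"
  unfolding adjoin_def by fast

lemma adjoin_mono: "Range E \<subseteq> Range (adjoin E b g)"
proof
  fix x assume x: "x \<in> Range E"
  then show "x \<in> Range (adjoin E b g)"
    unfolding adjoin_Range by (intro exI[of _ 1] exI[of _ x] exI[of _ "[]"]) simp
qed

text \<open>Here the subgroup contains with one member of a chain all others, so that the chains
  still to be added are disjoint from it, as \<open>tower.chain\<close> demands.\<close>

definition closed_tower :: "'a hyp set \<Rightarrow> (bool \<times> (int \<times> int \<times> int) set) list
    \<Rightarrow> (('a hyp \<times> step_code list) \<times> 'a hyp) set \<Rightarrow> bool" where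
  "closed_tower A ds E \<longleftrightarrow> tower A ds E \<and> chain_closed_in UNIV (Range E)"

lemma closed_tower_facts:
  assumes A: "psub A" "good A" "1 \<in> A" and E: "closed_tower A ds E"
  shows "psub (Range E)" "good (Range E)" "1 \<in> Range E"
proof -
  have t: "tower A ds E" using E by (simp add: closed_tower_def)
  have "piso (E\<inverse> O E)" by (rule tower_piso[OF A t t])
  moreover have "Range (E\<inverse> O E) = Range E" by auto
  ultimately show "psub (Range E)" "good (Range E)" "1 \<in> Range E"
    using piso_psub_Range piso_good(2) piso_1 by (metis, metis, metis Range.intros)
qed

lemma closed_tower_RN:
  assumes A: "psub A" "good A" "1 \<in> A" and E: "closed_tower A ds E" and x: "x \<in> RN"
  shows "\<exists>ds' E'. closed_tower A ds' E' \<and> Range E \<subseteq> Range E' \<and> x \<in> Range E'"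
proof (cases "x \<in> Range E")
  case True then show ?thesis using E by blast
next
  case False
  note R = closed_tower_facts[OF A E]
  have t: "tower A ds E" and cl: "chain_closed_in UNIV (Range E)" using E by (auto simp: closed_tower_def)
  have nonstandard: "nonstandard x" using std_iff[OF x] psub_of_nat[OF R(1,3)] False by auto
  have out: "shifted x k \<notin> Range E" for k
    using cl linked_sym[OF linked_shifted[OF nonstandard]] x False unfolding chain_closed_in_def by (metis IntI UNIV_I shifted_RN)
  have t': "tower A ((True, residues True x) # ds) (adjoin E True x)" by (rule tower.chain[OF t x nonstandard out])
  have members: "members True x = shifted x" by (simp add: members_def fun_eq_iff)
  have all: "shifted x k \<in> Range (adjoin E True x)" for k
    unfolding adjoin_Range members
    by (intro exI[of _ 1] exI[of _ 0] exI[of _ "[(1, k)]"]) (simp add: psub_0[OF R(1)])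
  have "chain_closed_in UNIV (Range (adjoin E True x))" unfolding chain_closed_in_def
  proof (intro allI impI)
    fix s s' assume s: "s \<in> RN \<inter> Range (adjoin E True x)" and s': "s' \<in> RN \<inter> UNIV" and l: "linked s s'"
    then obtain n z l where 1: "n \<noteq> 0" "z \<in> Range E" "of_int n * s = z + lin (shifted x) l"
      unfolding Int_iff adjoin_Range members by blast
    have "s \<in> Range E \<or> (\<exists>j. s = shifted x j)"
      using chain_element[OF R(1,2) nonstandard x _ 1(2,1,3)] out s by blast
    then show "s' \<in> Range (adjoin E True x)"
    proof
      assume "s \<in> Range E"
      then have "s' \<in> Range E" using cl s s' l unfolding chain_closed_in_def by blast
      then show ?thesis using adjoin_mono by blast
    next
      assume "\<exists>j. s = shifted x j"
      then have "linked x s" using linked_shifted[OF nonstandard] by blast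
      then obtain k where "s' = shifted x k" using linkedE[OF nonstandard, of s'] s' l linked_trans by blast
      then show ?thesis using all by simp
    qed
  qed
  moreover have "x \<in> Range (adjoin E True x)" using all[of 0] shifted_0[OF x] by simp
  ultimately show ?thesis using t' adjoin_mono[of E] unfolding closed_tower_def by blast
qed

lemma closed_tower_RN_list:
  assumes A: "psub A" "good A" "1 \<in> A" and E: "closed_tower A ds E" and xs: "set xs \<subseteq> RN"
  shows "\<exists>ds' E'. closed_tower A ds' E' \<and> Range E \<subseteq> Range E' \<and> set xs \<subseteq> Range E'"
  using xs
proof (induction xs)
  case Nil then show ?case using E by auto
next
  case (Cons x xs)
  then obtain ds1 E1 where 1: "closed_tower A ds1 E1" "Range E \<subseteq> Range E1" "set xs \<subseteq> Range E1" by auto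
  obtain ds2 E2 where 2: "closed_tower A ds2 E2" "Range E1 \<subseteq> Range E2" "x \<in> Range E2"
    using closed_tower_RN[OF A 1(1), of x] Cons.prems by auto
  have "set (x # xs) \<subseteq> Range E2" "Range E \<subseteq> Range E2" using 1 2 by auto
  then show ?case using 2(1) by blast
qed

text \<open>A generic element can be added as such. Otherwise a multiple of it is the sum of an
  old element and a combination of members of \<open>R\<close>, and the chains of these are added.\<close>

lemma closed_tower_extend:
  assumes A: "psub A" "good A" "1 \<in> A" and E: "closed_tower A ds E"
  shows "\<exists>ds' E'. closed_tower A ds' E' \<and> Range E \<subseteq> Range E' \<and> x \<in> Range E'"
proof (cases "generic (Range E) x")
  case True
  note R = closed_tower_facts[OF A E]
  have t: "tower A ds E" and cl: "chain_closed_in UNIV (Range E)" using E by (auto simp: closed_tower_def)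
  have t': "tower A ((False, residues False x) # ds) (adjoin E False x)" by (rule tower.generic[OF t True])
  have const: "members False x = (\<lambda>_. x)" by (simp add: members_def fun_eq_iff)
  have lin_members: "\<exists>c. lin (members False x) l = of_int c * x" for l
    unfolding const
  proof (induction l)
    case Nil then show ?case by (intro exI[of _ 0]) simp
  next
    case (Cons p l)
    then obtain c where "lin (\<lambda>_. x) l = of_int c * x" by blast
    then show ?case
      by (intro exI[of _ "fst p + c"]) (cases p, simp add: algebra_simps)
  qed
  have old: "s \<in> Range E" if "s \<in> RN" "s \<in> Range (adjoin E False x)" for s
  proof -
    from that(2) obtain n z l where 1: "n \<noteq> 0" "z \<in> Range E" "of_int n * s = z + lin (members False x) l"
      unfolding adjoin_Range by blast
    obtain c where c: "lin (members False x) l = of_int c * x" using lin_members by blast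
    have "of_int c * x = - z + lin id [(n, s)]" using 1(3) c by (simp add: algebra_simps)
    then have "c = 0" using genericD[OF True, of "- z" "[(n, s)]" c] psub_minus[OF R(1) 1(2)] that(1) by simp
    then have "of_int n * s \<in> Range E" using 1 c by simp
    then show ?thesis by (rule psub_pure[OF R(1) 1(1)])
  qed
  have "chain_closed_in UNIV (Range (adjoin E False x))" unfolding chain_closed_in_def
    using old cl adjoin_mono[of E False x] unfolding chain_closed_in_def by blast
  moreover have "x \<in> Range (adjoin E False x)" unfolding adjoin_Range
    by (intro exI[of _ 1] exI[of _ 0] exI[of _ "[(1, 0)]"]) (simp add: psub_0[OF R(1)] members_def)
  ultimately show ?thesis using t' adjoin_mono[of E] unfolding closed_tower_def by blast
next
  case False
  then obtain n a l where 1: "n \<noteq> 0" "a \<in> Range E" "snd ` set l \<subseteq> RN" "of_int n * x = a + lin id l"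
    by (auto simp: generic_def)
  obtain ds' E' where 2: "closed_tower A ds' E'" "Range E \<subseteq> Range E'" "set (map snd l) \<subseteq> Range E'"
    using closed_tower_RN_list[OF A E, of "map snd l"] 1(3) by auto
  note R = closed_tower_facts[OF A 2(1)]
  have "of_int n * x \<in> Range E'" unfolding 1(4)
    by (intro psub_add[OF R(1)] psub_lin[OF R(1)]) (use 1 2 in auto)
  then have "x \<in> Range E'" by (rule psub_pure[OF R(1) 1(1)])
  then show ?thesis using 2 by blast
qed

lemma closed_tower_list:
  assumes A: "psub A" "good A" "1 \<in> A" "chain_closed_in UNIV A"
  shows "\<exists>ds E. closed_tower A ds E \<and> set xs \<subseteq> Range E"
proof (induction xs)
  case Nil
  have "Range (base_names A) = A" by (auto simp: base_names_def)
  then have "closed_tower A [] (base_names A)"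
    using A(4) by (simp add: closed_tower_def tower.base)
  then show ?case by auto
next
  case (Cons x xs)
  then obtain ds E where "closed_tower A ds E" "set xs \<subseteq> Range E" by blast
  with closed_tower_extend[OF A(1-3), of ds E x] obtain ds' E' where
    "closed_tower A ds' E'" "set xs \<subseteq> Range E'" "x \<in> Range E'" by blast
  then show ?case by auto
qed

text \<open>The parameters and names involve finitely many elements of \<open>A\<close>. Over a countable good
  subgroup containing these, matching equal names is a countable partial isomorphism.\<close>

lemma same_names_teq:
  assumes A: "psub A" "good A" "1 \<in> A" and E: "tower A ds E" and F: "tower A ds F"
    and xs: "length xs = length cs" "set (zip cs xs) \<subseteq> E" and ys: "length ys = length cs" "set (zip cs ys) \<subseteq> F"
    and us: "set us \<subseteq> A"
  shows "teq (xs @ us) (ys @ us)"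
proof -
  have csA: "fst ` set cs \<subseteq> A"
  proof
    fix a assume "a \<in> fst ` set cs"
    then obtain c where c: "c \<in> set cs" "a = fst c" by blast
    then obtain x where "(c, x) \<in> set (zip cs xs)" using xs(1) by (metis in_set_impl_in_set_zip1)
    then have "c \<in> Domain E" using xs(2) by blast
    then show "a \<in> A" using tower_Domain[OF E] c(2) by auto
  qed
  have "set us \<union> fst ` set cs \<subseteq> A" using us csA by blast
  moreover have "countable (set us \<union> fst ` set cs)" by (rule countable_finite) simp
  ultimately obtain B where B: "set us \<union> fst ` set cs \<subseteq> B" "B \<subseteq> A" "psub B" "good B" "1 \<in> B" "countable B"
    by (rule countable_good_hull[OF A]) blast
  define E' where "E' = {p \<in> E. fst (fst p) \<in> B}"
  define F' where "F' = {p \<in> F. fst (fst p) \<in> B}"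
  have t: "tower B ds E'" "tower B ds F'" unfolding E'_def F'_def by (rule tower_restrict[OF E B(2)], rule tower_restrict[OF F B(2)])
  have piso: "piso (E'\<inverse> O F')" by (rule tower_piso[OF B(3-5) t])
  have "E'\<inverse> O F' \<subseteq> (\<lambda>(p, q). (snd p, snd q)) ` (E' \<times> F')" by force
  then have "countable (E'\<inverse> O F')"
    by (rule countable_subset) (use tower_countable[OF t(1) B(6)] tower_countable[OF t(2) B(6)] in auto)
  with piso show ?thesis
  proof (rule piso_teq_zip)
    show "length (xs @ us) = length (ys @ us)" using xs ys by simp
    have "(u, u) \<in> E'\<inverse> O F'" if "u \<in> set us" for u
      using tower_base_name[OF t(1), of u] tower_base_name[OF t(2), of u] that B(1) by blast
    moreover have "set (zip xs ys) \<subseteq> E'\<inverse> O F'"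
    proof
      fix p assume "p \<in> set (zip xs ys)"
      then obtain i where i: "i < length cs" "p = (xs ! i, ys ! i)" using xs(1) ys(1) by (auto simp: set_zip)
      have "(cs ! i, xs ! i) \<in> set (zip cs xs)" "(cs ! i, ys ! i) \<in> set (zip cs ys)"
        using xs(1) ys(1) i(1) by (auto simp: set_zip)
      then have "(cs ! i, xs ! i) \<in> E" "(cs ! i, ys ! i) \<in> F" using xs(2) ys(2) by blast+
      moreover have "fst (cs ! i) \<in> B" using B(1) i(1) by auto
      ultimately show "p \<in> E'\<inverse> O F'" unfolding i(2) E'_def F'_def by auto
    qed
    ultimately show "set (zip (xs @ us) (ys @ us)) \<subseteq> E'\<inverse> O F'"
      using xs(1) ys(1) by (auto simp: zip_same)
  qed
qed

end

context embedded_model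
begin

text \<open>A type over \<open>A\<close> is realized by a tuple in a tower over a hull \<open>C\<close> of \<open>A\<close> of size at
  most \<open>\<kappa>\<close>. It is determined by the residues of the tower, which are finitely many sets of
  triples of integers, and the names of the tuple.\<close>

theorem card_types_le:
  fixes \<kappa> :: "'k rel"
  assumes \<kappa>: "Card_order \<kappa>" "|UNIV :: nat set set| \<le>o \<kappa>" and A: "|A| \<le>o \<kappa>"
  shows "|types M n A| \<le>o \<kappa>"
proof -
  have inf: "\<not> finite (Field \<kappa>)"
  proof
    assume "finite (Field \<kappa>)"
    moreover have "|UNIV :: nat set set| \<le>o |Field \<kappa>|"
      using \<kappa>(2) ordIso_symmetric[OF card_of_Field_ordIso[OF \<kappa>(1)]] by (rule ordLeq_ordIso_trans)
    ultimately have "finite (UNIV :: nat set set)" using card_of_ordLeq_infinite by blast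
    then show False by (simp add: Finite_Set.finite_set)
  qed
  note \<kappa>' = \<kappa>(1) inf
  have "|h ` A| \<le>o \<kappa>" using A by (rule card_of_image_le)
  then obtain C where C: "h ` A \<subseteq> C" "psub C" "good C" "1 \<in> C" "chain_closed_in UNIV C" "|C| \<le>o \<kappa>"
    by (rule good_hull[OF psub_UNIV good_UNIV UNIV_I subset_UNIV \<kappa>']) blast
  have "\<exists>d xs E. length xs = n \<and> p = tpN A xs \<and> tower C (fst d) E \<and>
      length xs = length (snd d) \<and> set (zip (snd d) xs) \<subseteq> E" if p: "p \<in> types M n A" for p
  proof -
    have "finitely_sat M n p" "p \<subseteq> Forms n UNIV"
      using p Forms_mono[of A UNIV n] by (auto simp: types_def)
    from realize[OF this] obtain xs where xs: "length xs = n" "\<forall>f\<in>p. Nholds xs f"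
      unfolding Nholds_def case_prod_unfold by blast
    have "p = tpN A xs" using p xs by (rule types_eq_tpN)
    moreover obtain ds E where E: "closed_tower C ds E" "set xs \<subseteq> Range E"
      using closed_tower_list[OF C(2-5), of xs] by blast
    have "\<forall>x\<in>set xs. \<exists>c. (c, x) \<in> E" using E(2) by blast
    then obtain g where g: "\<forall>x\<in>set xs. (g x, x) \<in> E" by metis
    have "set (zip (map g xs) xs) \<subseteq> E" using g by (auto simp: set_zip)
    then show ?thesis
      using xs(1) \<open>p = tpN A xs\<close> E(1) by (intro exI[of _ "(ds, map g xs)"] exI[of _ xs] exI[of _ E]) (simp add: closed_tower_def)
  qed
  then obtain d xs E where d: "\<And>p. p \<in> types M n A \<Longrightarrow> length (xs p) = n \<and> p = tpN A (xs p) \<and>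
      tower C (fst (d p)) (E p) \<and> length (xs p) = length (snd (d p)) \<and> set (zip (snd (d p)) (xs p)) \<subseteq> E p" by metis
  define X where "X = lists (UNIV :: (bool \<times> (int \<times> int \<times> int) set) set) \<times> lists (C \<times> (UNIV :: step_code list set))"
  have "inj_on d (types M n A)"
  proof (rule inj_onI)
    fix p q assume p: "p \<in> types M n A" and q: "q \<in> types M n A" and eq: "d p = d q"
    have "teq (xs p @ map h bs) (xs q @ map h bs)" if "bs \<in> lists A" for bs
      by (rule same_names_teq[OF C(2-4), of "fst (d p)" "E p" "E q" _ "snd (d p)"])
        (use d[OF p] d[OF q] eq that C(1) in auto)
    then have "tpN A (xs p) = tpN A (xs q)"
      using tpN_eq_iff[of A "xs p" "xs q"] d[OF p] d[OF q] by simp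
    then show "p = q" using d[OF p] d[OF q] by metis
  qed
  moreover have "d ` types M n A \<subseteq> X"
  proof
    fix y assume "y \<in> d ` types M n A"
    then obtain p where p: "p \<in> types M n A" "y = d p" by blast
    have "c \<in> C \<times> UNIV" if c: "c \<in> set (snd (d p))" for c
    proof -
      obtain x where "(c, x) \<in> set (zip (snd (d p)) (xs p))"
        using c d[OF p(1)] by (metis in_set_impl_in_set_zip1)
      then have "c \<in> Domain (E p)" using d[OF p(1)] by blast
      then show ?thesis using tower_Domain d[OF p(1)] by blast
    qed
    then show "y \<in> X" unfolding X_def p(2) by (cases "d p") auto
  qed
  ultimately have "|types M n A| \<le>o |X|" using card_of_ordLeq by blast
  moreover have "|X| \<le>o \<kappa>"
  proof -
    have "inj (\<lambda>S :: (int \<times> int \<times> int) set. to_nat ` S)" by (simp add: inj_image_eq_iff inj_def)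
    then have "|UNIV :: (int \<times> int \<times> int) set set| \<le>o |UNIV :: nat set set|"
      using card_of_ordLeq by blast
    then have residues: "|UNIV :: (int \<times> int \<times> int) set set| \<le>o \<kappa>" using \<kappa>(2) ordLeq_transitive by blast
    have codes: "|UNIV :: bool set| \<le>o \<kappa>" "|UNIV :: step_code list set| \<le>o \<kappa>"
      by (intro countable_le_infinite[OF \<kappa>'] countableI_type)+
    show ?thesis unfolding X_def UNIV_Times_UNIV[symmetric]
      by (intro card_of_Times_ordLeq_infinite_Field[OF inf _ _ \<kappa>(1)] card_of_lists_le[OF \<kappa>'] residues codes C(6))
  qed
  ultimately show ?thesis by (rule ordLeq_transitive)
qed

end

theorem theoremA:
  fixes R :: "nat set" and r :: "nat \<Rightarrow> nat"
  assumes "regular r" and "R = range r"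
  shows "superstable TYPE('m) TYPE('k) (Th (Z_struc R)) \<and>
         lascar_rank TYPE('m) (Th (Z_struc R)) natLeq"
proof -
  interpret regular_sequence r by unfold_locales (rule assms(1))
  have embed: "\<exists>h. embedded_model r M h" if "model M (Th (Z_struc R))" for M :: "'m struc"
  proof -
    have "model M (Th Z)" using that assms(2) by simp
    from elementary_embedding[OF this] obtain h :: "'m \<Rightarrow> 'm pfm hyp" where
      "\<And>v \<phi>. sat M v \<phi> \<longleftrightarrow> sat N (h \<circ> v) \<phi>"
      "\<And>n \<Phi>. finitely_sat M n \<Phi> \<Longrightarrow> \<Phi> \<subseteq> Forms n UNIV \<Longrightarrow>
        \<exists>xs. length xs = n \<and> (\<forall>(\<phi>, bs)\<in>\<Phi>. sat N ((!) (xs @ map h bs)) \<phi>)" by metis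
    then have "embedded_model r M h" by unfold_locales
    then show ?thesis by blast
  qed
  have "superstable TYPE('m) TYPE('k) (Th (Z_struc R))"
    unfolding superstable_def stable_in_def
  proof (intro allI impI)
    fix \<kappa> :: "'k rel" and M :: "'m struc" and A :: "'m set" and n :: nat
    assume \<kappa>: "Card_order \<kappa> \<and> |UNIV :: nat set set| \<le>o \<kappa>" and M: "model M (Th (Z_struc R))" and A: "|A| \<le>o \<kappa>"
    obtain h where "embedded_model r M h" using embed[OF M] by blast
    then show "|types M n A| \<le>o \<kappa>" using \<kappa> A by (intro embedded_model.card_types_le) auto
  qed
  moreover have "lascar_rank TYPE('m) (Th (Z_struc R)) natLeq"
    unfolding lascar_rank_def
  proof (intro conjI natLeq_Well_order allI impI ballI)
    fix \<kappa> :: "'m rel" and M :: "'m struc"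
    assume M: "model M (Th (Z_struc R)) \<and> monster \<kappa> M"
    then obtain h where h: "embedded_model r M h" using embed by blast
    show "\<not> U_gt \<kappa> M natLeq {} p" for p
      using embedded_model.not_U_gt_omega[OF h] M by blast
    show "\<exists>p\<in>types M 1 {}. U_gt \<kappa> M \<beta> {} p" if "\<beta> <o natLeq" for \<beta> :: "nat rel"
      using embedded_model.U_gt_finite[OF h] M that by blast
  qed
  ultimately show ?thesis ..
qed

end
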